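(* Let $\mathcal{C}$ be a pivotal fusion category and let $\mathcal{M}$ be a $\mathcal{C}$-module category with a $\mathcal{C}$-module trace. For all non-zero $m\in\mathcal{M}$, the inner hom algebra $\underline{\mathrm{Hom}}(m,m)$ is a Frobenius algebra in $\mathcal{C}$. If $m$ is a simple object, then $\underline{\mathrm{Hom}}(m,m)$ is a special haploid symmetric Frobenius algebra with $\dim^{\mathcal{C}}(\underline{\mathrm{Hom}}(m,m))>0$.
   Context: All categories are abelian and locally finite over $\mathbb{C}$. A fusion category is a semisimple rigid monoidal $\mathbb{C}$-linear category with tensor product bilinear on morphisms, simple unit $1$ and finitely many isomorphism classes of simple objects (treated as strict). The right dual of $c$ is $c^{*}$ with $\mathrm{ev}_c:c^{*}\otimes c\to1$, $\mathrm{coev}_c:1\to c\otimes c^{*}$; the left dual is ${}^{*}c$ with $\mathrm{ev}'_c:c\otimes{}^{*}c\to1$, $\mathrm{coev}'_c:1\to{}^{*}c\otimes c$; $({}^{*}c)^{*}\cong c\cong{}^{*}(c^{*})$ canonically, treated as identities. A pivotal structure is a monoidal natural isomorphism $a:\mathrm{id}\to(-)^{**}$; $\mathrm{tr}^{L}_c(f)=\mathrm{ev}_c\circ(a_{{}^{*}c}\otimes f)\circ\mathrm{coev}'_c$ and $\dim^{\mathcal{C}}(c)=\mathrm{tr}^{L}_c(\mathrm{id}_c)\in\mathbb{C}$. A (left) $\mathcal{C}$-module category is a semisimple $\mathbb{C}$-linear abelian category $\mathcal{M}$ with a bifunctor $\triangleright:\mathcal{C}\times\mathcal{M}\to\mathcal{M}$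 and natural isomorphisms $(c\otimes d)\triangleright m\cong c\triangleright(d\triangleright m)$, $1\triangleright m\cong m$ satisfying the usual pentagon and triangle axioms (suppressed below). For $f\in\mathrm{End}_{\mathcal{M}}(c\triangleright m)$ put $\mathrm{tr}^{\mathcal{C}}(f)=(\mathrm{ev}_c\triangleright\mathrm{id}_m)\circ(a_{{}^{*}c}\triangleright f)\circ(\mathrm{coev}'_c\triangleright\mathrm{id}_m)$. A $\mathcal{C}$-module trace on $\mathcal{M}$ is a family of linear maps $\Theta_m:\mathrm{End}_{\mathcal{M}}(m)\to\mathbb{C}$ that is symmetric ($\Theta_m(g\circ f)=\Theta_n(f\circ g)$ for $f:m\to n$, $g:n\to m$), non-degenerate (the pairing $(f,g)\mapsto\Theta_m(g\circ f)$ on $\mathrm{Hom}(m,n)\times\mathrm{Hom}(n,m)$ is non-degenerate for all $m,n$) and $\mathcal{C}$-compatible ($\Theta_{c\triangleright m}=\Theta_m\circ\mathrm{tr}^{\mathcal{C}}$). The inner hom $\underline{\mathrm{Hom}}(m,n)\in\mathcal{C}$ is an object with isomorphisms $\alpha:\mathrm{Hom}_{\mathcal{M}}(c\triangleright m,n)\cong\mathrm{Hom}_{\mathcal{C}}(c,\underline{\mathrm{Hom}}(m,n))$ natural in $c$. Let $\mathrm{ev}_{n,m}=\alpha^{-1}(\mathrm{id}):\underline{\mathrm{Hom}}(n,m)\triangleright n\to m$. The algebra structure on $\underline{\mathrm{Hom}}(m,m)$ has multiplication $\alpha(\mathrm{ev}_{m,m}\circ(\mathrm{id}\triangleright\mathrm{ev}_{m,m}))$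 and unit the image under $\alpha$ of $\mathrm{id}_m\in\mathrm{Hom}_{\mathcal{M}}(1\triangleright m,m)$. An algebra $(A,\mu,\eta)$ is haploid if $\mathrm{Hom}_{\mathcal{C}}(1,A)\cong\mathbb{C}$. A Frobenius algebra is an algebra $(A,\mu,\eta)$ together with a coassociative counital coalgebra structure $(\Delta,\epsilon)$ on $A$ with $\Delta\circ\mu=(\mu\otimes\mathrm{id}_A)\circ(\mathrm{id}_A\otimes\Delta)=(\mathrm{id}_A\otimes\mu)\circ(\Delta\otimes\mathrm{id}_A)$. It is special if $\epsilon\circ\eta=\beta_1\mathrm{id}_1$ and $\mu\circ\Delta=\beta_A\mathrm{id}_A$ with $\beta_1,\beta_A\in\mathbb{C}^{\times}$. It is symmetric if $(\epsilon\mu\otimes\mathrm{id}_{A^{*}})\circ(\mathrm{id}_A\otimes\mathrm{coev}_A)=a_{{}^{*}A}\circ(\mathrm{id}_{{}^{*}A}\otimes\epsilon\mu)\circ(\mathrm{coev}'_A\otimes\mathrm{id}_A)$ as morphisms $A\to A^{*}$. The claim is that the inner hom algebra carries a coalgebra structure with the stated properties. *)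

theory Defs
  imports Complex_Main "HOL-Algebra.Module"
begin

section \<open>Complex vector spaces as modules over a ring record\<close>

definition complex_ring :: "complex ring" where
  "complex_ring = \<lparr>carrier = UNIV, mult = (*), one = 1, zero = 0, add = (+)\<rparr>"

definition complex_module :: "(complex, complex) module" where
  "complex_module = \<lparr>carrier = UNIV, mult = (*), one = 1, zero = 0, add = (+), smult = (*)\<rparr>"

definition linear_map ::
  "(complex, 'a) module \<Rightarrow> (complex, 'b) module \<Rightarrow> ('a \<Rightarrow> 'b) \<Rightarrow> bool" where
  "linear_map V W \<phi> \<longleftrightarrow>
     \<phi> \<in> carrier V \<rightarrow> carrier W \<and>
     (\<forall>u\<in>carrier V. \<forall>v\<in>carrier V. \<phi> (u \<oplus>\<^bsub>V\<^esub> v) = \<phi> u \<oplus>\<^bsub>W\<^esub> \<phi> v) \<and>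
     (\<forall>z. \<forall>v\<in>carrier V. \<phi> (z \<odot>\<^bsub>V\<^esub> v) = z \<odot>\<^bsub>W\<^esub> \<phi> v)"

definition linear_iso ::
  "(complex, 'a) module \<Rightarrow> (complex, 'b) module \<Rightarrow> ('a \<Rightarrow> 'b) \<Rightarrow> bool" where
  "linear_iso V W \<phi> \<longleftrightarrow> linear_map V W \<phi> \<and> bij_betw \<phi> (carrier V) (carrier W)"

definition finite_dimensional :: "(complex, 'a) module \<Rightarrow> bool" where
  "finite_dimensional V \<longleftrightarrow>
     (\<exists>B. finite B \<and> B \<subseteq> carrier V \<and>
        (\<forall>v\<in>carrier V. \<exists>k. v = (\<Oplus>\<^bsub>V\<^esub>b\<in>B. k b \<odot>\<^bsub>V\<^esub> b)))"


section \<open>Linear categories\<close>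

record ('o, 'a) lin_cat =
  Obj :: "'o set"
  Arr :: "'a set"
  Dom :: "'a \<Rightarrow> 'o"
  Cod :: "'a \<Rightarrow> 'o"
  ident :: "'o \<Rightarrow> 'a"
  Comp :: "'a \<Rightarrow> 'a \<Rightarrow> 'a" (infixl "\<cdot>\<index>" 55)
  Zero :: "'o \<Rightarrow> 'o \<Rightarrow> 'a"
  Add :: "'a \<Rightarrow> 'a \<Rightarrow> 'a"
  Scale :: "complex \<Rightarrow> 'a \<Rightarrow> 'a"

definition Hom :: "('o, 'a, 'x) lin_cat_scheme \<Rightarrow> 'o \<Rightarrow> 'o \<Rightarrow> 'a set" where
  "Hom C x y = {f \<in> Arr C. Dom C f = x \<and> Cod C f = y}"

text \<open>The record type of modules extends that of rings; the fields \<open>mult\<close> and \<open>one\<close> play no role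
  in the notion of a module and are filled with junk.\<close>

definition hom_module :: "('o, 'a, 'x) lin_cat_scheme \<Rightarrow> 'o \<Rightarrow> 'o \<Rightarrow> (complex, 'a) module" where
  "hom_module C x y =
     \<lparr>carrier = Hom C x y, mult = (\<lambda>_ _. Zero C x y), one = Zero C x y,
      zero = Zero C x y, add = Add C, smult = Scale C\<rparr>"

locale linear_category =
  fixes C :: "('o, 'a, 'x) lin_cat_scheme" (structure)
  assumes Dom_in: "f \<in> Arr C \<Longrightarrow> Dom C f \<in> Obj C"
    and Cod_in: "f \<in> Arr C \<Longrightarrow> Cod C f \<in> Obj C"
    and ident_in: "x \<in> Obj C \<Longrightarrow> ident C x \<in> Hom C x x"
    and comp_in: "f \<in> Hom C x y \<Longrightarrow> g \<in> Hom C y z \<Longrightarrow> g \<cdot> f \<in> Hom C x z"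
    and comp_assoc: "f \<in> Hom C w x \<Longrightarrow> g \<in> Hom C x y \<Longrightarrow> h \<in> Hom C y z \<Longrightarrow>
          h \<cdot> g \<cdot> f = h \<cdot> (g \<cdot> f)"
    and comp_ident_right: "f \<in> Hom C x y \<Longrightarrow> f \<cdot> ident C x = f"
    and comp_ident_left: "f \<in> Hom C x y \<Longrightarrow> ident C y \<cdot> f = f"
    and module_Hom: "x \<in> Obj C \<Longrightarrow> y \<in> Obj C \<Longrightarrow> module complex_ring (hom_module C x y)"
    and comp_linear_left: "f \<in> Hom C x y \<Longrightarrow> z \<in> Obj C \<Longrightarrow>
          linear_map (hom_module C y z) (hom_module C x z) (\<lambda>g. g \<cdot> f)"
    and comp_linear_right: "g \<in> Hom C y z \<Longrightarrow> x \<in> Obj C \<Longrightarrow>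
          linear_map (hom_module C x y) (hom_module C x z) (\<lambda>f. g \<cdot> f)"

definition iso_arr :: "('o, 'a, 'x) lin_cat_scheme \<Rightarrow> 'a \<Rightarrow> bool" where
  "iso_arr C f \<longleftrightarrow> f \<in> Arr C \<and>
     (\<exists>g \<in> Hom C (Cod C f) (Dom C f).
        g \<cdot>\<^bsub>C\<^esub> f = ident C (Dom C f) \<and> f \<cdot>\<^bsub>C\<^esub> g = ident C (Cod C f))"

definition inv_arr :: "('o, 'a, 'x) lin_cat_scheme \<Rightarrow> 'a \<Rightarrow> 'a" where
  "inv_arr C f =
     (THE g. g \<in> Hom C (Cod C f) (Dom C f) \<and>
        g \<cdot>\<^bsub>C\<^esub> f = ident C (Dom C f) \<and> f \<cdot>\<^bsub>C\<^esub> g = ident C (Cod C f))"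

definition isomorphic :: "('o, 'a, 'x) lin_cat_scheme \<Rightarrow> 'o \<Rightarrow> 'o \<Rightarrow> bool" where
  "isomorphic C x y \<longleftrightarrow> (\<exists>f \<in> Hom C x y. iso_arr C f)"

definition monic :: "('o, 'a, 'x) lin_cat_scheme \<Rightarrow> 'a \<Rightarrow> bool" where
  "monic C f \<longleftrightarrow> f \<in> Arr C \<and>
     (\<forall>w \<in> Obj C. \<forall>g \<in> Hom C w (Dom C f). \<forall>h \<in> Hom C w (Dom C f).
        f \<cdot>\<^bsub>C\<^esub> g = f \<cdot>\<^bsub>C\<^esub> h \<longrightarrow> g = h)"

definition epic :: "('o, 'a, 'x) lin_cat_scheme \<Rightarrow> 'a \<Rightarrow> bool" where
  "epic C f \<longleftrightarrow> f \<in> Arr C \<and>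
     (\<forall>w \<in> Obj C. \<forall>g \<in> Hom C (Cod C f) w. \<forall>h \<in> Hom C (Cod C f) w.
        g \<cdot>\<^bsub>C\<^esub> f = h \<cdot>\<^bsub>C\<^esub> f \<longrightarrow> g = h)"

definition zero_object :: "('o, 'a, 'x) lin_cat_scheme \<Rightarrow> 'o \<Rightarrow> bool" where
  "zero_object C z \<longleftrightarrow> z \<in> Obj C \<and>
     (\<forall>x \<in> Obj C. (\<exists>!f. f \<in> Hom C x z) \<and> (\<exists>!f. f \<in> Hom C z x))"

definition is_kernel :: "('o, 'a, 'x) lin_cat_scheme \<Rightarrow> 'a \<Rightarrow> 'a \<Rightarrow> bool" where
  "is_kernel C f k \<longleftrightarrow> f \<in> Arr C \<and> k \<in> Arr C \<and> Cod C k = Dom C f \<and>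
     f \<cdot>\<^bsub>C\<^esub> k = Zero C (Dom C k) (Cod C f) \<and>
     (\<forall>w \<in> Obj C. \<forall>h \<in> Hom C w (Dom C f). f \<cdot>\<^bsub>C\<^esub> h = Zero C w (Cod C f) \<longrightarrow>
        (\<exists>!u. u \<in> Hom C w (Dom C k) \<and> k \<cdot>\<^bsub>C\<^esub> u = h))"

definition is_cokernel :: "('o, 'a, 'x) lin_cat_scheme \<Rightarrow> 'a \<Rightarrow> 'a \<Rightarrow> bool" where
  "is_cokernel C f q \<longleftrightarrow> f \<in> Arr C \<and> q \<in> Arr C \<and> Dom C q = Cod C f \<and>
     q \<cdot>\<^bsub>C\<^esub> f = Zero C (Dom C f) (Cod C q) \<and>
     (\<forall>w \<in> Obj C. \<forall>h \<in> Hom C (Cod C f) w. h \<cdot>\<^bsub>C\<^esub> f = Zero C (Dom C f) w \<longrightarrow>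
        (\<exists>!u. u \<in> Hom C (Cod C q) w \<and> u \<cdot>\<^bsub>C\<^esub> q = h))"

text \<open>\<open>s\<close> is the direct sum of \<open>X 0, \<dots>, X (n - 1)\<close> with injections \<open>\<iota> k\<close> and projections \<open>\<pi> k\<close>.\<close>

definition direct_sum ::
  "('o, 'a, 'x) lin_cat_scheme \<Rightarrow> nat \<Rightarrow> (nat \<Rightarrow> 'o) \<Rightarrow> 'o \<Rightarrow> (nat \<Rightarrow> 'a) \<Rightarrow> (nat \<Rightarrow> 'a) \<Rightarrow> bool" where
  "direct_sum C n X s \<iota> \<pi> \<longleftrightarrow> s \<in> Obj C \<and>
     (\<forall>k<n. X k \<in> Obj C \<and> \<iota> k \<in> Hom C (X k) s \<and> \<pi> k \<in> Hom C s (X k)) \<and>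
     (\<forall>j<n. \<forall>k<n. \<pi> j \<cdot>\<^bsub>C\<^esub> \<iota> k = (if j = k then ident C (X k) else Zero C (X k) (X j))) \<and>
     (\<Oplus>\<^bsub>hom_module C s s\<^esub>k\<in>{..<n}. \<iota> k \<cdot>\<^bsub>C\<^esub> \<pi> k) = ident C s"

definition simple :: "('o, 'a, 'x) lin_cat_scheme \<Rightarrow> 'o \<Rightarrow> bool" where
  "simple C x \<longleftrightarrow> x \<in> Obj C \<and> \<not> zero_object C x \<and>
     (\<forall>i. monic C i \<and> Cod C i = x \<longrightarrow> zero_object C (Dom C i) \<or> iso_arr C i)"

inductive has_finite_length :: "('o, 'a, 'x) lin_cat_scheme \<Rightarrow> 'o \<Rightarrow> bool"
  for C :: "('o, 'a, 'x) lin_cat_scheme" where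
  zero: "zero_object C x \<Longrightarrow> has_finite_length C x"
| extend: "has_finite_length C y \<Longrightarrow> i \<in> Hom C y x \<Longrightarrow> monic C i \<Longrightarrow>
     is_cokernel C i q \<Longrightarrow> simple C (Cod C q) \<Longrightarrow> has_finite_length C x"

locale abelian_category = linear_category +
  assumes zero_object_ex: "\<exists>z. zero_object C z"
    and direct_sum_ex: "(\<And>k. k < n \<Longrightarrow> X k \<in> Obj C) \<Longrightarrow> \<exists>s \<iota> \<pi>. direct_sum C n X s \<iota> \<pi>"
    and kernel_ex: "f \<in> Arr C \<Longrightarrow> \<exists>k. is_kernel C f k"
    and cokernel_ex: "f \<in> Arr C \<Longrightarrow> \<exists>q. is_cokernel C f q"
    and monic_is_kernel: "monic C k \<Longrightarrow> \<exists>f. is_kernel C f k"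
    and epic_is_cokernel: "epic C q \<Longrightarrow> \<exists>f. is_cokernel C f q"

locale locally_finite_category = abelian_category +
  assumes finite_dimensional_Hom:
      "x \<in> Obj C \<Longrightarrow> y \<in> Obj C \<Longrightarrow> finite_dimensional (hom_module C x y)"
    and finite_length: "x \<in> Obj C \<Longrightarrow> has_finite_length C x"

locale semisimple_category = locally_finite_category +
  assumes semisimple: "x \<in> Obj C \<Longrightarrow>
     \<exists>n X \<iota> \<pi>. (\<forall>k<n. simple C (X k)) \<and> direct_sum C n X x \<iota> \<pi>"


section \<open>Pivotal fusion categories\<close>

record ('o, 'a) mon_cat = "('o, 'a) lin_cat" +
  TensO :: "'o \<Rightarrow> 'o \<Rightarrow> 'o" (infixr "\<otimes>\<^sub>o\<index>" 70)
  TensM :: "'a \<Rightarrow> 'a \<Rightarrow> 'a" (infixr "\<otimes>\<^sub>m\<index>" 70)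
  unit_obj :: 'o

locale strict_monoidal_category = linear_category C
  for C :: "('o, 'a, 'x) mon_cat_scheme" (structure) +
  assumes unit_obj_in: "unit_obj C \<in> Obj C"
    and tensO_in: "x \<in> Obj C \<Longrightarrow> y \<in> Obj C \<Longrightarrow> x \<otimes>\<^sub>o y \<in> Obj C"
    and tensM_in: "f \<in> Hom C x y \<Longrightarrow> g \<in> Hom C u v \<Longrightarrow> f \<otimes>\<^sub>m g \<in> Hom C (x \<otimes>\<^sub>o u) (y \<otimes>\<^sub>o v)"
    and tensM_ident: "x \<in> Obj C \<Longrightarrow> y \<in> Obj C \<Longrightarrow> ident C x \<otimes>\<^sub>m ident C y = ident C (x \<otimes>\<^sub>o y)"
    and tensM_comp: "f \<in> Hom C x y \<Longrightarrow> f' \<in> Hom C y z \<Longrightarrow> g \<in> Hom C u v \<Longrightarrow> g' \<in> Hom C v w \<Longrightarrow>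
          (f' \<cdot> f) \<otimes>\<^sub>m (g' \<cdot> g) = (f' \<otimes>\<^sub>m g') \<cdot> (f \<otimes>\<^sub>m g)"
    and tensO_assoc: "x \<in> Obj C \<Longrightarrow> y \<in> Obj C \<Longrightarrow> z \<in> Obj C \<Longrightarrow>
          (x \<otimes>\<^sub>o y) \<otimes>\<^sub>o z = x \<otimes>\<^sub>o (y \<otimes>\<^sub>o z)"
    and tensM_assoc: "f \<in> Arr C \<Longrightarrow> g \<in> Arr C \<Longrightarrow> h \<in> Arr C \<Longrightarrow>
          (f \<otimes>\<^sub>m g) \<otimes>\<^sub>m h = f \<otimes>\<^sub>m (g \<otimes>\<^sub>m h)"
    and tensO_unit: "x \<in> Obj C \<Longrightarrow> unit_obj C \<otimes>\<^sub>o x = x" "x \<in> Obj C \<Longrightarrow> x \<otimes>\<^sub>o unit_obj C = x"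
    and tensM_unit: "f \<in> Arr C \<Longrightarrow> ident C (unit_obj C) \<otimes>\<^sub>m f = f"
          "f \<in> Arr C \<Longrightarrow> f \<otimes>\<^sub>m ident C (unit_obj C) = f"
    and tensM_linear_left: "g \<in> Hom C u v \<Longrightarrow> x \<in> Obj C \<Longrightarrow> y \<in> Obj C \<Longrightarrow>
          linear_map (hom_module C x y) (hom_module C (x \<otimes>\<^sub>o u) (y \<otimes>\<^sub>o v)) (\<lambda>f. f \<otimes>\<^sub>m g)"
    and tensM_linear_right: "f \<in> Hom C x y \<Longrightarrow> u \<in> Obj C \<Longrightarrow> v \<in> Obj C \<Longrightarrow>
          linear_map (hom_module C u v) (hom_module C (x \<otimes>\<^sub>o u) (y \<otimes>\<^sub>o v)) (\<lambda>g. f \<otimes>\<^sub>m g)"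

text \<open>\<open>y\<close> is a right dual of \<open>x\<close>, equivalently \<open>x\<close> is a left dual of \<open>y\<close>, with evaluation
  \<open>e : y \<otimes> x \<rightarrow> 1\<close> and coevaluation \<open>k : 1 \<rightarrow> x \<otimes> y\<close>.\<close>

definition dual_pair :: "('o, 'a, 'x) mon_cat_scheme \<Rightarrow> 'o \<Rightarrow> 'o \<Rightarrow> 'a \<Rightarrow> 'a \<Rightarrow> bool" where
  "dual_pair C x y e k \<longleftrightarrow> x \<in> Obj C \<and> y \<in> Obj C \<and>
     e \<in> Hom C (y \<otimes>\<^sub>o\<^bsub>C\<^esub> x) (unit_obj C) \<and> k \<in> Hom C (unit_obj C) (x \<otimes>\<^sub>o\<^bsub>C\<^esub> y) \<and>
     (ident C x \<otimes>\<^sub>m\<^bsub>C\<^esub> e) \<cdot>\<^bsub>C\<^esub> (k \<otimes>\<^sub>m\<^bsub>C\<^esub> ident C x) = ident C x \<and>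
     (e \<otimes>\<^sub>m\<^bsub>C\<^esub> ident C y) \<cdot>\<^bsub>C\<^esub> (ident C y \<otimes>\<^sub>m\<^bsub>C\<^esub> k) = ident C y"

text \<open>For \<open>f : x \<rightarrow> x'\<close>, a right dual \<open>y\<close> of \<open>x\<close> with coevaluation \<open>k\<close>, and a right dual \<open>y'\<close> of
  \<open>x'\<close> with evaluation \<open>e'\<close>, this is the transpose \<open>y' \<rightarrow> y\<close> of \<open>f\<close>. For \<open>f = id\<close> it is the canonical
  isomorphism between two right duals of the same object.\<close>

definition transp :: "('o, 'a, 'x) mon_cat_scheme \<Rightarrow> 'o \<Rightarrow> 'a \<Rightarrow> 'o \<Rightarrow> 'a \<Rightarrow> 'a \<Rightarrow> 'a" where
  "transp C y k y' e' f =
     (e' \<otimes>\<^sub>m\<^bsub>C\<^esub> ident C y) \<cdot>\<^bsub>C\<^esub> (ident C y' \<otimes>\<^sub>m\<^bsub>C\<^esub> f \<otimes>\<^sub>m\<^bsub>C\<^esub> ident C y) \<cdot>\<^bsub>C\<^esub> (ident C y' \<otimes>\<^sub>m\<^bsub>C\<^esub> k)"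

record ('o, 'a) rigid_cat = "('o, 'a) mon_cat" +
  rdual :: "'o \<Rightarrow> 'o"
  ev :: "'o \<Rightarrow> 'a"
  coev :: "'o \<Rightarrow> 'a"
  ldual :: "'o \<Rightarrow> 'o"
  lev :: "'o \<Rightarrow> 'a"
  lcoev :: "'o \<Rightarrow> 'a"

locale fusion_category = strict_monoidal_category C + semisimple_category C
  for C :: "('o, 'a, 'x) rigid_cat_scheme" (structure) +
  assumes right_dual: "c \<in> Obj C \<Longrightarrow> dual_pair C c (rdual C c) (ev C c) (coev C c)"
    and left_dual: "c \<in> Obj C \<Longrightarrow> dual_pair C (ldual C c) c (lev C c) (lcoev C c)"
    and simple_unit: "simple C (unit_obj C)"
    and finitely_many_simples:
      "\<exists>S. finite S \<and> S \<subseteq> Obj C \<and> (\<forall>x. simple C x \<longrightarrow> (\<exists>y\<in>S. isomorphic C x y))"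

definition rdualM :: "('o, 'a, 'x) rigid_cat_scheme \<Rightarrow> 'a \<Rightarrow> 'a" where
  "rdualM C f = transp C (rdual C (Dom C f)) (coev C (Dom C f)) (rdual C (Cod C f)) (ev C (Cod C f)) f"

text \<open>The canonical isomorphism \<open>c \<cong> (*c)*\<close>: both objects are right duals of \<open>*c\<close>.\<close>

definition can_ldual :: "('o, 'a, 'x) rigid_cat_scheme \<Rightarrow> 'o \<Rightarrow> 'a" where
  "can_ldual C c =
     transp C (rdual C (ldual C c)) (coev C (ldual C c)) c (lev C c) (ident C (ldual C c))"

text \<open>The canonical isomorphism \<open>d* \<otimes> c* \<cong> (c \<otimes> d)*\<close>.\<close>

definition can_tens :: "('o, 'a, 'x) rigid_cat_scheme \<Rightarrow> 'o \<Rightarrow> 'o \<Rightarrow> 'a" where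
  "can_tens C c d =
     transp C (rdual C (c \<otimes>\<^sub>o\<^bsub>C\<^esub> d)) (coev C (c \<otimes>\<^sub>o\<^bsub>C\<^esub> d)) (rdual C d \<otimes>\<^sub>o\<^bsub>C\<^esub> rdual C c)
       (ev C d \<cdot>\<^bsub>C\<^esub> (ident C (rdual C d) \<otimes>\<^sub>m\<^bsub>C\<^esub> ev C c \<otimes>\<^sub>m\<^bsub>C\<^esub> ident C d)) (ident C (c \<otimes>\<^sub>o\<^bsub>C\<^esub> d))"

record ('o, 'a) pivotal_cat = "('o, 'a) rigid_cat" +
  piv :: "'o \<Rightarrow> 'a"

text \<open>In \<open>piv_monoidal\<close>, the monoidal structure \<open>c** \<otimes> d** \<cong> (c \<otimes> d)**\<close> of the double dual is
  the composite of \<open>can_tens\<close> at \<open>d*, c*\<close> with the inverse of the transpose of \<open>can_tens\<close> at \<open>c, d\<close>;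
  the inverse is moved to the other side of the equation. Compatibility with the units follows,
  since \<open>piv\<close> is invertible.\<close>

locale pivotal_fusion_category = fusion_category C
  for C :: "('o, 'a, 'x) pivotal_cat_scheme" (structure) +
  assumes piv_in: "c \<in> Obj C \<Longrightarrow> piv C c \<in> Hom C c (rdual C (rdual C c))"
    and piv_iso: "c \<in> Obj C \<Longrightarrow> iso_arr C (piv C c)"
    and piv_natural: "f \<in> Hom C c d \<Longrightarrow> piv C d \<cdot> f = rdualM C (rdualM C f) \<cdot> piv C c"
    and piv_monoidal: "c \<in> Obj C \<Longrightarrow> d \<in> Obj C \<Longrightarrow>
          rdualM C (can_tens C c d) \<cdot> piv C (c \<otimes>\<^sub>o d)
            = can_tens C (rdual C d) (rdual C c) \<cdot> (piv C c \<otimes>\<^sub>m piv C d)"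

text \<open>The component of the pivotal structure at \<open>*c\<close>, read as a morphism \<open>*c \<rightarrow> c*\<close> along the
  canonical isomorphism \<open>(*c)** \<cong> c*\<close>.\<close>

definition piv_ldual :: "('o, 'a, 'x) pivotal_cat_scheme \<Rightarrow> 'o \<Rightarrow> 'a" where
  "piv_ldual C c = rdualM C (can_ldual C c) \<cdot>\<^bsub>C\<^esub> piv C (ldual C c)"

definition left_trace :: "('o, 'a, 'x) pivotal_cat_scheme \<Rightarrow> 'o \<Rightarrow> 'a \<Rightarrow> 'a" where
  "left_trace C c f = ev C c \<cdot>\<^bsub>C\<^esub> (piv_ldual C c \<otimes>\<^sub>m\<^bsub>C\<^esub> f) \<cdot>\<^bsub>C\<^esub> lcoev C c"

text \<open>The identification of \<open>End(1)\<close> with the complex numbers, used implicitly in dimensions.\<close>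

definition scalar_of :: "('o, 'a, 'x) mon_cat_scheme \<Rightarrow> 'a \<Rightarrow> complex" where
  "scalar_of C f = (THE z. f = Scale C z (ident C (unit_obj C)))"

definition dimension :: "('o, 'a, 'x) pivotal_cat_scheme \<Rightarrow> 'o \<Rightarrow> complex" where
  "dimension C c = scalar_of C (left_trace C c (ident C c))"


section \<open>Module categories and module traces\<close>

record ('o, 'a, 'p, 'b) mod_cat = "('p, 'b) lin_cat" +
  actO :: "'o \<Rightarrow> 'p \<Rightarrow> 'p" (infixr "\<triangleright>\<^sub>o\<index>" 65)
  actM :: "'a \<Rightarrow> 'b \<Rightarrow> 'b" (infixr "\<triangleright>\<^sub>m\<index>" 65)
  act_assoc :: "'o \<Rightarrow> 'o \<Rightarrow> 'p \<Rightarrow> 'b"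
  act_unit :: "'p \<Rightarrow> 'b"

locale module_category = C: fusion_category C + M: semisimple_category M
  for C :: "('o, 'a, 'x) rigid_cat_scheme" and M :: "('o, 'a, 'p, 'b, 'y) mod_cat_scheme" +
  assumes actO_in: "c \<in> Obj C \<Longrightarrow> m \<in> Obj M \<Longrightarrow> c \<triangleright>\<^sub>o\<^bsub>M\<^esub> m \<in> Obj M"
    and actM_in: "f \<in> Hom C c d \<Longrightarrow> g \<in> Hom M m n \<Longrightarrow>
          f \<triangleright>\<^sub>m\<^bsub>M\<^esub> g \<in> Hom M (c \<triangleright>\<^sub>o\<^bsub>M\<^esub> m) (d \<triangleright>\<^sub>o\<^bsub>M\<^esub> n)"
    and actM_ident: "c \<in> Obj C \<Longrightarrow> m \<in> Obj M \<Longrightarrow>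
          ident C c \<triangleright>\<^sub>m\<^bsub>M\<^esub> ident M m = ident M (c \<triangleright>\<^sub>o\<^bsub>M\<^esub> m)"
    and actM_comp: "f \<in> Hom C c d \<Longrightarrow> f' \<in> Hom C d e \<Longrightarrow> g \<in> Hom M m n \<Longrightarrow> g' \<in> Hom M n p \<Longrightarrow>
          (f' \<cdot>\<^bsub>C\<^esub> f) \<triangleright>\<^sub>m\<^bsub>M\<^esub> (g' \<cdot>\<^bsub>M\<^esub> g) = (f' \<triangleright>\<^sub>m\<^bsub>M\<^esub> g') \<cdot>\<^bsub>M\<^esub> (f \<triangleright>\<^sub>m\<^bsub>M\<^esub> g)"
    and actM_linear_left: "g \<in> Hom M m n \<Longrightarrow> c \<in> Obj C \<Longrightarrow> d \<in> Obj C \<Longrightarrow>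
          linear_map (hom_module C c d) (hom_module M (c \<triangleright>\<^sub>o\<^bsub>M\<^esub> m) (d \<triangleright>\<^sub>o\<^bsub>M\<^esub> n)) (\<lambda>f. f \<triangleright>\<^sub>m\<^bsub>M\<^esub> g)"
    and actM_linear_right: "f \<in> Hom C c d \<Longrightarrow> m \<in> Obj M \<Longrightarrow> n \<in> Obj M \<Longrightarrow>
          linear_map (hom_module M m n) (hom_module M (c \<triangleright>\<^sub>o\<^bsub>M\<^esub> m) (d \<triangleright>\<^sub>o\<^bsub>M\<^esub> n)) (\<lambda>g. f \<triangleright>\<^sub>m\<^bsub>M\<^esub> g)"
    and act_assoc_in: "c \<in> Obj C \<Longrightarrow> d \<in> Obj C \<Longrightarrow> m \<in> Obj M \<Longrightarrow>
          act_assoc M c d m \<in> Hom M ((c \<otimes>\<^sub>o\<^bsub>C\<^esub> d) \<triangleright>\<^sub>o\<^bsub>M\<^esub> m) (c \<triangleright>\<^sub>o\<^bsub>M\<^esub> (d \<triangleright>\<^sub>o\<^bsub>M\<^esub> m))"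
    and act_assoc_iso: "c \<in> Obj C \<Longrightarrow> d \<in> Obj C \<Longrightarrow> m \<in> Obj M \<Longrightarrow> iso_arr M (act_assoc M c d m)"
    and act_assoc_natural: "f \<in> Hom C c c' \<Longrightarrow> f' \<in> Hom C d d' \<Longrightarrow> g \<in> Hom M m n \<Longrightarrow>
          act_assoc M c' d' n \<cdot>\<^bsub>M\<^esub> ((f \<otimes>\<^sub>m\<^bsub>C\<^esub> f') \<triangleright>\<^sub>m\<^bsub>M\<^esub> g)
            = (f \<triangleright>\<^sub>m\<^bsub>M\<^esub> (f' \<triangleright>\<^sub>m\<^bsub>M\<^esub> g)) \<cdot>\<^bsub>M\<^esub> act_assoc M c d m"
    and act_unit_in: "m \<in> Obj M \<Longrightarrow> act_unit M m \<in> Hom M (unit_obj C \<triangleright>\<^sub>o\<^bsub>M\<^esub> m) m"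
    and act_unit_iso: "m \<in> Obj M \<Longrightarrow> iso_arr M (act_unit M m)"
    and act_unit_natural: "g \<in> Hom M m n \<Longrightarrow>
          act_unit M n \<cdot>\<^bsub>M\<^esub> (ident C (unit_obj C) \<triangleright>\<^sub>m\<^bsub>M\<^esub> g) = g \<cdot>\<^bsub>M\<^esub> act_unit M m"
    and pentagon: "c \<in> Obj C \<Longrightarrow> d \<in> Obj C \<Longrightarrow> e \<in> Obj C \<Longrightarrow> m \<in> Obj M \<Longrightarrow>
          act_assoc M c d (e \<triangleright>\<^sub>o\<^bsub>M\<^esub> m) \<cdot>\<^bsub>M\<^esub> act_assoc M (c \<otimes>\<^sub>o\<^bsub>C\<^esub> d) e m
            = (ident C c \<triangleright>\<^sub>m\<^bsub>M\<^esub> act_assoc M d e m) \<cdot>\<^bsub>M\<^esub> act_assoc M c (d \<otimes>\<^sub>o\<^bsub>C\<^esub> e) m"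
    and triangle: "c \<in> Obj C \<Longrightarrow> m \<in> Obj M \<Longrightarrow>
          (ident C c \<triangleright>\<^sub>m\<^bsub>M\<^esub> act_unit M m) \<cdot>\<^bsub>M\<^esub> act_assoc M c (unit_obj C) m = ident M (c \<triangleright>\<^sub>o\<^bsub>M\<^esub> m)"

text \<open>The composite \<open>m \<cong> 1 \<triangleright> m \<rightarrow> (*c \<otimes> c) \<triangleright> m \<cong> *c \<triangleright> (c \<triangleright> m) \<rightarrow> c* \<triangleright> (c \<triangleright> m) \<cong> (c* \<otimes> c) \<triangleright> m
  \<rightarrow> 1 \<triangleright> m \<cong> m\<close> for \<open>f : c \<triangleright> m \<rightarrow> c \<triangleright> m\<close>.\<close>

definition partial_trace ::
  "('o, 'a, 'x) pivotal_cat_scheme \<Rightarrow> ('o, 'a, 'p, 'b, 'y) mod_cat_scheme \<Rightarrow> 'o \<Rightarrow> 'p \<Rightarrow> 'b \<Rightarrow> 'b" where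
  "partial_trace C M c m f =
     act_unit M m \<cdot>\<^bsub>M\<^esub>
     (ev C c \<triangleright>\<^sub>m\<^bsub>M\<^esub> ident M m) \<cdot>\<^bsub>M\<^esub>
     inv_arr M (act_assoc M (rdual C c) c m) \<cdot>\<^bsub>M\<^esub>
     (piv_ldual C c \<triangleright>\<^sub>m\<^bsub>M\<^esub> f) \<cdot>\<^bsub>M\<^esub>
     act_assoc M (ldual C c) c m \<cdot>\<^bsub>M\<^esub>
     (lcoev C c \<triangleright>\<^sub>m\<^bsub>M\<^esub> ident M m) \<cdot>\<^bsub>M\<^esub>
     inv_arr M (act_unit M m)"

locale module_trace =
  C: pivotal_fusion_category C + M: module_category C M
  for C :: "('o, 'a, 'x) pivotal_cat_scheme" and M :: "('o, 'a, 'p, 'b, 'y) mod_cat_scheme" +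
  fixes \<Theta> :: "'p \<Rightarrow> 'b \<Rightarrow> complex"
  assumes trace_linear: "m \<in> Obj M \<Longrightarrow> linear_map (hom_module M m m) complex_module (\<Theta> m)"
    and trace_symmetric: "f \<in> Hom M m n \<Longrightarrow> g \<in> Hom M n m \<Longrightarrow> \<Theta> m (g \<cdot>\<^bsub>M\<^esub> f) = \<Theta> n (f \<cdot>\<^bsub>M\<^esub> g)"
    and trace_nondegenerate_left: "f \<in> Hom M m n \<Longrightarrow>
          (\<And>g. g \<in> Hom M n m \<Longrightarrow> \<Theta> m (g \<cdot>\<^bsub>M\<^esub> f) = 0) \<Longrightarrow> f = Zero M m n"
    and trace_nondegenerate_right: "g \<in> Hom M n m \<Longrightarrow>
          (\<And>f. f \<in> Hom M m n \<Longrightarrow> \<Theta> m (g \<cdot>\<^bsub>M\<^esub> f) = 0) \<Longrightarrow> g = Zero M n m"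
    and trace_compatible: "c \<in> Obj C \<Longrightarrow> m \<in> Obj M \<Longrightarrow> f \<in> Hom M (c \<triangleright>\<^sub>o\<^bsub>M\<^esub> m) (c \<triangleright>\<^sub>o\<^bsub>M\<^esub> m) \<Longrightarrow>
          \<Theta> (c \<triangleright>\<^sub>o\<^bsub>M\<^esub> m) f = \<Theta> m (partial_trace C M c m f)"


section \<open>Inner homs\<close>

locale inner_hom = module_category C M
  for C :: "('o, 'a, 'x) rigid_cat_scheme" and M :: "('o, 'a, 'p, 'b, 'y) mod_cat_scheme" +
  fixes m n :: 'p and H :: 'o and \<alpha> :: "'o \<Rightarrow> 'b \<Rightarrow> 'a"
  assumes source_in: "m \<in> Obj M"
    and target_in: "n \<in> Obj M"
    and inner_in: "H \<in> Obj C"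
    and inner_iso: "c \<in> Obj C \<Longrightarrow>
          linear_iso (hom_module M (c \<triangleright>\<^sub>o\<^bsub>M\<^esub> m) n) (hom_module C c H) (\<alpha> c)"
    and inner_natural: "g \<in> Hom C d c \<Longrightarrow> f \<in> Hom M (c \<triangleright>\<^sub>o\<^bsub>M\<^esub> m) n \<Longrightarrow>
          \<alpha> d (f \<cdot>\<^bsub>M\<^esub> (g \<triangleright>\<^sub>m\<^bsub>M\<^esub> ident M m)) = \<alpha> c f \<cdot>\<^bsub>C\<^esub> g"

definition inner_ev ::
  "('o, 'a, 'x) rigid_cat_scheme \<Rightarrow> ('o, 'a, 'p, 'b, 'y) mod_cat_scheme \<Rightarrow> 'p \<Rightarrow> 'p \<Rightarrow> 'o \<Rightarrow>
   ('o \<Rightarrow> 'b \<Rightarrow> 'a) \<Rightarrow> 'b" where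
  "inner_ev C M m n H \<alpha> = inv_into (Hom M (H \<triangleright>\<^sub>o\<^bsub>M\<^esub> m) n) (\<alpha> H) (ident C H)"

definition inner_mult ::
  "('o, 'a, 'x) rigid_cat_scheme \<Rightarrow> ('o, 'a, 'p, 'b, 'y) mod_cat_scheme \<Rightarrow> 'p \<Rightarrow> 'o \<Rightarrow>
   ('o \<Rightarrow> 'b \<Rightarrow> 'a) \<Rightarrow> 'a" where
  "inner_mult C M m H \<alpha> =
     \<alpha> (H \<otimes>\<^sub>o\<^bsub>C\<^esub> H)
       (inner_ev C M m m H \<alpha> \<cdot>\<^bsub>M\<^esub> (ident C H \<triangleright>\<^sub>m\<^bsub>M\<^esub> inner_ev C M m m H \<alpha>) \<cdot>\<^bsub>M\<^esub> act_assoc M H H m)"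

definition inner_unit ::
  "('o, 'a, 'x) rigid_cat_scheme \<Rightarrow> ('o, 'a, 'p, 'b, 'y) mod_cat_scheme \<Rightarrow> 'p \<Rightarrow>
   ('o \<Rightarrow> 'b \<Rightarrow> 'a) \<Rightarrow> 'a" where
  "inner_unit C M m \<alpha> = \<alpha> (unit_obj C) (act_unit M m)"


section \<open>Frobenius algebras\<close>

definition algebra_in :: "('o, 'a, 'x) mon_cat_scheme \<Rightarrow> 'o \<Rightarrow> 'a \<Rightarrow> 'a \<Rightarrow> bool" where
  "algebra_in C A \<mu> \<eta> \<longleftrightarrow> A \<in> Obj C \<and>
     \<mu> \<in> Hom C (A \<otimes>\<^sub>o\<^bsub>C\<^esub> A) A \<and> \<eta> \<in> Hom C (unit_obj C) A \<and>
     \<mu> \<cdot>\<^bsub>C\<^esub> (\<mu> \<otimes>\<^sub>m\<^bsub>C\<^esub> ident C A) = \<mu> \<cdot>\<^bsub>C\<^esub> (ident C A \<otimes>\<^sub>m\<^bsub>C\<^esub> \<mu>) \<and>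
     \<mu> \<cdot>\<^bsub>C\<^esub> (\<eta> \<otimes>\<^sub>m\<^bsub>C\<^esub> ident C A) = ident C A \<and>
     \<mu> \<cdot>\<^bsub>C\<^esub> (ident C A \<otimes>\<^sub>m\<^bsub>C\<^esub> \<eta>) = ident C A"

definition coalgebra_in :: "('o, 'a, 'x) mon_cat_scheme \<Rightarrow> 'o \<Rightarrow> 'a \<Rightarrow> 'a \<Rightarrow> bool" where
  "coalgebra_in C A \<Delta> \<epsilon> \<longleftrightarrow> A \<in> Obj C \<and>
     \<Delta> \<in> Hom C A (A \<otimes>\<^sub>o\<^bsub>C\<^esub> A) \<and> \<epsilon> \<in> Hom C A (unit_obj C) \<and>
     (\<Delta> \<otimes>\<^sub>m\<^bsub>C\<^esub> ident C A) \<cdot>\<^bsub>C\<^esub> \<Delta> = (ident C A \<otimes>\<^sub>m\<^bsub>C\<^esub> \<Delta>) \<cdot>\<^bsub>C\<^esub> \<Delta> \<and>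
     (\<epsilon> \<otimes>\<^sub>m\<^bsub>C\<^esub> ident C A) \<cdot>\<^bsub>C\<^esub> \<Delta> = ident C A \<and>
     (ident C A \<otimes>\<^sub>m\<^bsub>C\<^esub> \<epsilon>) \<cdot>\<^bsub>C\<^esub> \<Delta> = ident C A"

definition frobenius_algebra ::
  "('o, 'a, 'x) mon_cat_scheme \<Rightarrow> 'o \<Rightarrow> 'a \<Rightarrow> 'a \<Rightarrow> 'a \<Rightarrow> 'a \<Rightarrow> bool" where
  "frobenius_algebra C A \<mu> \<eta> \<Delta> \<epsilon> \<longleftrightarrow> algebra_in C A \<mu> \<eta> \<and> coalgebra_in C A \<Delta> \<epsilon> \<and>
     \<Delta> \<cdot>\<^bsub>C\<^esub> \<mu> = (\<mu> \<otimes>\<^sub>m\<^bsub>C\<^esub> ident C A) \<cdot>\<^bsub>C\<^esub> (ident C A \<otimes>\<^sub>m\<^bsub>C\<^esub> \<Delta>) \<and>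
     \<Delta> \<cdot>\<^bsub>C\<^esub> \<mu> = (ident C A \<otimes>\<^sub>m\<^bsub>C\<^esub> \<mu>) \<cdot>\<^bsub>C\<^esub> (\<Delta> \<otimes>\<^sub>m\<^bsub>C\<^esub> ident C A)"

definition haploid :: "('o, 'a, 'x) mon_cat_scheme \<Rightarrow> 'o \<Rightarrow> bool" where
  "haploid C A \<longleftrightarrow> (\<exists>\<phi>. linear_iso (hom_module C (unit_obj C) A) complex_module \<phi>)"

definition special ::
  "('o, 'a, 'x) mon_cat_scheme \<Rightarrow> 'o \<Rightarrow> 'a \<Rightarrow> 'a \<Rightarrow> 'a \<Rightarrow> 'a \<Rightarrow> bool" where
  "special C A \<mu> \<eta> \<Delta> \<epsilon> \<longleftrightarrow>
     (\<exists>\<beta>\<^sub>1 \<beta>\<^sub>A. \<beta>\<^sub>1 \<noteq> 0 \<and> \<beta>\<^sub>A \<noteq> 0 \<and>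
        \<epsilon> \<cdot>\<^bsub>C\<^esub> \<eta> = Scale C \<beta>\<^sub>1 (ident C (unit_obj C)) \<and> \<mu> \<cdot>\<^bsub>C\<^esub> \<Delta> = Scale C \<beta>\<^sub>A (ident C A))"

definition symmetric_form :: "('o, 'a, 'x) pivotal_cat_scheme \<Rightarrow> 'o \<Rightarrow> 'a \<Rightarrow> 'a \<Rightarrow> bool" where
  "symmetric_form C A \<mu> \<epsilon> \<longleftrightarrow>
     ((\<epsilon> \<cdot>\<^bsub>C\<^esub> \<mu>) \<otimes>\<^sub>m\<^bsub>C\<^esub> ident C (rdual C A)) \<cdot>\<^bsub>C\<^esub> (ident C A \<otimes>\<^sub>m\<^bsub>C\<^esub> coev C A)
       = piv_ldual C A \<cdot>\<^bsub>C\<^esub>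
         (ident C (ldual C A) \<otimes>\<^sub>m\<^bsub>C\<^esub> (\<epsilon> \<cdot>\<^bsub>C\<^esub> \<mu>)) \<cdot>\<^bsub>C\<^esub> (lcoev C A \<otimes>\<^sub>m\<^bsub>C\<^esub> ident C A)"

end

theory Submission
  imports Defs "HOL-Computational_Algebra.Fundamental_Theorem_Algebra"
begin

text \<open>Write \<open>A\<close> for the inner hom \<open>Hom(m, m)\<close>. By duality, the morphisms \<open>c \<triangleright> m \<rightarrow> d \<triangleright> m\<close> of the
  module category are the same as the morphisms \<open>c \<rightarrow> d \<otimes> A\<close> of \<open>C\<close>, and composition becomes the
  composition of maps between free \<open>A\<close>-modules (\<open>free_map_inj\<close>, \<open>free_map_surj\<close>,
  \<open>free_map_comp\<close>). This is the only place where the coherence isomorphisms of the module category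
  have to be handled in earnest. The algebra axioms for \<open>A\<close> are then the category laws, and everything
  else happens in the strict monoidal category \<open>C\<close>.

  The module trace \<open>\<Theta>\<close> is a functional on \<open>End(m) = Hom(1, A)\<close>. As \<open>C\<close> is semisimple with
  \<open>End(1) = \<complex>\<close>, it is induced by a morphism \<open>\<epsilon> : A \<rightarrow> 1\<close>. The pairing \<open>\<kappa> = \<epsilon> \<mu>\<close> of
  \<open>Hom(x, A)\<close> with \<open>Hom(1, x \<otimes> A)\<close> is the trace pairing of \<open>Hom(x \<triangleright> m, m)\<close> with
  \<open>Hom(m, x \<triangleright> m)\<close>, hence nondegenerate. For \<open>x = A\<^sup>*\<close> this provides a copairing \<open>\<delta>\<close>
  (\<open>nondegenerate_form\<close>), and an algebra with a nondegenerate invariant form is a Frobenius algebra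
  (\<open>frobenius_from_nondegenerate_form\<close>).

  Now let \<open>m\<close> be simple and \<open>t = \<Theta>(id\<^sub>m)\<close>, which is nonzero. Then \<open>Hom(1, A) = \<complex> \<eta>\<close>, so \<open>A\<close> is
  haploid, and the left trace of \<open>f : c \<rightarrow> c\<close> is \<open>\<Theta>(f \<triangleright> m) / t\<close>. Therefore the symmetry and the
  compatibility of \<open>\<Theta>\<close> make the left trace cyclic and multiplicative. Three consequences complete
  the proof, once \<open>dim A\<close> is known to be nonzero.

  \<^item> The \<open>A\<close>-linear endomorphism \<open>\<mu> \<Delta>\<close> is a scalar \<open>\<beta>\<close>, and \<open>\<beta> t = \<epsilon> \<mu> \<delta>\<close> is \<open>dim A\<close> by the
    symmetry of \<open>\<Theta>\<close> (\<open>counit_mult_copairing\<close>). So \<open>A\<close> is special.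
  \<^item> The form \<open>tr(x \<mapsto> x a b)\<close> is symmetric by cyclicity, and as \<open>A\<close> is haploid, it is a nonzero
    multiple of \<open>\<kappa>\<close> (\<open>symmetric_if_dimension_nonzero\<close>).
  \<^item> Let \<open>n\<close> run over the simple objects that occur in some \<open>d \<triangleright> m\<close>, with \<open>d\<close> simple, and let
    \<open>N(d, n)\<close> be the multiplicity. Then \<open>dim d \<sqdot> t = \<Sum>\<^sub>n N(d, n) \<Theta>(id\<^sub>n)\<close>, while
    \<open>\<Sum>\<^sub>d N(d, n) dim d = \<Theta>(id\<^sub>n) dim A / t\<close>, both sides being the dimension of the inner hom from
    \<open>m\<close> to \<open>n\<close>. Together they yield
    \<open>dim A \<sqdot> \<Sum>\<^sub>n |\<Theta>(id\<^sub>n)|\<^sup>2 = |t|\<^sup>2 \<sqdot> \<Sum>\<^sub>d |dim d|\<^sup>2 > 0\<close> (\<open>dimension_positive\<close>).\<close>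

section \<open>Linear algebra over the complex numbers\<close>

lemma complex_ring_simps [simp]:
  "carrier complex_ring = UNIV" "x \<otimes>\<^bsub>complex_ring\<^esub> y = x * y" "\<one>\<^bsub>complex_ring\<^esub> = 1"
  "x \<oplus>\<^bsub>complex_ring\<^esub> y = x + y" "\<zero>\<^bsub>complex_ring\<^esub> = 0"
  by (simp_all add: complex_ring_def)

lemma complex_module_simps [simp]:
  "carrier complex_module = UNIV" "x \<oplus>\<^bsub>complex_module\<^esub> y = x + y"
  "\<zero>\<^bsub>complex_module\<^esub> = 0" "x \<odot>\<^bsub>complex_module\<^esub> y = x * y"
  by (simp_all add: complex_module_def)

lemma complex_ring_cring: "cring complex_ring"
proof (rule cringI)
  show "abelian_group complex_ring"
  proof (rule abelian_groupI)
    show "\<exists>y\<in>carrier complex_ring. y \<oplus>\<^bsub>complex_ring\<^esub> x = \<zero>\<^bsub>complex_ring\<^esub>" for x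
      by (rule bexI[of _ "- x"]) simp_all
  qed (simp_all add: algebra_simps)
  show "comm_monoid complex_ring"
    by (rule comm_monoidI) (simp_all add: algebra_simps)
qed (simp add: algebra_simps)

lemma complex_module_module: "module complex_ring complex_module"
proof (rule moduleI)
  show "abelian_group complex_module"
  proof (rule abelian_groupI)
    show "\<exists>y\<in>carrier complex_module. y \<oplus>\<^bsub>complex_module\<^esub> x = \<zero>\<^bsub>complex_module\<^esub>" for x
      by (rule bexI[of _ "- x"]) simp_all
  qed (simp_all add: algebra_simps)
qed (simp_all add: complex_ring_cring algebra_simps)

lemma finsum_complex_module: "finsum complex_module f I = sum f I"
proof -
  interpret module complex_ring complex_module by (rule complex_module_module)
  show ?thesis
    by (induction I rule: infinite_finite_induct)
      (simp_all add: M.finsum_infinite)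
qed

lemma linear_map_closed: "linear_map V W \<phi> \<Longrightarrow> v \<in> carrier V \<Longrightarrow> \<phi> v \<in> carrier W"
  by (auto simp: linear_map_def)

lemma linear_map_add:
  "linear_map V W \<phi> \<Longrightarrow> u \<in> carrier V \<Longrightarrow> v \<in> carrier V \<Longrightarrow> \<phi> (u \<oplus>\<^bsub>V\<^esub> v) = \<phi> u \<oplus>\<^bsub>W\<^esub> \<phi> v"
  by (auto simp: linear_map_def)

lemma linear_map_smult:
  "linear_map V W \<phi> \<Longrightarrow> v \<in> carrier V \<Longrightarrow> \<phi> (z \<odot>\<^bsub>V\<^esub> v) = z \<odot>\<^bsub>W\<^esub> \<phi> v"
  by (auto simp: linear_map_def)

lemma linear_map_zero:
  assumes "module complex_ring V" "module complex_ring W" "linear_map V W \<phi>"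
  shows "\<phi> \<zero>\<^bsub>V\<^esub> = \<zero>\<^bsub>W\<^esub>"
proof -
  interpret V: module complex_ring V by fact
  interpret W: module complex_ring W by fact
  have "\<phi> (0 \<odot>\<^bsub>V\<^esub> \<zero>\<^bsub>V\<^esub>) = 0 \<odot>\<^bsub>W\<^esub> \<phi> \<zero>\<^bsub>V\<^esub>"
    by (rule linear_map_smult[OF assms(3)]) simp
  thus ?thesis
    using V.smult_l_null[of "\<zero>\<^bsub>V\<^esub>"] W.smult_l_null[of "\<phi> \<zero>\<^bsub>V\<^esub>"]
      linear_map_closed[OF assms(3), of "\<zero>\<^bsub>V\<^esub>"] by simp
qed

lemma linear_map_comp:
  "linear_map U V \<phi> \<Longrightarrow> linear_map V W \<psi> \<Longrightarrow> linear_map U W (\<lambda>x. \<psi> (\<phi> x))"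
  unfolding linear_map_def by (auto simp: Pi_iff)

lemma linear_map_finsum:
  assumes "module complex_ring V" "module complex_ring W" "linear_map V W \<phi>"
    and "finite I" "\<And>i. i \<in> I \<Longrightarrow> f i \<in> carrier V"
  shows "\<phi> (finsum V f I) = finsum W (\<lambda>i. \<phi> (f i)) I"
proof -
  interpret V: module complex_ring V by fact
  interpret W: module complex_ring W by fact
  show ?thesis
    using assms(4,5)
  proof (induction I rule: finite_induct)
    case empty
    thus ?case using linear_map_zero[OF assms(1-3)] by simp
  next
    case (insert i I)
    have f: "f \<in> I \<rightarrow> carrier V" "f i \<in> carrier V" using insert by auto
    have wf: "(\<lambda>i. \<phi> (f i)) \<in> I \<rightarrow> carrier W" "\<phi> (f i) \<in> carrier W"
      using f linear_map_closed[OF assms(3)] by auto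
    have "\<phi> (f i \<oplus>\<^bsub>V\<^esub> finsum V f I) = \<phi> (f i) \<oplus>\<^bsub>W\<^esub> \<phi> (finsum V f I)"
      using f by (intro linear_map_add[OF assms(3)]) (auto intro: V.finsum_closed)
    thus ?case
      using insert f wf by (simp add: V.finsum_insert W.finsum_insert)
  qed
qed

lemma linear_functional_finsum:
  assumes "module complex_ring V" "linear_map V complex_module \<phi>"
    and "finite I" "\<And>i. i \<in> I \<Longrightarrow> f i \<in> carrier V"
  shows "\<phi> (finsum V f I) = (\<Sum>i\<in>I. \<phi> (f i))"
  using linear_map_finsum[OF assms(1) complex_module_module assms(2-4)]
  by (simp add: finsum_complex_module)

text \<open>Gaussian elimination: an equation with a nonzero coefficient is solved for one unknown.\<close>

lemma underdetermined_system:
  fixes a :: "'e \<Rightarrow> 'i \<Rightarrow> complex"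
  assumes "finite E" "finite I" "card E < card I"
  shows "\<exists>c. (\<exists>i\<in>I. c i \<noteq> 0) \<and> (\<forall>e\<in>E. (\<Sum>i\<in>I. a e i * c i) = 0)"
  using assms
proof (induction E arbitrary: a I rule: finite_induct)
  case empty
  thus ?case by (intro exI[of _ "\<lambda>_. 1"]) (auto simp: card_gt_0_iff)
next
  case (insert e E)
  show ?case
  proof (cases "\<forall>i\<in>I. a e i = 0")
    case True
    obtain c where "\<exists>i\<in>I. c i \<noteq> 0" "\<forall>e\<in>E. (\<Sum>i\<in>I. a e i * c i) = 0"
      using insert.IH[of I a] insert.prems insert.hyps by auto
    thus ?thesis using True by (intro exI[of _ c]) auto
  next
    case False
    then obtain p where p: "p \<in> I" "a e p \<noteq> 0" by blast
    define J where "J = I - {p}"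
    define b where "b e' i = a e' i - a e' p * a e i / a e p" for e' i
    have J: "finite J" "I = insert p J" "p \<notin> J" "card E < card J"
      using p insert.prems insert.hyps by (auto simp: J_def card_Diff_singleton_if)
    obtain c where c: "\<exists>i\<in>J. c i \<noteq> 0" "\<forall>e\<in>E. (\<Sum>i\<in>J. b e i * c i) = 0"
      using insert.IH[of J b] J by auto
    define c' where "c' = c(p := - (\<Sum>i\<in>J. a e i * c i) / a e p)"
    have c': "(\<Sum>i\<in>I. a e' i * c' i) =
        (\<Sum>i\<in>J. a e' i * c i) - a e' p * (\<Sum>i\<in>J. a e i * c i) / a e p" for e'
    proof -
      have "(\<Sum>i\<in>J. a e' i * c' i) = (\<Sum>i\<in>J. a e' i * c i)"
        using J by (intro sum.cong) (auto simp: c'_def)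
      thus ?thesis using J by (simp add: c'_def)
    qed
    have "(\<Sum>i\<in>I. a e' i * c' i) = (\<Sum>i\<in>J. b e' i * c i)" for e'
    proof -
      have "(\<Sum>i\<in>J. b e' i * c i) = (\<Sum>i\<in>J. a e' i * c i - a e' p * (a e i * c i) / a e p)"
        by (simp add: b_def left_diff_distrib mult.assoc)
      thus ?thesis
        unfolding c' by (simp add: sum_subtractf sum_distrib_left sum_divide_distrib)
    qed
    hence "(\<Sum>i\<in>I. a e' i * c' i) = 0" if "e' \<in> E" for e' using c that by simp
    moreover have "(\<Sum>i\<in>I. a e i * c' i) = 0" unfolding c' using p by simp
    moreover have "\<exists>i\<in>I. c' i \<noteq> 0" using c J by (auto simp: c'_def)
    ultimately show ?thesis by (intro exI[of _ c']) auto
  qed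
qed

text \<open>A functional that vanishes on the common kernel of finitely many functionals is a linear
  combination of them.\<close>

lemma functional_in_span:
  assumes "module complex_ring W" "finite B"
    and "\<And>v. v \<in> B \<Longrightarrow> linear_map W complex_module (\<lambda>w. b w v)"
    and "linear_map W complex_module L"
    and "\<And>w. w \<in> carrier W \<Longrightarrow> (\<And>v. v \<in> B \<Longrightarrow> b w v = 0) \<Longrightarrow> L w = 0"
  shows "\<exists>k. \<forall>w\<in>carrier W. L w = (\<Sum>v\<in>B. k v * b w v)"
  using assms(2-5)
proof (induction B arbitrary: L rule: finite_induct)
  case empty
  thus ?case by auto
next
  case (insert c B)
  interpret W: module complex_ring W by fact
  note lin = insert.prems(1)
  show ?case
  proof (cases "\<forall>w\<in>carrier W. (\<forall>v\<in>B. b w v = 0) \<longrightarrow> b w c = 0")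
    case True
    have "\<exists>k. \<forall>w\<in>carrier W. L w = (\<Sum>v\<in>B. k v * b w v)"
    proof (rule insert.IH)
      show "L w = 0" if "w \<in> carrier W" "\<And>v. v \<in> B \<Longrightarrow> b w v = 0" for w
        by (rule insert.prems(3)) (use that True in auto)
    qed (use insert.prems in auto)
    then obtain k where "\<forall>w\<in>carrier W. L w = (\<Sum>v\<in>B. k v * b w v)" by blast
    moreover have "(\<Sum>v\<in>B. (k(c := 0)) v * b w v) = (\<Sum>v\<in>B. k v * b w v)" for w
      using insert.hyps by (intro sum.cong) auto
    ultimately show ?thesis using insert.hyps by (intro exI[of _ "k(c := 0)"]) simp
  next
    case False
    then obtain w0 where w0: "w0 \<in> carrier W" "\<forall>v\<in>B. b w0 v = 0" "b w0 c \<noteq> 0" by blast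
    define r where "r = L w0 / b w0 c"
    define L' where "L' w = L w - r * b w c" for w
    have "linear_map W complex_module L'"
      unfolding linear_map_def L'_def
      using linear_map_add[OF insert.prems(2)] linear_map_smult[OF insert.prems(2)]
        linear_map_add[OF lin[of c]] linear_map_smult[OF lin[of c]]
      by (auto simp: algebra_simps)
    moreover have "L' w = 0" if w: "w \<in> carrier W" "\<And>v. v \<in> B \<Longrightarrow> b w v = 0" for w
    proof -
      define w' where "w' = w \<oplus>\<^bsub>W\<^esub> (- (b w c / b w0 c)) \<odot>\<^bsub>W\<^esub> w0"
      have w': "w' \<in> carrier W" using w w0 by (simp add: w'_def)
      have b': "b w' v = b w v - (b w c / b w0 c) * b w0 v" if "v \<in> insert c B" for v
        using linear_map_add[OF lin[OF that] w(1), of "(- (b w c / b w0 c)) \<odot>\<^bsub>W\<^esub> w0"]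
          linear_map_smult[OF lin[OF that] w0(1), of "- (b w c / b w0 c)"] w0(1)
        by (simp add: w'_def)
      have "L w' = 0"
        by (rule insert.prems(3)[OF w']) (use b' w w0 in auto)
      moreover have "L w' = L w - (b w c / b w0 c) * L w0"
        using linear_map_add[OF insert.prems(2) w(1), of "(- (b w c / b w0 c)) \<odot>\<^bsub>W\<^esub> w0"]
          linear_map_smult[OF insert.prems(2) w0(1), of "- (b w c / b w0 c)"] w0(1)
        by (simp add: w'_def)
      ultimately show ?thesis by (simp add: L'_def r_def)
    qed
    ultimately have "\<exists>k. \<forall>w\<in>carrier W. L' w = (\<Sum>v\<in>B. k v * b w v)"
      using insert.prems by (intro insert.IH) auto
    then obtain k where k: "\<forall>w\<in>carrier W. L' w = (\<Sum>v\<in>B. k v * b w v)" by blast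
    have "(\<Sum>v\<in>B. (k(c := r)) v * b w v) = (\<Sum>v\<in>B. k v * b w v)" for w
      using insert.hyps by (intro sum.cong) auto
    thus ?thesis using insert.hyps k
      by (intro exI[of _ "k(c := r)"]) (auto simp: L'_def algebra_simps)
  qed
qed

text \<open>If a space of functionals on a finite-dimensional space separates points, it contains all
  functionals. The prescribed values on a finite spanning set are reached one vector at a time: if no
  functional separates the next vector \<open>c\<close> from the earlier ones, then \<open>c\<close> is a combination of them,
  and its value is already correct.\<close>

lemma functional_represented:
  assumes V: "module complex_ring V" and W: "module complex_ring W" and "finite_dimensional V"
    and b_right: "\<And>w. w \<in> carrier W \<Longrightarrow> linear_map V complex_module (b w)"
    and b_left: "\<And>v. v \<in> carrier V \<Longrightarrow> linear_map W complex_module (\<lambda>w. b w v)"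
    and separating: "\<And>v. v \<in> carrier V \<Longrightarrow> (\<And>w. w \<in> carrier W \<Longrightarrow> b w v = 0) \<Longrightarrow> v = \<zero>\<^bsub>V\<^esub>"
    and \<phi>: "linear_map V complex_module \<phi>"
  shows "\<exists>w\<in>carrier W. \<forall>v\<in>carrier V. b w v = \<phi> v"
proof -
  interpret V: module complex_ring V by fact
  interpret W: module complex_ring W by fact
  have fin: "\<exists>w\<in>carrier W. \<forall>v\<in>B. b w v = \<phi> v" if "finite B" "B \<subseteq> carrier V" for B
    using that
  proof (induction B rule: finite_induct)
    case empty
    thus ?case using W.M.zero_closed by blast
  next
    case (insert c B)
    then obtain w where w: "w \<in> carrier W" "\<forall>v\<in>B. b w v = \<phi> v" by auto
    have c: "c \<in> carrier V" and B: "\<And>v. v \<in> B \<Longrightarrow> v \<in> carrier V" using insert by auto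
    show ?case
    proof (cases "\<forall>w\<in>carrier W. (\<forall>v\<in>B. b w v = 0) \<longrightarrow> b w c = 0")
      case False
      then obtain w0 where w0: "w0 \<in> carrier W" "\<forall>v\<in>B. b w0 v = 0" "b w0 c \<noteq> 0" by blast
      define w' where "w' = w \<oplus>\<^bsub>W\<^esub> ((\<phi> c - b w c) / b w0 c) \<odot>\<^bsub>W\<^esub> w0"
      have "b w' v = b w v + (\<phi> c - b w c) / b w0 c * b w0 v" if "v \<in> carrier V" for v
        using linear_map_add[OF b_left[OF that] w(1), of "((\<phi> c - b w c) / b w0 c) \<odot>\<^bsub>W\<^esub> w0"]
          linear_map_smult[OF b_left[OF that] w0(1), of "(\<phi> c - b w c) / b w0 c"] w0(1)
        by (simp add: w'_def)
      moreover have "w' \<in> carrier W" using w w0 by (simp add: w'_def)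
      ultimately show ?thesis using w w0 c B by (intro bexI[of _ w']) auto
    next
      case True
      have "\<exists>k. \<forall>w\<in>carrier W. b w c = (\<Sum>v\<in>B. k v * b w v)"
        by (rule functional_in_span[OF W insert.hyps(1)]) (use b_left c B True in auto)
      then obtain k where k: "\<And>w. w \<in> carrier W \<Longrightarrow> b w c = (\<Sum>v\<in>B. k v * b w v)" by blast
      define s where "s = finsum V (\<lambda>v. k v \<odot>\<^bsub>V\<^esub> v) B"
      have s: "s \<in> carrier V" using B unfolding s_def by (intro V.finsum_closed) auto
      have lin_s: "\<psi> s = (\<Sum>v\<in>B. k v * \<psi> v)" if "linear_map V complex_module \<psi>" for \<psi>
      proof -
        have "\<psi> s = (\<Sum>v\<in>B. \<psi> (k v \<odot>\<^bsub>V\<^esub> v))"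
          unfolding s_def using B insert.hyps by (intro linear_functional_finsum[OF V that]) auto
        thus ?thesis using B linear_map_smult[OF that] by simp
      qed
      define d where "d = c \<oplus>\<^bsub>V\<^esub> (-1) \<odot>\<^bsub>V\<^esub> s"
      have lin_d: "\<psi> d = \<psi> c - \<psi> s" if "linear_map V complex_module \<psi>" for \<psi>
        using linear_map_add[OF that c, of "(-1) \<odot>\<^bsub>V\<^esub> s"] linear_map_smult[OF that s, of "-1"] s
        by (simp add: d_def)
      have "d = \<zero>\<^bsub>V\<^esub>"
      proof (rule separating)
        show "d \<in> carrier V" using c s by (simp add: d_def)
        show "b u d = 0" if "u \<in> carrier W" for u
          using lin_d[OF b_right[OF that]] lin_s[OF b_right[OF that]] k[OF that] by simp
      qed
      hence "\<phi> c = \<phi> s"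
        using lin_d[OF \<phi>] linear_map_zero[OF V complex_module_module \<phi>] by simp
      also have "\<dots> = (\<Sum>v\<in>B. k v * b w v)" unfolding lin_s[OF \<phi>] using w by (intro sum.cong) auto
      also have "\<dots> = b w c" using k w by simp
      finally show ?thesis using w by (intro bexI[of _ w]) auto
    qed
  qed
  obtain B where B: "finite B" "B \<subseteq> carrier V"
    and span: "\<And>v. v \<in> carrier V \<Longrightarrow> \<exists>k. v = finsum V (\<lambda>u. k u \<odot>\<^bsub>V\<^esub> u) B"
    using assms(3) unfolding finite_dimensional_def by blast
  obtain w where w: "w \<in> carrier W" "\<forall>v\<in>B. b w v = \<phi> v" using fin[OF B] by blast
  have "b w v = \<phi> v" if v: "v \<in> carrier V" for v
  proof -
    obtain k where k: "v = finsum V (\<lambda>u. k u \<odot>\<^bsub>V\<^esub> u) B" using span[OF v] by blast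
    have "\<psi> v = (\<Sum>u\<in>B. k u * \<psi> u)" if "linear_map V complex_module \<psi>" for \<psi>
    proof -
      have "\<psi> v = (\<Sum>u\<in>B. \<psi> (k u \<odot>\<^bsub>V\<^esub> u))"
        unfolding k using B by (intro linear_functional_finsum[OF V that]) auto
      thus ?thesis using B linear_map_smult[OF that] by (simp add: subset_iff)
    qed
    from this[OF b_right[OF w(1)]] this[OF \<phi>] show ?thesis using w by simp
  qed
  thus ?thesis using w by blast
qed

lemma linear_dependence:
  assumes V: "module complex_ring V" and "finite_dimensional V"
    and v: "\<And>i::nat. v i \<in> carrier V"
  shows "\<exists>N c. (\<exists>i<N. c i \<noteq> 0) \<and> finsum V (\<lambda>i. c i \<odot>\<^bsub>V\<^esub> v i) {..<N} = \<zero>\<^bsub>V\<^esub>"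
proof -
  interpret V: module complex_ring V by fact
  obtain B where B: "finite B" "B \<subseteq> carrier V"
    and span: "\<And>v. v \<in> carrier V \<Longrightarrow> \<exists>k. v = finsum V (\<lambda>u. k u \<odot>\<^bsub>V\<^esub> u) B"
    using assms(2) unfolding finite_dimensional_def by blast
  obtain k where k: "\<And>i. v i = finsum V (\<lambda>u. k i u \<odot>\<^bsub>V\<^esub> u) B"
    using span[OF v] by metis
  obtain c where c: "\<exists>i\<in>{..card B}. c i \<noteq> 0" "\<forall>u\<in>B. (\<Sum>i\<in>{..card B}. k i u * c i) = 0"
    using underdetermined_system[OF B(1), of "{..card B}" "\<lambda>u i. k i u"] by auto
  have comb: "finsum V (\<lambda>i. c i \<odot>\<^bsub>V\<^esub> v i) {..<n} = finsum V (\<lambda>u. (\<Sum>i<n. k i u * c i) \<odot>\<^bsub>V\<^esub> u) B"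
    for n
  proof (induction n)
    case 0
    have "finsum V (\<lambda>u. 0 \<odot>\<^bsub>V\<^esub> u) B = finsum V (\<lambda>u. \<zero>\<^bsub>V\<^esub>) B"
      using B V.smult_l_null by (intro V.finsum_cong') auto
    thus ?case by simp
  next
    case (Suc n)
    have cv: "c n \<odot>\<^bsub>V\<^esub> v n = finsum V (\<lambda>u. (k n u * c n) \<odot>\<^bsub>V\<^esub> u) B"
    proof -
      have "linear_map V V (\<lambda>w. c n \<odot>\<^bsub>V\<^esub> w)"
        unfolding linear_map_def
        using V.smult_r_distr V.smult_assoc1[symmetric] by (auto simp: mult.commute)
      hence "c n \<odot>\<^bsub>V\<^esub> v n = finsum V (\<lambda>u. c n \<odot>\<^bsub>V\<^esub> (k n u \<odot>\<^bsub>V\<^esub> u)) B"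
        unfolding k using B by (intro linear_map_finsum[OF V V]) auto
      also have "\<dots> = finsum V (\<lambda>u. (k n u * c n) \<odot>\<^bsub>V\<^esub> u) B"
        using B V.smult_assoc1[of "c n", symmetric]
        by (intro V.finsum_cong') (auto simp: mult.commute)
      finally show ?thesis .
    qed
    have "finsum V (\<lambda>i. c i \<odot>\<^bsub>V\<^esub> v i) {..<Suc n}
        = c n \<odot>\<^bsub>V\<^esub> v n \<oplus>\<^bsub>V\<^esub> finsum V (\<lambda>i. c i \<odot>\<^bsub>V\<^esub> v i) {..<n}"
      unfolding lessThan_Suc using v by (intro V.finsum_insert) auto
    also have "\<dots> = finsum V (\<lambda>u. (k n u * c n) \<odot>\<^bsub>V\<^esub> u \<oplus>\<^bsub>V\<^esub> (\<Sum>i<n. k i u * c i) \<odot>\<^bsub>V\<^esub> u) B"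
      unfolding Suc.IH cv using B by (intro V.finsum_addf[symmetric]) auto
    also have "\<dots> = finsum V (\<lambda>u. (\<Sum>i<Suc n. k i u * c i) \<odot>\<^bsub>V\<^esub> u) B"
      using B V.smult_l_distr[symmetric] by (intro V.finsum_cong') (auto simp: add.commute)
    finally show ?case .
  qed
  have "finsum V (\<lambda>u. 0 \<odot>\<^bsub>V\<^esub> u) B = finsum V (\<lambda>u. \<zero>\<^bsub>V\<^esub>) B"
    using B V.smult_l_null by (intro V.finsum_cong') auto
  moreover have "finsum V (\<lambda>u. (\<Sum>i<Suc (card B). k i u * c i) \<odot>\<^bsub>V\<^esub> u) B
      = finsum V (\<lambda>u. 0 \<odot>\<^bsub>V\<^esub> u) B"
    using B c by (intro V.finsum_cong') (auto simp: lessThan_Suc_atMost)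
  ultimately have "finsum V (\<lambda>i. c i \<odot>\<^bsub>V\<^esub> v i) {..<Suc (card B)} = \<zero>\<^bsub>V\<^esub>"
    unfolding comb by simp
  thus ?thesis using c(1) by (intro exI[of _ "Suc (card B)"] exI[of _ c]) (auto simp: less_Suc_eq_le)
qed

section \<open>Linear categories\<close>

lemma hom_module_simps [simp]:
  "carrier (hom_module C x y) = Hom C x y"
  "f \<oplus>\<^bsub>hom_module C x y\<^esub> g = Add C f g"
  "\<zero>\<^bsub>hom_module C x y\<^esub> = Zero C x y"
  "z \<odot>\<^bsub>hom_module C x y\<^esub> f = Scale C z f"
  by (simp_all add: hom_module_def)

lemma in_HomD:
  assumes "f \<in> Hom C x y"
  shows "f \<in> Arr C" "Dom C f = x" "Cod C f = y"
  using assms by (simp_all add: Hom_def)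

lemma in_Hom_self: "f \<in> Arr C \<Longrightarrow> f \<in> Hom C (Dom C f) (Cod C f)"
  by (simp add: Hom_def)

lemma in_Hom_iff: "f \<in> Hom C x y \<longleftrightarrow> f \<in> Arr C \<and> Dom C f = x \<and> Cod C f = y"
  by (simp add: Hom_def)

context linear_category
begin

lemma Hom_obj:
  assumes "f \<in> Hom C x y"
  shows "x \<in> Obj C" "y \<in> Obj C"
  using assms Dom_in Cod_in by (auto simp: Hom_def)

lemma ident_arr:
  assumes "x \<in> Obj C"
  shows "ident C x \<in> Arr C" "Dom C (ident C x) = x" "Cod C (ident C x) = x"
  using ident_in[OF assms] by (simp_all add: Hom_def)

lemma comp_arr:
  assumes "f \<in> Arr C" "g \<in> Arr C" "Dom C g = Cod C f"
  shows "g \<cdot> f \<in> Arr C" "Dom C (g \<cdot> f) = Dom C f" "Cod C (g \<cdot> f) = Cod C g"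
  using comp_in[of f "Dom C f" "Cod C f" g "Cod C g"] assms by (simp_all add: Hom_def)

lemma comp_assoc_arr:
  assumes "f \<in> Arr C" "g \<in> Arr C" "h \<in> Arr C" "Dom C g = Cod C f" "Dom C h = Cod C g"
  shows "(h \<cdot> g) \<cdot> f = h \<cdot> (g \<cdot> f)"
  using comp_assoc[of f "Dom C f" "Cod C f" g "Cod C g" h "Cod C h"] assms by (simp add: Hom_def)

lemma comp_eq_assoc:
  assumes "g \<cdot> f = k" "h \<in> Arr C" "f \<in> Arr C" "g \<in> Arr C"
    "Dom C g = Cod C f" "Dom C f = Cod C h"
  shows "g \<cdot> (f \<cdot> h) = k \<cdot> h"
  using comp_assoc_arr[of h f g] assms by simp

lemma comp_ident_arr:
  assumes "f \<in> Arr C"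
  shows "Dom C f = x \<Longrightarrow> f \<cdot> ident C x = f" "Cod C f = x \<Longrightarrow> ident C x \<cdot> f = f"
  using comp_ident_right[of f "Dom C f" "Cod C f"] comp_ident_left[of f "Dom C f" "Cod C f"] assms
  by (auto simp: Hom_def)

lemmas arr = Dom_in Cod_in ident_arr comp_arr comp_ident_arr

lemma Hom_module_laws:
  assumes "f \<in> Hom C x y"
  shows "Scale C z f \<in> Hom C x y"
    and "g \<in> Hom C x y \<Longrightarrow> Add C f g \<in> Hom C x y"
    and "Scale C 1 f = f"
    and "Scale C 0 f = Zero C x y"
    and "Scale C z (Scale C w f) = Scale C (z * w) f"
    and "Scale C (z + w) f = Add C (Scale C z f) (Scale C w f)"
    and "Add C f (Zero C x y) = f"
    and "Add C (Zero C x y) f = f"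
proof -
  interpret V: module complex_ring "hom_module C x y"
    using module_Hom Hom_obj assms by blast
  show "Scale C z f \<in> Hom C x y" "Scale C 1 f = f" "Scale C 0 f = Zero C x y"
    using assms V.smult_closed[of z f] V.smult_one[of f] V.smult_l_null[of f] by simp_all
  show "g \<in> Hom C x y \<Longrightarrow> Add C f g \<in> Hom C x y"
    using assms V.M.a_closed[of f g] by simp
  show "Scale C z (Scale C w f) = Scale C (z * w) f"
    using assms V.smult_assoc1[of z w f] by simp
  show "Scale C (z + w) f = Add C (Scale C z f) (Scale C w f)"
    using assms V.smult_l_distr[of z w f] by simp
  show "Add C f (Zero C x y) = f" "Add C (Zero C x y) f = f"
    using assms V.M.r_zero[of f] V.M.l_zero[of f] by simp_all
qed

lemma Zero_in: "x \<in> Obj C \<Longrightarrow> y \<in> Obj C \<Longrightarrow> Zero C x y \<in> Hom C x y"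
  using module.axioms(2)[OF module_Hom, of x y]
  by (metis abelian_group.axioms(1) abelian_monoid.zero_closed hom_module_simps(1,3))

lemma difference_zero:
  assumes "f \<in> Hom C x y" "g \<in> Hom C x y" "Add C f (Scale C (-1) g) = Zero C x y"
  shows "f = g"
proof -
  interpret V: module complex_ring "hom_module C x y"
    using module_Hom Hom_obj assms by blast
  have m: "Scale C (-1) g \<in> Hom C x y" using Hom_module_laws(1)[OF assms(2)] .
  have "Add C (Scale C (-1) g) g = Zero C x y"
    using Hom_module_laws(3,4)[OF assms(2)] Hom_module_laws(6)[OF assms(2), of "-1" 1] by simp
  hence "f = Add C f (Add C (Scale C (-1) g) g)" using Hom_module_laws(7)[OF assms(1)] by simp
  also have "\<dots> = Add C (Add C f (Scale C (-1) g)) g"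
    using V.M.a_assoc[of f "Scale C (-1) g" g] assms(1,2) m by simp
  also have "\<dots> = g" using assms Hom_module_laws(8)[OF assms(2)] by simp
  finally show ?thesis .
qed

lemma scale_arr:
  assumes "f \<in> Arr C"
  shows "Scale C z f \<in> Arr C" "Dom C (Scale C z f) = Dom C f" "Cod C (Scale C z f) = Cod C f"
  using Hom_module_laws(1)[OF in_Hom_self[OF assms], of z] by (simp_all add: Hom_def)

lemma comp_scale:
  assumes "f \<in> Arr C" "g \<in> Arr C" "Dom C g = Cod C f"
  shows "Scale C z g \<cdot> f = Scale C z (g \<cdot> f)" "g \<cdot> Scale C z f = Scale C z (g \<cdot> f)"
  using linear_map_smult[OF comp_linear_left[OF in_Hom_self[OF assms(1)], of "Cod C g"], of g z]
    linear_map_smult[OF comp_linear_right[OF in_Hom_self[OF assms(2)], of "Dom C f"], of f z] assms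
  by (simp_all add: Hom_def arr)

lemma comp_zero:
  shows "f \<in> Hom C x y \<Longrightarrow> z \<in> Obj C \<Longrightarrow> Zero C y z \<cdot> f = Zero C x z"
    and "g \<in> Hom C y z \<Longrightarrow> x \<in> Obj C \<Longrightarrow> g \<cdot> Zero C x y = Zero C x z"
proof -
  assume f: "f \<in> Hom C x y" and z: "z \<in> Obj C"
  show "Zero C y z \<cdot> f = Zero C x z"
    using linear_map_zero[OF module_Hom module_Hom comp_linear_left[OF f z]] Hom_obj[OF f] z by simp
next
  assume g: "g \<in> Hom C y z" and x: "x \<in> Obj C"
  show "g \<cdot> Zero C x y = Zero C x z"
    using linear_map_zero[OF module_Hom module_Hom comp_linear_right[OF g x]] Hom_obj[OF g] x by simp
qed

text \<open>A zero object has no nonzero morphisms, and a nonzero object has a nonzero identity.\<close>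

lemma zero_object_Hom:
  assumes "zero_object C z" "y \<in> Obj C"
  shows "f \<in> Hom C z y \<Longrightarrow> f = Zero C z y" "f \<in> Hom C y z \<Longrightarrow> f = Zero C y z"
  using assms Zero_in unfolding zero_object_def by blast+

lemma ident_nonzero:
  assumes "x \<in> Obj C" "\<not> zero_object C x"
  shows "ident C x \<noteq> Zero C x x"
proof
  assume 0: "ident C x = Zero C x x"
  have "zero_object C x"
    unfolding zero_object_def
  proof (intro conjI ballI)
    fix y assume y: "y \<in> Obj C"
    have "f = Zero C y x" if "f \<in> Hom C y x" for f
      using comp_ident_left[OF that] 0 comp_zero(1)[OF that assms(1)] by simp
    thus "\<exists>!f. f \<in> Hom C y x" using Zero_in[OF y assms(1)] by blast
    have "f = Zero C x y" if "f \<in> Hom C x y" for f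
      using comp_ident_right[OF that] 0 comp_zero(2)[OF that assms(1)] by simp
    thus "\<exists>!f. f \<in> Hom C x y" using Zero_in[OF assms(1) y] by blast
  qed (use assms in auto)
  thus False using assms by simp
qed

lemma Scale_ident_eq:
  assumes "v \<in> Hom C x y" "v \<noteq> Zero C x y" "Scale C z v = Scale C w v"
  shows "z = w"
proof (rule ccontr)
  assume "z \<noteq> w"
  have "Scale C (z - w) v = Add C (Scale C z v) (Scale C (- w) v)"
    using Hom_module_laws(6)[OF assms(1), of z "- w"] by simp
  also have "\<dots> = Scale C (w - w) v"
    using Hom_module_laws(6)[OF assms(1), of w "- w"] assms(3) by simp
  finally have "Scale C (inverse (z - w)) (Scale C (z - w) v) =
      Scale C (inverse (z - w)) (Scale C 0 v)" by simp
  hence "Scale C (inverse (z - w) * (z - w)) v = Scale C (inverse (z - w) * 0) v"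
    using Hom_module_laws(5)[OF assms(1)] by simp
  hence "Scale C 1 v = Scale C 0 v" using \<open>z \<noteq> w\<close> by simp
  thus False using Hom_module_laws(3,4)[OF assms(1)] assms(2) by simp
qed

subsection \<open>Isomorphisms\<close>

lemma iso_arrE:
  assumes "iso_arr C f" "f \<in> Hom C x y"
  obtains g where "g \<in> Hom C y x" "g \<cdot> f = ident C x" "f \<cdot> g = ident C y"
  using assms unfolding iso_arr_def by (auto simp: Hom_def)

lemma iso_arrI:
  assumes "f \<in> Hom C x y" "g \<in> Hom C y x" "g \<cdot> f = ident C x" "f \<cdot> g = ident C y"
  shows "iso_arr C f"
  using assms unfolding iso_arr_def by (auto simp: Hom_def)

lemma inv_arr:
  assumes "iso_arr C f" "f \<in> Hom C x y"
  shows "inv_arr C f \<in> Hom C y x" "inv_arr C f \<cdot> f = ident C x" "f \<cdot> inv_arr C f = ident C y"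
proof -
  obtain g where g: "g \<in> Hom C y x" "g \<cdot> f = ident C x" "f \<cdot> g = ident C y"
    using iso_arrE[OF assms] .
  have "inv_arr C f = g"
    unfolding inv_arr_def
  proof (rule the_equality)
    show "g \<in> Hom C (Cod C f) (Dom C f) \<and> g \<cdot> f = ident C (Dom C f) \<and> f \<cdot> g = ident C (Cod C f)"
      using g assms(2) by (simp add: Hom_def)
    fix h
    assume "h \<in> Hom C (Cod C f) (Dom C f) \<and> h \<cdot> f = ident C (Dom C f) \<and> f \<cdot> h = ident C (Cod C f)"
    hence h: "h \<in> Hom C y x" "h \<cdot> f = ident C x" using assms(2) by (auto simp: Hom_def)
    have "h = h \<cdot> (f \<cdot> g)" using g h comp_ident_right by simp
    also have "\<dots> = h \<cdot> f \<cdot> g" using comp_assoc[OF g(1) assms(2) h(1)] by simp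
    also have "\<dots> = g" using h g comp_ident_left by simp
    finally show "h = g" .
  qed
  thus "inv_arr C f \<in> Hom C y x" "inv_arr C f \<cdot> f = ident C x" "f \<cdot> inv_arr C f = ident C y"
    using g by simp_all
qed

lemma right_cancel:
  assumes "i \<in> Hom C x y" "j \<in> Hom C y x" "i \<cdot> j = ident C y"
    and "f \<in> Hom C y z" "g \<in> Hom C y z" "f \<cdot> i = g \<cdot> i"
  shows "f = g"
proof -
  have "f = f \<cdot> i \<cdot> j" using comp_assoc[OF assms(2,1,4)] assms(3) comp_ident_right[OF assms(4)] by simp
  also have "\<dots> = g" using comp_assoc[OF assms(2,1,5)] assms(3,6) comp_ident_right[OF assms(5)] by simp
  finally show ?thesis .
qed

lemma isomorphicE:
  assumes "isomorphic C x y"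
  obtains f g where "f \<in> Hom C x y" "g \<in> Hom C y x" "g \<cdot> f = ident C x" "f \<cdot> g = ident C y"
  using assms iso_arrE unfolding isomorphic_def by blast

lemma isomorphicI:
  "f \<in> Hom C x y \<Longrightarrow> g \<in> Hom C y x \<Longrightarrow> g \<cdot> f = ident C x \<Longrightarrow> f \<cdot> g = ident C y \<Longrightarrow> isomorphic C x y"
  using iso_arrI unfolding isomorphic_def by blast

lemma isomorphic_refl: "x \<in> Obj C \<Longrightarrow> isomorphic C x x"
  using isomorphicI[of "ident C x" x x "ident C x"] ident_in comp_ident_left by blast

lemma isomorphic_sym: "isomorphic C x y \<Longrightarrow> isomorphic C y x"
  by (metis isomorphicE isomorphicI)

lemma comp_iso_pair:
  assumes "f \<in> Hom C x y" "g \<in> Hom C y x" "g \<cdot> f = ident C x"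
    and "f' \<in> Hom C y z" "g' \<in> Hom C z y" "g' \<cdot> f' = ident C y"
  shows "(g \<cdot> g') \<cdot> (f' \<cdot> f) = ident C x"
proof -
  have "(g \<cdot> g') \<cdot> (f' \<cdot> f) = g \<cdot> (g' \<cdot> f') \<cdot> f"
    using assms(1,2,4,5) by (simp add: Hom_def arr comp_assoc_arr)
  thus ?thesis using assms by (simp add: comp_ident_right)
qed

lemma isomorphic_trans:
  assumes "isomorphic C x y" "isomorphic C y z"
  shows "isomorphic C x z"
proof -
  obtain f g where fg: "f \<in> Hom C x y" "g \<in> Hom C y x" "g \<cdot> f = ident C x" "f \<cdot> g = ident C y"
    using isomorphicE[OF assms(1)] .
  obtain f' g' where fg': "f' \<in> Hom C y z" "g' \<in> Hom C z y" "g' \<cdot> f' = ident C y" "f' \<cdot> g' = ident C z"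
    using isomorphicE[OF assms(2)] .
  show ?thesis
    by (rule isomorphicI[of "f' \<cdot> f" x z "g \<cdot> g'"])
      (use fg fg' comp_in comp_iso_pair in blast)+
qed

subsection \<open>Direct sums\<close>

lemma direct_sumD:
  assumes "direct_sum C n X s \<iota> \<pi>"
  shows "s \<in> Obj C"
    and "k < n \<Longrightarrow> X k \<in> Obj C" "k < n \<Longrightarrow> \<iota> k \<in> Hom C (X k) s" "k < n \<Longrightarrow> \<pi> k \<in> Hom C s (X k)"
    and "j < n \<Longrightarrow> k < n \<Longrightarrow> \<pi> j \<cdot> \<iota> k = (if j = k then ident C (X k) else Zero C (X k) (X j))"
    and "finsum (hom_module C s s) (\<lambda>k. \<iota> k \<cdot> \<pi> k) {..<n} = ident C s"
  using assms unfolding direct_sum_def by blast+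

lemma direct_sum_functional:
  assumes "direct_sum C n X s \<iota> \<pi>" and "linear_map (hom_module C s s) complex_module \<phi>"
  shows "\<phi> (ident C s) = (\<Sum>k<n. \<phi> (\<iota> k \<cdot> \<pi> k))"
  unfolding direct_sumD(6)[OF assms(1), symmetric]
  using direct_sumD(1-4)[OF assms(1)]
  by (intro linear_functional_finsum[OF module_Hom assms(2)]) (auto intro: comp_in)

lemma direct_sum_eq_zero:
  assumes ds: "direct_sum C n X s \<iota> \<pi>"
  shows "f \<in> Hom C s y \<Longrightarrow> (\<And>k. k < n \<Longrightarrow> f \<cdot> \<iota> k = Zero C (X k) y) \<Longrightarrow> f = Zero C s y"
    and "f \<in> Hom C y s \<Longrightarrow> (\<And>k. k < n \<Longrightarrow> \<pi> k \<cdot> f = Zero C y (X k)) \<Longrightarrow> f = Zero C y s"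
proof -
  note D = direct_sumD[OF ds]
  have in_ss: "\<iota> k \<cdot> \<pi> k \<in> carrier (hom_module C s s)" if "k \<in> {..<n}" for k
    using D that by (auto intro: comp_in)
  {
    assume f: "f \<in> Hom C s y" and 0: "\<And>k. k < n \<Longrightarrow> f \<cdot> \<iota> k = Zero C (X k) y"
    have y: "y \<in> Obj C" using Hom_obj[OF f] by simp
    interpret W: module complex_ring "hom_module C s y" using module_Hom D y by simp
    have "f = f \<cdot> ident C s" using comp_ident_right[OF f] by simp
    also have "\<dots> = finsum (hom_module C s y) (\<lambda>k. f \<cdot> (\<iota> k \<cdot> \<pi> k)) {..<n}"
      unfolding D(6)[symmetric]
      by (rule linear_map_finsum[OF module_Hom module_Hom comp_linear_right[OF f]])
        (use D y in_ss in auto)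
    also have "\<dots> = finsum (hom_module C s y) (\<lambda>k. \<zero>\<^bsub>hom_module C s y\<^esub>) {..<n}"
    proof (rule W.finsum_cong')
      fix k assume k: "k \<in> {..<n}"
      have "f \<cdot> (\<iota> k \<cdot> \<pi> k) = f \<cdot> \<iota> k \<cdot> \<pi> k" using comp_assoc[OF D(4) D(3) f] k by simp
      thus "f \<cdot> (\<iota> k \<cdot> \<pi> k) = \<zero>\<^bsub>hom_module C s y\<^esub>" using 0 k comp_zero(1)[OF D(4) y] by simp
    qed (use W.M.zero_closed in auto)
    finally show "f = Zero C s y" using W.finsum_zero[of "{..<n}"] by simp
  }
  {
    assume f: "f \<in> Hom C y s" and 0: "\<And>k. k < n \<Longrightarrow> \<pi> k \<cdot> f = Zero C y (X k)"
    have y: "y \<in> Obj C" using Hom_obj[OF f] by simp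
    interpret W: module complex_ring "hom_module C y s" using module_Hom D y by simp
    have "f = ident C s \<cdot> f" using comp_ident_left[OF f] by simp
    also have "\<dots> = finsum (hom_module C y s) (\<lambda>k. \<iota> k \<cdot> \<pi> k \<cdot> f) {..<n}"
      unfolding D(6)[symmetric]
      by (rule linear_map_finsum[OF module_Hom module_Hom comp_linear_left[OF f], of s])
        (use D y in_ss in auto)
    also have "\<dots> = finsum (hom_module C y s) (\<lambda>k. \<zero>\<^bsub>hom_module C y s\<^esub>) {..<n}"
    proof (rule W.finsum_cong')
      fix k assume k: "k \<in> {..<n}"
      have "\<iota> k \<cdot> \<pi> k \<cdot> f = \<iota> k \<cdot> (\<pi> k \<cdot> f)" using comp_assoc[OF f D(4) D(3)] k by simp
      thus "\<iota> k \<cdot> \<pi> k \<cdot> f = \<zero>\<^bsub>hom_module C y s\<^esub>" using 0 k comp_zero(2)[OF D(3) y] by simp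
    qed (use W.M.zero_closed in auto)
    finally show "f = Zero C y s" using W.finsum_zero[of "{..<n}"] by simp
  }
qed

end

section \<open>Schur's lemma\<close>

context abelian_category
begin

text \<open>The kernel of a nonzero morphism from a simple object is zero, so the morphism
  is monic, and a nonzero subobject of a simple object is everything.\<close>

lemma simple_iso:
  assumes "simple C x" "simple C y" "f \<in> Hom C x y" "f \<noteq> Zero C x y"
  shows "iso_arr C f"
proof -
  have x: "x \<in> Obj C" "\<not> zero_object C x" and y: "y \<in> Obj C"
    using assms unfolding simple_def by auto
  note f = in_HomD[OF assms(3)]
  obtain k where k: "is_kernel C f k" using kernel_ex[OF f(1)] by blast
  define w where "w = Dom C k"
  have kH: "k \<in> Hom C w x" and fk: "f \<cdot> k = Zero C w y"
    and univ: "\<And>v h. v \<in> Obj C \<Longrightarrow> h \<in> Hom C v x \<Longrightarrow> f \<cdot> h = Zero C v y \<Longrightarrow>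
          \<exists>!u. u \<in> Hom C v w \<and> k \<cdot> u = h"
    using k f unfolding is_kernel_def w_def by (auto simp: Hom_def)
  have w: "w \<in> Obj C" using Hom_obj[OF kH] by simp
  have "monic C k"
    unfolding monic_def
  proof (intro conjI ballI impI)
    fix v g h
    assume v: "v \<in> Obj C" and gh: "g \<in> Hom C v (Dom C k)" "h \<in> Hom C v (Dom C k)" and eq: "k \<cdot> g = k \<cdot> h"
    have kg: "k \<cdot> g \<in> Hom C v x" using comp_in[OF gh(1) in_Hom_self] kH by (simp add: Hom_def)
    have "f \<cdot> (k \<cdot> g) = Zero C v y"
      using comp_assoc[OF gh(1)[folded w_def] kH assms(3)] fk comp_zero(1)[OF gh(1)[folded w_def] y]
      by simp
    from univ[OF v kg this] show "g = h" using gh eq by (auto simp: w_def)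
  qed (use kH in \<open>simp add: Hom_def\<close>)
  hence "zero_object C w \<or> iso_arr C k"
    using assms(1) kH unfolding simple_def by (auto simp: Hom_def)
  moreover have "\<not> iso_arr C k"
  proof
    assume "iso_arr C k"
    then obtain g where g: "g \<in> Hom C x w" "k \<cdot> g = ident C x" using iso_arrE[OF _ kH] by metis
    have "f = f \<cdot> k \<cdot> g"
      using comp_assoc[OF g(1) kH assms(3)] g comp_ident_right[OF assms(3)] by simp
    thus False using fk comp_zero(1)[OF g(1) y] assms(4) by simp
  qed
  ultimately have zw: "zero_object C w" by simp
  have "monic C f"
    unfolding monic_def
  proof (intro conjI ballI impI)
    fix v g h
    assume v: "v \<in> Obj C" and gh: "g \<in> Hom C v (Dom C f)" "h \<in> Hom C v (Dom C f)" and eq: "f \<cdot> g = f \<cdot> h"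
    have gh': "g \<in> Hom C v x" "h \<in> Hom C v x" using gh f by simp_all
    define d where "d = Add C g (Scale C (-1) h)"
    have d: "d \<in> Hom C v x" unfolding d_def using gh' Hom_module_laws by blast
    have "f \<cdot> d = Add C (f \<cdot> g) (Scale C (-1) (f \<cdot> h))"
      unfolding d_def
      using linear_map_add[OF comp_linear_right[OF assms(3) v], of g "Scale C (-1) h"]
        linear_map_smult[OF comp_linear_right[OF assms(3) v], of h "-1"] gh' Hom_module_laws(1)
      by simp
    also have "\<dots> = Scale C (1 + -1) (f \<cdot> g)"
      using Hom_module_laws(3,6)[OF comp_in[OF gh'(1) assms(3)]] eq by metis
    also have "\<dots> = Zero C v y" using Hom_module_laws(4)[OF comp_in[OF gh'(1) assms(3)]] by simp
    finally obtain u where u: "u \<in> Hom C v w" "k \<cdot> u = d" using univ[OF v d] by blast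
    have "d = Zero C v x"
      using u zero_object_Hom(2)[OF zw v u(1)] comp_zero(2)[OF kH v] by simp
    thus "g = h" using difference_zero[OF gh'] by (simp add: d_def)
  qed (use f in simp)
  thus ?thesis using assms(2) f x unfolding simple_def by auto
qed

end

context locally_finite_category
begin

text \<open>Horner evaluation of a polynomial at an endomorphism.\<close>

definition poly_arr where
  "poly_arr x f p =
     fold_coeffs (\<lambda>c g. Add C (Scale C c (ident C x)) (f \<cdot> g)) p (Zero C x x)"

lemma poly_arr_zero: "poly_arr x f 0 = Zero C x x"
  by (simp add: poly_arr_def)

lemma poly_arr_pCons:
  assumes "f \<in> Hom C x x"
  shows "poly_arr x f (pCons c p) = Add C (Scale C c (ident C x)) (f \<cdot> poly_arr x f p)"
proof (cases "c = 0 \<and> p = 0")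
  case True
  have x: "x \<in> Obj C" using Hom_obj[OF assms] by simp
  show ?thesis
    using True Hom_module_laws(4,7)[OF ident_in[OF x]] comp_zero(2)[OF assms x]
      Hom_module_laws(8)[OF Zero_in[OF x x]]
    by (simp add: poly_arr_zero)
next
  case False
  thus ?thesis
    unfolding poly_arr_def
    by (cases "c = 0") (simp_all add: fold_coeffs_pCons_not_0_0_eq)
qed

lemma poly_arr_in:
  assumes "f \<in> Hom C x x"
  shows "poly_arr x f p \<in> Hom C x x"
proof (induction p)
  case 0
  thus ?case using Zero_in Hom_obj[OF assms] by (simp add: poly_arr_zero)
next
  case (pCons c p)
  thus ?case
    using Hom_module_laws(1,2) ident_in comp_in[OF _ assms] Hom_obj[OF assms]
    by (simp add: poly_arr_pCons[OF assms])
qed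

lemma poly_arr_smult_add:
  assumes f: "f \<in> Hom C x x"
  shows "poly_arr x f (p + smult z q) = Add C (poly_arr x f p) (Scale C z (poly_arr x f q))"
proof (induction p q rule: poly_induct2)
  case 0
  have x: "x \<in> Obj C" using Hom_obj[OF f] by simp
  interpret V: module complex_ring "hom_module C x x" by (rule module_Hom[OF x x])
  show ?case using V.smult_r_null[of z] V.M.l_zero[of "Zero C x x"] Zero_in[OF x x]
    by (simp add: poly_arr_zero)
next
  case (pCons a p b q)
  have x: "x \<in> Obj C" using Hom_obj[OF f] by simp
  interpret V: module complex_ring "hom_module C x x" by (rule module_Hom[OF x x])
  define P Q where "P = poly_arr x f p" and "Q = poly_arr x f q"
  have PQ: "P \<in> Hom C x x" "Q \<in> Hom C x x" unfolding P_def Q_def using poly_arr_in[OF f] by auto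
  have fPQ: "f \<cdot> P \<in> Hom C x x" "f \<cdot> Q \<in> Hom C x x" using PQ comp_in f by auto
  have id: "ident C x \<in> Hom C x x" using ident_in[OF x] .
  have sc: "Scale C w h \<in> Hom C x x" if "h \<in> Hom C x x" for w h
    using Hom_module_laws(1)[OF that] .
  have distr: "Scale C z (Add C g h) = Add C (Scale C z g) (Scale C z h)"
    if "g \<in> Hom C x x" "h \<in> Hom C x x" for g h
    using V.smult_r_distr[of z g h] that by simp
  have "f \<cdot> Add C P (Scale C z Q) = Add C (f \<cdot> P) (Scale C z (f \<cdot> Q))"
    using linear_map_add[OF comp_linear_right[OF f x], of P "Scale C z Q"]
      linear_map_smult[OF comp_linear_right[OF f x], of Q z] PQ sc by simp
  moreover have "Scale C (a + z * b) (ident C x)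
      = Add C (Scale C a (ident C x)) (Scale C z (Scale C b (ident C x)))"
    using Hom_module_laws(5,6)[OF id] by simp
  moreover have "Add C (Add C h1 h2) (Add C h3 h4) = Add C (Add C h1 h3) (Add C h2 h4)"
    if "h1 \<in> Hom C x x" "h2 \<in> Hom C x x" "h3 \<in> Hom C x x" "h4 \<in> Hom C x x" for h1 h2 h3 h4
    using V.M.add.m_assoc V.M.add.m_comm V.M.add.m_closed that
    by (metis V.M.add.m_lcomm hom_module_simps(1,2))
  ultimately show ?case
    using pCons.IH PQ fPQ id sc distr
    by (simp add: poly_arr_pCons[OF f] P_def[symmetric] Q_def[symmetric])
qed

text \<open>Every endomorphism \<open>f\<close> of a simple object is a scalar: a nonzero polynomial \<open>p\<close> of least degree
  with \<open>p(f) = 0\<close> has a root \<open>z\<close>; writing \<open>p = (X - z) q\<close>, the endomorphism \<open>q(f)\<close> is nonzero, hence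
  invertible, so \<open>f = z\<close>.\<close>

lemma simple_endo_scalar:
  assumes "simple C x" "f \<in> Hom C x x"
  shows "\<exists>z. f = Scale C z (ident C x)"
proof -
  note f = assms(2)
  have x: "x \<in> Obj C" "\<not> zero_object C x" using assms unfolding simple_def by auto
  have id: "ident C x \<in> Hom C x x" using ident_in[OF x(1)] .
  interpret V: module complex_ring "hom_module C x x" by (rule module_Hom[OF x(1) x(1)])
  have zero_smult: "Add C (Zero C x x) (Scale C z h) = Scale C z h" if "h \<in> Hom C x x" for z h
    using Hom_module_laws(8)[OF Hom_module_laws(1)[OF that]] .
  have smult: "poly_arr x f (smult z q) = Scale C z (poly_arr x f q)" for z q
    using poly_arr_smult_add[OF f, of 0 z q] zero_smult[OF poly_arr_in[OF f]]
    by (simp add: poly_arr_zero)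
  obtain N c where c: "\<exists>i<N. c i \<noteq> 0"
    and dep: "finsum (hom_module C x x) (\<lambda>i. Scale C (c i) (poly_arr x f (monom 1 i))) {..<N} = Zero C x x"
    using linear_dependence[OF module_Hom[OF x(1) x(1)] finite_dimensional_Hom[OF x(1) x(1)],
        of "\<lambda>i. poly_arr x f (monom 1 i)"] poly_arr_in[OF f] by auto
  have "poly_arr x f (\<Sum>i<n. monom (c i) i)
      = finsum (hom_module C x x) (\<lambda>i. Scale C (c i) (poly_arr x f (monom 1 i))) {..<n}" for n
  proof (induction n)
    case 0
    thus ?case by (simp add: poly_arr_zero)
  next
    case (Suc n)
    have in_V: "Scale C (c i) (poly_arr x f (monom 1 i)) \<in> carrier (hom_module C x x)" for i
      using Hom_module_laws(1)[OF poly_arr_in[OF f]] by simp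
    have "poly_arr x f (\<Sum>i<Suc n. monom (c i) i)
        = poly_arr x f ((\<Sum>i<n. monom (c i) i) + smult (c n) (monom 1 n))"
      by (simp add: smult_monom)
    also have "\<dots> = Add C (poly_arr x f (\<Sum>i<n. monom (c i) i)) (Scale C (c n) (poly_arr x f (monom 1 n)))"
      by (rule poly_arr_smult_add[OF f])
    finally show ?case
      using Suc.IH in_V V.M.add.m_comm V.M.finsum_closed[of "\<lambda>i. Scale C (c i) (poly_arr x f (monom 1 i))" "{..<n}"]
        V.M.finsum_insert[of "{..<n}" n "\<lambda>i. Scale C (c i) (poly_arr x f (monom 1 i))"]
      by (simp add: lessThan_Suc Pi_iff)
  qed
  hence "poly_arr x f (\<Sum>i<N. monom (c i) i) = Zero C x x" using dep by simp
  moreover have "(\<Sum>i<N. monom (c i) i) \<noteq> 0"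
  proof
    assume 0: "(\<Sum>i<N. monom (c i) i) = 0"
    obtain j where j: "j < N" "c j \<noteq> 0" using c by blast
    have "coeff (\<Sum>i<N. monom (c i) i) j = c j"
      using j by (simp add: coeff_sum if_distrib sum.delta)
    thus False using 0 j by simp
  qed
  ultimately have ex: "\<exists>p. p \<noteq> 0 \<and> poly_arr x f p = Zero C x x" by blast
  define p where "p = arg_min degree (\<lambda>p. p \<noteq> 0 \<and> poly_arr x f p = Zero C x x)"
  have p: "p \<noteq> 0" "poly_arr x f p = Zero C x x"
    using arg_min_natI[of "\<lambda>p. p \<noteq> 0 \<and> poly_arr x f p = Zero C x x" _ degree] ex
    unfolding p_def by blast+
  have min: "degree p \<le> degree q" if "q \<noteq> 0" "poly_arr x f q = Zero C x x" for q
    unfolding p_def by (rule arg_min_nat_le) (use that in auto)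
  have "\<not> constant (poly p)"
  proof
    assume "constant (poly p)"
    then obtain a where a: "p = [:a:]" using constant_degree degree_eq_zeroE by metis
    have "poly_arr x f p = Scale C a (ident C x)"
      unfolding a using poly_arr_pCons[OF f, of a 0] comp_zero(2)[OF f x(1)]
        Hom_module_laws(7)[OF Hom_module_laws(1)[OF id]] by (simp add: poly_arr_zero)
    hence "Scale C a (ident C x) = Scale C 0 (ident C x)" using p Hom_module_laws(4)[OF id] by simp
    hence "a = 0" using Scale_ident_eq[OF id ident_nonzero[OF x]] by blast
    thus False using p a by simp
  qed
  then obtain z where "poly p z = 0" using fundamental_theorem_of_algebra by blast
  then obtain q where q: "p = [:- z, 1:] * q" using poly_eq_0_iff_dvd by blast
  have q0: "q \<noteq> 0" using p(1) q by auto
  hence "degree q < degree p" unfolding q by (subst degree_mult_eq) auto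
  hence nz: "poly_arr x f q \<noteq> Zero C x x" using min[OF q0] by auto
  define g where "g = poly_arr x f q"
  have g: "g \<in> Hom C x x" unfolding g_def by (rule poly_arr_in[OF f])
  obtain h where h: "h \<in> Hom C x x" "g \<cdot> h = ident C x"
    using iso_arrE[OF simple_iso[OF assms(1,1) g] g] nz unfolding g_def by metis
  have "p = pCons 0 q + smult (- z) q" using q by (simp add: mult_pCons_left add.commute)
  hence "poly_arr x f p = Add C (poly_arr x f (pCons 0 q)) (Scale C (- z) g)"
    unfolding g_def using poly_arr_smult_add[OF f] by metis
  also have "poly_arr x f (pCons 0 q) = f \<cdot> g"
    using poly_arr_pCons[OF f, of 0 q] Hom_module_laws(4)[OF id]
      Hom_module_laws(8)[OF comp_in[OF g f]] by (simp add: g_def)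
  also have "Scale C (- z) g = Scale C (-1) (Scale C z g)" using Hom_module_laws(5)[OF g] by simp
  finally have "f \<cdot> g = Scale C z g"
    using p(2) difference_zero[OF comp_in[OF g f] Hom_module_laws(1)[OF g]] by simp
  hence "f \<cdot> g \<cdot> h = Scale C z (g \<cdot> h)"
    using comp_scale(1)[of h g z] g h by (simp add: Hom_def)
  thus ?thesis using h comp_assoc[OF h(1) g f] comp_ident_right[OF f] by auto
qed

end

definition eigenvalue :: "('o, 'a, 'x) lin_cat_scheme \<Rightarrow> 'o \<Rightarrow> 'a \<Rightarrow> complex" where
  "eigenvalue C x f = (THE z. f = Scale C z (ident C x))"

context locally_finite_category
begin

lemma simple_obj:
  assumes "simple C x"
  shows "x \<in> Obj C" "ident C x \<in> Hom C x x" "ident C x \<noteq> Zero C x x"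
  using assms ident_nonzero ident_in by (auto simp: simple_def)

lemma eigenvalue_Scale:
  assumes "simple C x"
  shows "eigenvalue C x (Scale C z (ident C x)) = z"
  unfolding eigenvalue_def using Scale_ident_eq[OF simple_obj(2,3)[OF assms]] by blast

lemma eigenvalue_ident:
  assumes "simple C x"
  shows "eigenvalue C x (ident C x) = 1"
  using eigenvalue_Scale[OF assms, of 1] Hom_module_laws(3)[OF simple_obj(2)[OF assms]] by simp

lemma eigenvalue_zero:
  assumes "simple C x"
  shows "eigenvalue C x (Zero C x x) = 0"
  using eigenvalue_Scale[OF assms, of 0] Hom_module_laws(4)[OF simple_obj(2)[OF assms]] by simp

lemma eigenvalue:
  assumes "simple C x" "f \<in> Hom C x x"
  shows "f = Scale C (eigenvalue C x f) (ident C x)"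
  using simple_endo_scalar[OF assms] eigenvalue_Scale[OF assms(1)] by metis

lemma linear_eigenvalue:
  assumes "simple C x"
  shows "linear_map (hom_module C x x) complex_module (eigenvalue C x)"
proof -
  note id = simple_obj(2)[OF assms]
  have "eigenvalue C x (Add C f g) = eigenvalue C x f + eigenvalue C x g"
    if "f \<in> Hom C x x" "g \<in> Hom C x x" for f g
    using eigenvalue[OF assms that(1)] eigenvalue[OF assms that(2)] Hom_module_laws(6)[OF id]
      eigenvalue_Scale[OF assms] by metis
  moreover have "eigenvalue C x (Scale C z f) = z * eigenvalue C x f" if "f \<in> Hom C x x" for f z
    using eigenvalue[OF assms that] Hom_module_laws(5)[OF id] eigenvalue_Scale[OF assms] by metis
  ultimately show ?thesis unfolding linear_map_def by simp
qed

text \<open>\<open>Hom(x, y)\<close> is spanned by any isomorphism \<open>v\<close>; the coefficient of \<open>f\<close> is read off from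
  \<open>f v\<^sup>-\<^sup>1\<close>.\<close>

lemma Hom_simple_iso:
  assumes "simple C y" "v \<in> Hom C x y" "w \<in> Hom C y x" "w \<cdot> v = ident C x" "f \<in> Hom C x y"
  shows "f = Scale C (eigenvalue C y (f \<cdot> w)) v"
proof -
  have fw: "f \<cdot> w \<in> Hom C y y" using comp_in assms by blast
  have "f = f \<cdot> w \<cdot> v" using comp_assoc[OF assms(2,3,5)] assms(4) comp_ident_right[OF assms(5)] by simp
  also have "\<dots> = Scale C (eigenvalue C y (f \<cdot> w)) (ident C y) \<cdot> v"
    using eigenvalue[OF assms(1) fw] by simp
  also have "\<dots> = Scale C (eigenvalue C y (f \<cdot> w)) (ident C y \<cdot> v)"
    using comp_scale(1)[of v "ident C y"] assms(2) simple_obj[OF assms(1)] by (simp add: Hom_def)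
  finally show ?thesis using comp_ident_left[OF assms(2)] by simp
qed

lemma Hom_simple_not_iso:
  assumes "simple C x" "simple C y" "\<not> isomorphic C x y" "f \<in> Hom C x y"
  shows "f = Zero C x y"
  using simple_iso[OF assms(1,2,4)] assms(3,4) unfolding isomorphic_def by blast

end

context semisimple_category
begin

text \<open>For a simple object \<open>d\<close>, composition \<open>Hom(x, d) \<times> Hom(d, x) \<rightarrow> End(d) = \<complex>\<close> is a perfect
  pairing, as one sees on the simple summands of \<open>x\<close>.\<close>

lemma simple_separates:
  assumes d: "simple C d"
  shows "f \<in> Hom C d x \<Longrightarrow> (\<And>\<psi>. \<psi> \<in> Hom C x d \<Longrightarrow> \<psi> \<cdot> f = Zero C d d) \<Longrightarrow> f = Zero C d x"
    and "\<psi> \<in> Hom C x d \<Longrightarrow> (\<And>f. f \<in> Hom C d x \<Longrightarrow> \<psi> \<cdot> f = Zero C d d) \<Longrightarrow> \<psi> = Zero C x d"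
proof -
  note d' = simple_obj[OF d]
  {
    assume f: "f \<in> Hom C d x" and 0: "\<And>\<psi>. \<psi> \<in> Hom C x d \<Longrightarrow> \<psi> \<cdot> f = Zero C d d"
    obtain n X \<iota> \<pi> where X: "\<forall>k<n. simple C (X k)" and ds: "direct_sum C n X x \<iota> \<pi>"
      using semisimple Hom_obj[OF f] by blast
    note D = direct_sumD[OF ds]
    show "f = Zero C d x"
    proof (rule direct_sum_eq_zero(2)[OF ds f], rule ccontr)
      fix k assume k: "k < n" and nz: "\<pi> k \<cdot> f \<noteq> Zero C d (X k)"
      have pf: "\<pi> k \<cdot> f \<in> Hom C d (X k)" using comp_in[OF f D(4)[OF k]] .
      obtain g where g: "g \<in> Hom C (X k) d" "g \<cdot> (\<pi> k \<cdot> f) = ident C d"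
        using iso_arrE[OF simple_iso[OF d _ pf nz] pf] X k by metis
      have "g \<cdot> (\<pi> k \<cdot> f) = g \<cdot> \<pi> k \<cdot> f" using comp_assoc[OF f D(4)[OF k] g(1)] by simp
      thus False using 0[OF comp_in[OF D(4)[OF k] g(1)]] g d' by simp
    qed
  }
  {
    assume f: "\<psi> \<in> Hom C x d" and 0: "\<And>f. f \<in> Hom C d x \<Longrightarrow> \<psi> \<cdot> f = Zero C d d"
    obtain n X \<iota> \<pi> where X: "\<forall>k<n. simple C (X k)" and ds: "direct_sum C n X x \<iota> \<pi>"
      using semisimple Hom_obj[OF f] by blast
    note D = direct_sumD[OF ds]
    show "\<psi> = Zero C x d"
    proof (rule direct_sum_eq_zero(1)[OF ds f], rule ccontr)
      fix k assume k: "k < n" and nz: "\<psi> \<cdot> \<iota> k \<noteq> Zero C (X k) d"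
      have pf: "\<psi> \<cdot> \<iota> k \<in> Hom C (X k) d" using comp_in[OF D(3)[OF k] f] .
      obtain g where g: "g \<in> Hom C d (X k)" "\<psi> \<cdot> \<iota> k \<cdot> g = ident C d"
        using iso_arrE[OF simple_iso[OF _ d pf nz] pf] X k by metis
      have "\<psi> \<cdot> \<iota> k \<cdot> g = \<psi> \<cdot> (\<iota> k \<cdot> g)" using comp_assoc[OF g(1) D(3)[OF k] f] by simp
      thus False using 0[OF comp_in[OF g(1) D(3)[OF k]]] g d' by simp
    qed
  }
qed

text \<open>For \<open>d = 1\<close> this allows to check equations between forms \<open>x \<rightarrow> 1\<close> on the states \<open>1 \<rightarrow> x\<close>.\<close>

lemma eq_if_agree_on_simple:
  assumes d: "simple C d" and \<psi>: "\<psi> \<in> Hom C x d" "\<psi>' \<in> Hom C x d"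
    and eq: "\<And>f. f \<in> Hom C d x \<Longrightarrow> \<psi> \<cdot> f = \<psi>' \<cdot> f"
  shows "\<psi> = \<psi>'"
proof (rule difference_zero[OF \<psi>], rule simple_separates(2)[OF d])
  have m: "Scale C (-1) \<psi>' \<in> Hom C x d" using Hom_module_laws(1)[OF \<psi>(2)] .
  show "Add C \<psi> (Scale C (-1) \<psi>') \<in> Hom C x d" using Hom_module_laws(2)[OF \<psi>(1) m] .
  fix f assume f: "f \<in> Hom C d x"
  have "Add C \<psi> (Scale C (-1) \<psi>') \<cdot> f = Add C (\<psi>' \<cdot> f) (Scale C (-1) (\<psi>' \<cdot> f))"
    using linear_map_add[OF comp_linear_left[OF f simple_obj(1)[OF d]], of \<psi> "Scale C (-1) \<psi>'"]
      linear_map_smult[OF comp_linear_left[OF f simple_obj(1)[OF d]], of \<psi>' "-1"] \<psi> m eq[OF f]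
    by simp
  also have "\<dots> = Scale C (1 + -1) (\<psi>' \<cdot> f)"
    using Hom_module_laws(3,6)[OF comp_in[OF f \<psi>(2)]] by metis
  also have "\<dots> = Zero C d d" using Hom_module_laws(4)[OF comp_in[OF f \<psi>(2)]] by simp
  finally show "Add C \<psi> (Scale C (-1) \<psi>') \<cdot> f = Zero C d d" .
qed

text \<open>For \<open>d = 1\<close> this turns a functional on the states of an algebra into a candidate for a counit.\<close>

lemma functional_by_simple:
  assumes d: "simple C d" and x: "x \<in> Obj C"
    and \<phi>: "linear_map (hom_module C d x) complex_module \<phi>"
  shows "\<exists>\<epsilon>\<in>Hom C x d. \<forall>h\<in>Hom C d x. \<epsilon> \<cdot> h = Scale C (\<phi> h) (ident C d)"
proof -
  note d' = simple_obj[OF d]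
  have "\<exists>\<epsilon>\<in>carrier (hom_module C x d). \<forall>h\<in>carrier (hom_module C d x).
      eigenvalue C d (\<epsilon> \<cdot> h) = \<phi> h"
  proof (rule functional_represented[OF module_Hom[OF d'(1) x] module_Hom[OF x d'(1)]
        finite_dimensional_Hom[OF d'(1) x] _ _ _ \<phi>])
    fix \<epsilon> assume "\<epsilon> \<in> carrier (hom_module C x d)"
    thus "linear_map (hom_module C d x) complex_module (\<lambda>h. eigenvalue C d (\<epsilon> \<cdot> h))"
      using linear_map_comp[OF comp_linear_right linear_eigenvalue[OF d]] d' by simp
  next
    fix h assume h: "h \<in> carrier (hom_module C d x)"
    thus "linear_map (hom_module C x d) complex_module (\<lambda>\<epsilon>. eigenvalue C d (\<epsilon> \<cdot> h))"
      using linear_map_comp[OF comp_linear_left linear_eigenvalue[OF d]] d' by simp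
    assume 0: "\<And>\<epsilon>. \<epsilon> \<in> carrier (hom_module C x d) \<Longrightarrow> eigenvalue C d (\<epsilon> \<cdot> h) = 0"
    have "h = Zero C d x"
    proof (rule simple_separates(1)[OF d])
      fix \<epsilon> assume \<epsilon>: "\<epsilon> \<in> Hom C x d"
      have "\<epsilon> \<cdot> h \<in> Hom C d d" using comp_in \<epsilon> h by auto
      from eigenvalue[OF d this] show "\<epsilon> \<cdot> h = Zero C d d"
        using 0[of \<epsilon>] \<epsilon> Hom_module_laws(4)[OF d'(2)] by simp
    qed (use h in simp)
    thus "h = \<zero>\<^bsub>hom_module C d x\<^esub>" by simp
  qed
  then obtain \<epsilon> where \<epsilon>: "\<epsilon> \<in> Hom C x d" "\<And>h. h \<in> Hom C d x \<Longrightarrow> eigenvalue C d (\<epsilon> \<cdot> h) = \<phi> h"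
    by auto
  have "\<epsilon> \<cdot> h = Scale C (\<phi> h) (ident C d)" if "h \<in> Hom C d x" for h
    using eigenvalue[OF d comp_in[OF that \<epsilon>(1)]] \<epsilon>(2)[OF that] by simp
  thus ?thesis using \<epsilon>(1) by blast
qed

end

text \<open>As weak congruence rules, these trivial equations keep a composite from being normalized over and
  over again while its domain and codomain are computed.\<close>

lemma typing_cong:
  "f \<in> S \<longleftrightarrow> f \<in> S" "Dom C f = Dom C f" "Cod C f = Cod C f"
  by simp_all

section \<open>Frobenius algebras in strict monoidal categories\<close>

context strict_monoidal_category
begin

lemma tens_arr:
  assumes "f \<in> Arr C" "g \<in> Arr C"
  shows "f \<otimes>\<^sub>m g \<in> Arr C" "Dom C (f \<otimes>\<^sub>m g) = Dom C f \<otimes>\<^sub>o Dom C g"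
    "Cod C (f \<otimes>\<^sub>m g) = Cod C f \<otimes>\<^sub>o Cod C g"
  using tensM_in[OF in_Hom_self[OF assms(1)] in_Hom_self[OF assms(2)]] by (simp_all add: Hom_def)

lemma interchange:
  assumes "f \<in> Arr C" "f' \<in> Arr C" "g \<in> Arr C" "g' \<in> Arr C" "Dom C f' = Cod C f" "Dom C g' = Cod C g"
  shows "(f' \<otimes>\<^sub>m g') \<cdot> (f \<otimes>\<^sub>m g) = (f' \<cdot> f) \<otimes>\<^sub>m (g' \<cdot> g)"
  using tensM_comp[of f "Dom C f" "Cod C f" f' "Cod C f'" g "Dom C g" "Cod C g" g' "Cod C g'"] assms
  by (simp add: Hom_def)

text \<open>The rules collected in \<open>layers\<close> bring a morphism into the form of a composite, nested to the
  right, of layers \<open>id\<^sub>x \<otimes> f \<otimes> id\<^sub>y\<close>. Two such composites that differ by moving boxes past each other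
  are compared by \<open>slide\<close>.\<close>

lemma whisker_comp:
  assumes "f \<in> Arr C" "g \<in> Arr C" "Dom C g = Cod C f" "x \<in> Obj C"
  shows "ident C x \<otimes>\<^sub>m (g \<cdot> f) = (ident C x \<otimes>\<^sub>m g) \<cdot> (ident C x \<otimes>\<^sub>m f)"
    and "(g \<cdot> f) \<otimes>\<^sub>m ident C x = (g \<otimes>\<^sub>m ident C x) \<cdot> (f \<otimes>\<^sub>m ident C x)"
  using assms interchange[of "ident C x" "ident C x" f g] interchange[of f g "ident C x" "ident C x"]
  by (simp_all add: arr)

lemma ident_ident_tens:
  assumes "x \<in> Obj C" "y \<in> Obj C" "f \<in> Arr C"
  shows "ident C x \<otimes>\<^sub>m (ident C y \<otimes>\<^sub>m f) = ident C (x \<otimes>\<^sub>o y) \<otimes>\<^sub>m f"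
  using tensM_assoc[of "ident C x" "ident C y" f] tensM_ident[of x y] assms by (simp add: arr)

lemmas tarr = arr tens_arr tensO_in unit_obj_in tensO_unit tensM_unit tensO_assoc tensM_assoc
  tensM_ident

lemmas layers = tarr whisker_comp ident_ident_tens comp_assoc_arr

lemma exchange:
  assumes "f \<in> Arr C" "g \<in> Arr C"
  shows "(f \<otimes>\<^sub>m ident C (Cod C g)) \<cdot> (ident C (Dom C f) \<otimes>\<^sub>m g) = f \<otimes>\<^sub>m g"
    and "(ident C (Cod C f) \<otimes>\<^sub>m g) \<cdot> (f \<otimes>\<^sub>m ident C (Dom C g)) = f \<otimes>\<^sub>m g"
  using assms interchange[of "ident C (Dom C f)" f g "ident C (Cod C g)"]
    interchange[of f "ident C (Cod C f)" "ident C (Dom C g)" g]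
  by (simp_all add: arr)

lemma slide:
  assumes "f \<in> Hom C x x'" "g \<in> Hom C y y'"
  shows "(f \<otimes>\<^sub>m ident C y') \<cdot> (ident C x \<otimes>\<^sub>m g) = (ident C x' \<otimes>\<^sub>m g) \<cdot> (f \<otimes>\<^sub>m ident C y)"
  using exchange[of f g] assms by (simp add: Hom_def)

lemma slide_state:
  assumes "g \<in> Hom C y y'" "f \<in> Hom C (unit_obj C) x"
  shows "(f \<otimes>\<^sub>m ident C y') \<cdot> g = (ident C x \<otimes>\<^sub>m g) \<cdot> (f \<otimes>\<^sub>m ident C y)"
    and "(ident C y' \<otimes>\<^sub>m f) \<cdot> g = (g \<otimes>\<^sub>m ident C x) \<cdot> (ident C y \<otimes>\<^sub>m f)"
  using slide[OF assms(2,1)] slide[OF assms] tensM_unit[of g] assms(1) by (simp_all add: Hom_def)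

text \<open>Bending one leg of the multiplication round with \<open>\<delta>\<close>, on either side, gives the same
  comultiplication: pairing \<open>\<Delta>\<close> with \<open>A\<close> by \<open>\<kappa> = \<epsilon> \<mu>\<close> gives back \<open>\<mu>\<close>, by associativity and a
  zigzag, and when \<open>\<mu>\<close> is so expressed in the other candidate, the other zigzag leaves \<open>\<Delta>\<close>. With both
  expressions for \<open>\<Delta>\<close> at hand, coassociativity and the Frobenius laws reduce to associativity, and the
  counit laws to the zigzags.\<close>

lemma frobenius_from_nondegenerate_form:
  assumes alg: "algebra_in C A \<mu> \<eta>" and \<epsilon>: "\<epsilon> \<in> Hom C A (unit_obj C)"
    and \<delta>: "\<delta> \<in> Hom C (unit_obj C) (A \<otimes>\<^sub>o A)"
    and zig1: "(ident C A \<otimes>\<^sub>m (\<epsilon> \<cdot> \<mu>)) \<cdot> (\<delta> \<otimes>\<^sub>m ident C A) = ident C A"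
    and zig2: "((\<epsilon> \<cdot> \<mu>) \<otimes>\<^sub>m ident C A) \<cdot> (ident C A \<otimes>\<^sub>m \<delta>) = ident C A"
  defines "\<Delta> \<equiv> (ident C A \<otimes>\<^sub>m \<mu>) \<cdot> (\<delta> \<otimes>\<^sub>m ident C A)"
  shows "frobenius_algebra C A \<mu> \<eta> \<Delta> \<epsilon>" and "\<Delta> \<cdot> \<eta> = \<delta>"
    and "\<Delta> = (\<mu> \<otimes>\<^sub>m ident C A) \<cdot> (ident C A \<otimes>\<^sub>m \<delta>)"
proof -
  let ?I = "ident C A"
  have A [simp]: "A \<in> Obj C"
    and \<mu>: "\<mu> \<in> Hom C (A \<otimes>\<^sub>o A) A" and \<eta>: "\<eta> \<in> Hom C (unit_obj C) A"
    and assoc: "\<mu> \<cdot> (\<mu> \<otimes>\<^sub>m ?I) = \<mu> \<cdot> (?I \<otimes>\<^sub>m \<mu>)"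
    and unit: "\<mu> \<cdot> (?I \<otimes>\<^sub>m \<eta>) = ?I"
    using alg unfolding algebra_in_def by auto
  note [simp] = in_HomD[OF \<mu>] in_HomD[OF \<eta>] in_HomD[OF \<epsilon>] in_HomD[OF \<delta>]
  define \<kappa> where "\<kappa> = \<epsilon> \<cdot> \<mu>"
  have \<kappa> [simp]: "\<kappa> \<in> Arr C" "Dom C \<kappa> = A \<otimes>\<^sub>o A" "Cod C \<kappa> = unit_obj C"
    unfolding \<kappa>_def by (simp_all add: tarr cong: typing_cong)
  note zig = zig1[folded \<kappa>_def] zig2[folded \<kappa>_def]
  have inv: "\<kappa> \<cdot> (\<mu> \<otimes>\<^sub>m ?I) = \<kappa> \<cdot> (?I \<otimes>\<^sub>m \<mu>)"
    unfolding \<kappa>_def using assoc by (simp add: layers cong: typing_cong)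
  define P where "P = (\<mu> \<otimes>\<^sub>m ?I) \<cdot> (?I \<otimes>\<^sub>m \<delta>)"
  have \<Delta> [simp]: "\<Delta> \<in> Arr C" "Dom C \<Delta> = A" "Cod C \<Delta> = A \<otimes>\<^sub>o A"
    unfolding \<Delta>_def by (simp_all add: tarr cong: typing_cong)
  have P [simp]: "P \<in> Arr C" "Dom C P = A" "Cod C P = A \<otimes>\<^sub>o A"
    unfolding P_def by (simp_all add: tarr cong: typing_cong)
  have bend: "(?I \<otimes>\<^sub>m \<kappa>) \<cdot> (\<Delta> \<otimes>\<^sub>m ?I) = \<mu>"
  proof -
    have "(?I \<otimes>\<^sub>m \<kappa>) \<cdot> (\<Delta> \<otimes>\<^sub>m ?I)
        = (?I \<otimes>\<^sub>m (\<kappa> \<cdot> (\<mu> \<otimes>\<^sub>m ?I))) \<cdot> (\<delta> \<otimes>\<^sub>m ident C (A \<otimes>\<^sub>o A))"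
      unfolding \<Delta>_def by (simp add: layers cong: typing_cong)
    also have "\<dots> = (?I \<otimes>\<^sub>m \<kappa>) \<cdot> ((ident C (A \<otimes>\<^sub>o A) \<otimes>\<^sub>m \<mu>) \<cdot> (\<delta> \<otimes>\<^sub>m ident C (A \<otimes>\<^sub>o A)))"
      unfolding inv by (simp add: layers cong: typing_cong)
    also have "(ident C (A \<otimes>\<^sub>o A) \<otimes>\<^sub>m \<mu>) \<cdot> (\<delta> \<otimes>\<^sub>m ident C (A \<otimes>\<^sub>o A))
        = (\<delta> \<otimes>\<^sub>m ?I) \<cdot> (ident C (unit_obj C) \<otimes>\<^sub>m \<mu>)"
      by (rule slide[symmetric]) (auto simp: tarr in_Hom_iff cong: typing_cong)
    also have "(?I \<otimes>\<^sub>m \<kappa>) \<cdot> ((\<delta> \<otimes>\<^sub>m ?I) \<cdot> (ident C (unit_obj C) \<otimes>\<^sub>m \<mu>)) = ?I \<cdot> \<mu>"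
      using comp_eq_assoc[OF zig(1), of \<mu>] by (simp add: tarr cong: typing_cong)
    finally show ?thesis by (simp add: arr)
  qed
  have P_eq: "P = \<Delta>"
  proof -
    have "P = (?I \<otimes>\<^sub>m \<kappa> \<otimes>\<^sub>m ?I) \<cdot> ((\<Delta> \<otimes>\<^sub>m ident C (A \<otimes>\<^sub>o A)) \<cdot> (?I \<otimes>\<^sub>m \<delta>))"
      unfolding P_def bend[symmetric] by (simp add: layers cong: typing_cong)
    also have "(\<Delta> \<otimes>\<^sub>m ident C (A \<otimes>\<^sub>o A)) \<cdot> (?I \<otimes>\<^sub>m \<delta>)
        = (ident C (A \<otimes>\<^sub>o A) \<otimes>\<^sub>m \<delta>) \<cdot> (\<Delta> \<otimes>\<^sub>m ident C (unit_obj C))"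
      by (rule slide) (auto simp: tarr in_Hom_iff cong: typing_cong)
    also have "(?I \<otimes>\<^sub>m \<kappa> \<otimes>\<^sub>m ?I) \<cdot> ((ident C (A \<otimes>\<^sub>o A) \<otimes>\<^sub>m \<delta>) \<cdot> (\<Delta> \<otimes>\<^sub>m ident C (unit_obj C)))
        = (?I \<otimes>\<^sub>m ((\<kappa> \<otimes>\<^sub>m ?I) \<cdot> (?I \<otimes>\<^sub>m \<delta>))) \<cdot> \<Delta>"
      by (simp add: layers cong: typing_cong)
    also have "\<dots> = \<Delta>" unfolding zig by (simp add: tarr cong: typing_cong)
    finally show ?thesis .
  qed
  show \<Delta>_alt: "\<Delta> = (\<mu> \<otimes>\<^sub>m ?I) \<cdot> (?I \<otimes>\<^sub>m \<delta>)" using P_eq P_def by simp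
  have coassoc: "(\<Delta> \<otimes>\<^sub>m ?I) \<cdot> \<Delta> = (?I \<otimes>\<^sub>m \<Delta>) \<cdot> \<Delta>"
  proof -
    let ?B = "ident C (A \<otimes>\<^sub>o A)" and ?T = "ident C (A \<otimes>\<^sub>o A \<otimes>\<^sub>o A)"
    have "\<mu> \<otimes>\<^sub>m ?I \<in> Hom C (A \<otimes>\<^sub>o A \<otimes>\<^sub>o A) (A \<otimes>\<^sub>o A)" "?I \<otimes>\<^sub>m \<delta> \<in> Hom C A (A \<otimes>\<^sub>o A \<otimes>\<^sub>o A)"
      by (simp_all add: tarr in_Hom_iff cong: typing_cong)
    note s1 = slide_state(1)[OF this(1) \<delta>] and s2 = slide_state(1)[OF this(2) \<delta>]
    have s3: "(\<mu> \<otimes>\<^sub>m ?B) \<cdot> (?B \<otimes>\<^sub>m \<delta>) = (?I \<otimes>\<^sub>m \<delta>) \<cdot> (\<mu> \<otimes>\<^sub>m ident C (unit_obj C))"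
      by (rule slide) (auto simp: tarr in_Hom_iff cong: typing_cong)
    let ?X = "(?I \<otimes>\<^sub>m \<mu> \<otimes>\<^sub>m ?I) \<cdot> ((?I \<otimes>\<^sub>m (?I \<otimes>\<^sub>m \<mu>) \<otimes>\<^sub>m ?I) \<cdot> ((?B \<otimes>\<^sub>m ?I \<otimes>\<^sub>m \<delta>) \<cdot> (\<delta> \<otimes>\<^sub>m ?I)))"
    let ?Y = "(?I \<otimes>\<^sub>m \<mu> \<otimes>\<^sub>m ?I) \<cdot> ((?I \<otimes>\<^sub>m (\<mu> \<otimes>\<^sub>m ?I) \<otimes>\<^sub>m ?I) \<cdot> ((?B \<otimes>\<^sub>m ?I \<otimes>\<^sub>m \<delta>) \<cdot> (\<delta> \<otimes>\<^sub>m ?I)))"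
    have "(\<Delta> \<otimes>\<^sub>m ?I) \<cdot> \<Delta> = (\<Delta> \<otimes>\<^sub>m ?I) \<cdot> ((\<mu> \<otimes>\<^sub>m ?I) \<cdot> (?I \<otimes>\<^sub>m \<delta>))" using \<Delta>_alt by simp
    also have "\<dots> = (?I \<otimes>\<^sub>m \<mu> \<otimes>\<^sub>m ?I) \<cdot> (((\<delta> \<otimes>\<^sub>m ?B) \<cdot> (\<mu> \<otimes>\<^sub>m ?I)) \<cdot> (?I \<otimes>\<^sub>m \<delta>))"
      unfolding \<Delta>_def by (simp add: layers cong: typing_cong)
    also have "\<dots> = (?I \<otimes>\<^sub>m \<mu> \<otimes>\<^sub>m ?I) \<cdot> ((?B \<otimes>\<^sub>m \<mu> \<otimes>\<^sub>m ?I) \<cdot> ((\<delta> \<otimes>\<^sub>m ?T) \<cdot> (?I \<otimes>\<^sub>m \<delta>)))"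
      unfolding s1 by (simp add: layers cong: typing_cong)
    also have "\<dots> = ?X"
      unfolding s2 by (simp add: layers cong: typing_cong)
    also have "?X = ?Y"
    proof -
      have "(?I \<otimes>\<^sub>m \<mu> \<otimes>\<^sub>m ?I) \<cdot> (?I \<otimes>\<^sub>m (?I \<otimes>\<^sub>m \<mu>) \<otimes>\<^sub>m ?I) = ?I \<otimes>\<^sub>m (\<mu> \<cdot> (?I \<otimes>\<^sub>m \<mu>)) \<otimes>\<^sub>m ?I"
        by (simp add: layers cong: typing_cong)
      also have "\<dots> = (?I \<otimes>\<^sub>m \<mu> \<otimes>\<^sub>m ?I) \<cdot> (?I \<otimes>\<^sub>m (\<mu> \<otimes>\<^sub>m ?I) \<otimes>\<^sub>m ?I)"
        unfolding assoc[symmetric] by (simp add: layers cong: typing_cong)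
      finally have e: "(?I \<otimes>\<^sub>m \<mu> \<otimes>\<^sub>m ?I) \<cdot> (?I \<otimes>\<^sub>m (?I \<otimes>\<^sub>m \<mu>) \<otimes>\<^sub>m ?I)
        = (?I \<otimes>\<^sub>m \<mu> \<otimes>\<^sub>m ?I) \<cdot> (?I \<otimes>\<^sub>m (\<mu> \<otimes>\<^sub>m ?I) \<otimes>\<^sub>m ?I)" .
      show ?thesis
        by (subst comp_eq_assoc[OF e]; (simp add: tarr comp_assoc_arr cong: typing_cong)?)
    qed
    also have "?Y = (?I \<otimes>\<^sub>m \<mu> \<otimes>\<^sub>m ?I) \<cdot> ((?I \<otimes>\<^sub>m ((\<mu> \<otimes>\<^sub>m ?B) \<cdot> (?B \<otimes>\<^sub>m \<delta>))) \<cdot> (\<delta> \<otimes>\<^sub>m ?I))"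
      by (simp add: layers cong: typing_cong)
    also have "\<dots> = (?I \<otimes>\<^sub>m ((\<mu> \<otimes>\<^sub>m ?I) \<cdot> (?I \<otimes>\<^sub>m \<delta>))) \<cdot> ((?I \<otimes>\<^sub>m \<mu>) \<cdot> (\<delta> \<otimes>\<^sub>m ?I))"
      unfolding s3 by (simp add: layers cong: typing_cong)
    also have "\<dots> = (?I \<otimes>\<^sub>m \<Delta>) \<cdot> \<Delta>" using \<Delta>_alt by (simp add: \<Delta>_def[symmetric])
    finally show ?thesis .
  qed
  have counit1: "(\<epsilon> \<otimes>\<^sub>m ?I) \<cdot> \<Delta> = ?I"
  proof -
    have "(\<epsilon> \<otimes>\<^sub>m ?I) \<cdot> \<Delta> = (\<kappa> \<otimes>\<^sub>m ?I) \<cdot> (?I \<otimes>\<^sub>m \<delta>)"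
      unfolding \<Delta>_alt \<kappa>_def by (simp add: layers cong: typing_cong)
    thus ?thesis using zig by simp
  qed
  have counit2: "(?I \<otimes>\<^sub>m \<epsilon>) \<cdot> \<Delta> = ?I"
  proof -
    have "(?I \<otimes>\<^sub>m \<epsilon>) \<cdot> \<Delta> = (?I \<otimes>\<^sub>m \<kappa>) \<cdot> (\<delta> \<otimes>\<^sub>m ?I)"
      unfolding \<Delta>_def \<kappa>_def by (simp add: layers cong: typing_cong)
    thus ?thesis using zig by simp
  qed
  have frob1: "\<Delta> \<cdot> \<mu> = (\<mu> \<otimes>\<^sub>m ?I) \<cdot> (?I \<otimes>\<^sub>m \<Delta>)"
  proof -
    let ?B = "ident C (A \<otimes>\<^sub>o A)"
    have "(\<mu> \<otimes>\<^sub>m ?I) \<cdot> (?I \<otimes>\<^sub>m \<Delta>) = ((\<mu> \<cdot> (?I \<otimes>\<^sub>m \<mu>)) \<otimes>\<^sub>m ?I) \<cdot> (?B \<otimes>\<^sub>m \<delta>)"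
      unfolding \<Delta>_alt by (simp add: layers cong: typing_cong)
    also have "\<dots> = (\<mu> \<otimes>\<^sub>m ?I) \<cdot> ((\<mu> \<otimes>\<^sub>m ?B) \<cdot> (?B \<otimes>\<^sub>m \<delta>))"
      unfolding assoc[symmetric] by (simp add: layers cong: typing_cong)
    also have "(\<mu> \<otimes>\<^sub>m ?B) \<cdot> (?B \<otimes>\<^sub>m \<delta>) = (?I \<otimes>\<^sub>m \<delta>) \<cdot> (\<mu> \<otimes>\<^sub>m ident C (unit_obj C))"
      by (rule slide) (auto simp: tarr in_Hom_iff cong: typing_cong)
    also have "(\<mu> \<otimes>\<^sub>m ?I) \<cdot> ((?I \<otimes>\<^sub>m \<delta>) \<cdot> (\<mu> \<otimes>\<^sub>m ident C (unit_obj C))) = \<Delta> \<cdot> \<mu>"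
      unfolding \<Delta>_alt by (simp add: layers cong: typing_cong)
    finally show ?thesis by simp
  qed
  have frob2: "\<Delta> \<cdot> \<mu> = (?I \<otimes>\<^sub>m \<mu>) \<cdot> (\<Delta> \<otimes>\<^sub>m ?I)"
  proof -
    let ?B = "ident C (A \<otimes>\<^sub>o A)"
    have "(?I \<otimes>\<^sub>m \<mu>) \<cdot> (\<Delta> \<otimes>\<^sub>m ?I) = (?I \<otimes>\<^sub>m (\<mu> \<cdot> (\<mu> \<otimes>\<^sub>m ?I))) \<cdot> (\<delta> \<otimes>\<^sub>m ?B)"
      unfolding \<Delta>_def by (simp add: layers cong: typing_cong)
    also have "\<dots> = (?I \<otimes>\<^sub>m \<mu>) \<cdot> ((?B \<otimes>\<^sub>m \<mu>) \<cdot> (\<delta> \<otimes>\<^sub>m ?B))"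
      unfolding assoc by (simp add: layers cong: typing_cong)
    also have "(?B \<otimes>\<^sub>m \<mu>) \<cdot> (\<delta> \<otimes>\<^sub>m ?B) = (\<delta> \<otimes>\<^sub>m ?I) \<cdot> (ident C (unit_obj C) \<otimes>\<^sub>m \<mu>)"
      by (rule slide[symmetric]) (auto simp: tarr in_Hom_iff cong: typing_cong)
    also have "(?I \<otimes>\<^sub>m \<mu>) \<cdot> ((\<delta> \<otimes>\<^sub>m ?I) \<cdot> (ident C (unit_obj C) \<otimes>\<^sub>m \<mu>)) = \<Delta> \<cdot> \<mu>"
      unfolding \<Delta>_def by (simp add: layers cong: typing_cong)
    finally show ?thesis by simp
  qed
  have \<Delta>_in: "\<Delta> \<in> Hom C A (A \<otimes>\<^sub>o A)" by (simp add: Hom_def)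
  show "frobenius_algebra C A \<mu> \<eta> \<Delta> \<epsilon>"
    unfolding frobenius_algebra_def coalgebra_in_def
    using alg A \<Delta>_in \<epsilon> coassoc counit1 counit2 frob1 frob2 by blast
  show "\<Delta> \<cdot> \<eta> = \<delta>"
  proof -
    have "\<Delta> \<cdot> \<eta> = (?I \<otimes>\<^sub>m \<mu>) \<cdot> ((\<delta> \<otimes>\<^sub>m ?I) \<cdot> (ident C (unit_obj C) \<otimes>\<^sub>m \<eta>))"
      unfolding \<Delta>_def by (simp add: layers cong: typing_cong)
    also have "(\<delta> \<otimes>\<^sub>m ?I) \<cdot> (ident C (unit_obj C) \<otimes>\<^sub>m \<eta>)
        = (ident C (A \<otimes>\<^sub>o A) \<otimes>\<^sub>m \<eta>) \<cdot> (\<delta> \<otimes>\<^sub>m ident C (unit_obj C))"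
      by (rule slide) (auto simp: tarr in_Hom_iff cong: typing_cong)
    also have "(?I \<otimes>\<^sub>m \<mu>) \<cdot> ((ident C (A \<otimes>\<^sub>o A) \<otimes>\<^sub>m \<eta>) \<cdot> (\<delta> \<otimes>\<^sub>m ident C (unit_obj C)))
        = (?I \<otimes>\<^sub>m (\<mu> \<cdot> (?I \<otimes>\<^sub>m \<eta>))) \<cdot> \<delta>"
      by (simp add: layers cong: typing_cong)
    also have "\<dots> = \<delta>" unfolding unit by (simp add: tarr cong: typing_cong)
    finally show ?thesis .
  qed
qed

end

section \<open>Coherence in module categories\<close>

context module_category
begin

abbreviation compM (infixl \<open>\<cdot>\<^sub>M\<close> 55) where "g \<cdot>\<^sub>M f \<equiv> g \<cdot>\<^bsub>M\<^esub> f"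
abbreviation compC (infixl \<open>\<cdot>\<^sub>C\<close> 55) where "g \<cdot>\<^sub>C f \<equiv> g \<cdot>\<^bsub>C\<^esub> f"
abbreviation tensC (infixr \<open>\<otimes>\<^sub>C\<close> 70) where "f \<otimes>\<^sub>C g \<equiv> f \<otimes>\<^sub>m\<^bsub>C\<^esub> g"
abbreviation tensOC (infixr \<open>\<otimes>\<^sub>O\<close> 70) where "x \<otimes>\<^sub>O y \<equiv> x \<otimes>\<^sub>o\<^bsub>C\<^esub> y"
abbreviation actMM (infixr \<open>\<rhd>\<close> 65) where "f \<rhd> g \<equiv> f \<triangleright>\<^sub>m\<^bsub>M\<^esub> g"
abbreviation actOM (infixr \<open>\<rhd>\<^sub>O\<close> 65) where "x \<rhd>\<^sub>O n \<equiv> x \<triangleright>\<^sub>o\<^bsub>M\<^esub> n"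
abbreviation idC where "idC \<equiv> ident C"
abbreviation idM where "idM \<equiv> ident M"
abbreviation unitC (\<open>\<one>\<^sub>C\<close>) where "\<one>\<^sub>C \<equiv> unit_obj C"
abbreviation assM where "assM \<equiv> act_assoc M"
abbreviation uniM where "uniM \<equiv> act_unit M"

lemma act_arr:
  assumes "f \<in> Arr C" "g \<in> Arr M"
  shows "f \<rhd> g \<in> Arr M" "Dom M (f \<rhd> g) = Dom C f \<rhd>\<^sub>O Dom M g" "Cod M (f \<rhd> g) = Cod C f \<rhd>\<^sub>O Cod M g"
  using actM_in[OF in_Hom_self[OF assms(1)] in_Hom_self[OF assms(2)]] by (simp_all add: Hom_def)

lemma act_comp:
  assumes "f \<in> Arr C" "f' \<in> Arr C" "g \<in> Arr M" "g' \<in> Arr M" "Dom C f' = Cod C f" "Dom M g' = Cod M g"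
  shows "(f' \<rhd> g') \<cdot>\<^sub>M (f \<rhd> g) = (f' \<cdot>\<^sub>C f) \<rhd> (g' \<cdot>\<^sub>M g)"
  using actM_comp[of f "Dom C f" "Cod C f" f' "Cod C f'" g "Dom M g" "Cod M g" g' "Cod M g'"] assms
  by (simp add: Hom_def)

lemma act_whisker:
  assumes "F \<in> Arr M" "G \<in> Arr M" "Dom M G = Cod M F" "c \<in> Obj C"
  shows "idC c \<rhd> (G \<cdot>\<^sub>M F) = (idC c \<rhd> G) \<cdot>\<^sub>M (idC c \<rhd> F)"
  using assms act_comp[of "idC c" "idC c" F G] by (simp add: C.arr)

lemma whisker_act:
  assumes "f \<in> Arr C" "g \<in> Arr C" "Dom C g = Cod C f" "n \<in> Obj M"
  shows "(g \<cdot>\<^sub>C f) \<rhd> idM n = (g \<rhd> idM n) \<cdot>\<^sub>M (f \<rhd> idM n)"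
  using assms act_comp[of f g "idM n" "idM n"] by (simp add: M.arr)

lemma act_slide:
  assumes "f \<in> Hom C c d" "F \<in> Hom M n n'"
  shows "(f \<rhd> idM n') \<cdot>\<^sub>M (idC c \<rhd> F) = (idC d \<rhd> F) \<cdot>\<^sub>M (f \<rhd> idM n)"
  using assms act_comp[of "idC c" f F "idM n'"] act_comp[of f "idC d" "idM n" F]
  by (simp add: in_Hom_iff M.arr C.arr C.Hom_obj M.Hom_obj)

lemma act_split:
  assumes "f \<in> Hom C c d" "F \<in> Hom M n n'"
  shows "f \<rhd> F = (idC d \<rhd> F) \<cdot>\<^sub>M (f \<rhd> idM n)"
  using assms act_comp[of f "idC d" "idM n" F]
  by (simp add: in_Hom_iff M.arr C.arr C.Hom_obj M.Hom_obj)

lemma assM_arr: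
  assumes "c \<in> Obj C" "d \<in> Obj C" "n \<in> Obj M"
  shows "assM c d n \<in> Arr M" "Dom M (assM c d n) = (c \<otimes>\<^sub>O d) \<rhd>\<^sub>O n"
    "Cod M (assM c d n) = c \<rhd>\<^sub>O d \<rhd>\<^sub>O n"
  using act_assoc_in[OF assms] by (simp_all add: Hom_def)

lemma assM_inv_arr:
  assumes "c \<in> Obj C" "d \<in> Obj C" "n \<in> Obj M"
  shows "inv_arr M (assM c d n) \<in> Arr M" "Cod M (inv_arr M (assM c d n)) = (c \<otimes>\<^sub>O d) \<rhd>\<^sub>O n"
    "Dom M (inv_arr M (assM c d n)) = c \<rhd>\<^sub>O d \<rhd>\<^sub>O n"
  using M.inv_arr(1)[OF act_assoc_iso act_assoc_in] assms by (simp_all add: Hom_def)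

lemma assM_inv:
  assumes "c \<in> Obj C" "d \<in> Obj C" "n \<in> Obj M"
  shows "inv_arr M (assM c d n) \<cdot>\<^sub>M assM c d n = idM ((c \<otimes>\<^sub>O d) \<rhd>\<^sub>O n)"
    "assM c d n \<cdot>\<^sub>M inv_arr M (assM c d n) = idM (c \<rhd>\<^sub>O d \<rhd>\<^sub>O n)"
  using M.inv_arr(2,3)[OF act_assoc_iso act_assoc_in] assms by simp_all

lemma uniM_arr:
  assumes "n \<in> Obj M"
  shows "uniM n \<in> Arr M" "Dom M (uniM n) = \<one>\<^sub>C \<rhd>\<^sub>O n" "Cod M (uniM n) = n"
    "inv_arr M (uniM n) \<in> Arr M" "Cod M (inv_arr M (uniM n)) = \<one>\<^sub>C \<rhd>\<^sub>O n" "Dom M (inv_arr M (uniM n)) = n"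
  using act_unit_in[OF assms] M.inv_arr(1)[OF act_unit_iso act_unit_in] assms by (simp_all add: Hom_def)

lemma uniM_inv:
  assumes "n \<in> Obj M"
  shows "inv_arr M (uniM n) \<cdot>\<^sub>M uniM n = idM (\<one>\<^sub>C \<rhd>\<^sub>O n)" "uniM n \<cdot>\<^sub>M inv_arr M (uniM n) = idM n"
  using M.inv_arr(2,3)[OF act_unit_iso act_unit_in] assms by simp_all

lemmas marr = C.tarr M.arr act_arr assM_arr assM_inv_arr uniM_arr actO_in actM_ident
  M.comp_assoc_arr

lemma act_unit_faithful:
  assumes "F \<in> Hom M n n'" "G \<in> Hom M n n'" "idC \<one>\<^sub>C \<rhd> F = idC \<one>\<^sub>C \<rhd> G"
  shows "F = G"
proof -
  note n = M.Hom_obj[OF assms(1)]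
  have "F \<cdot>\<^sub>M uniM n = G \<cdot>\<^sub>M uniM n"
    using act_unit_natural[OF assms(1)] act_unit_natural[OF assms(2)] assms(3) by simp
  thus ?thesis
    using M.right_cancel[OF act_unit_in _ uniM_inv(2) assms(1,2)] n uniM_arr
    by (simp add: in_Hom_iff)
qed

text \<open>The second triangle identity follows from the first one and the pentagon, as in Kelly's
  reduction of the coherence axioms for monoidal categories: after acting with \<open>1\<close>, it is an instance
  of the pentagon, and acting with \<open>1\<close> is faithful.\<close>

lemma unit_triangle:
  assumes c: "c \<in> Obj C" and m: "m \<in> Obj M"
  shows "uniM (c \<rhd>\<^sub>O m) \<cdot>\<^sub>M assM \<one>\<^sub>C c m = idM (c \<rhd>\<^sub>O m)"
proof (rule act_unit_faithful)
  note [simp] = c m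
  let ?u = "idC \<one>\<^sub>C \<rhd> uniM (c \<rhd>\<^sub>O m)" and ?a = "idC \<one>\<^sub>C \<rhd> assM \<one>\<^sub>C c m"
  have pent: "assM \<one>\<^sub>C \<one>\<^sub>C (c \<rhd>\<^sub>O m) \<cdot>\<^sub>M assM \<one>\<^sub>C c m = ?a \<cdot>\<^sub>M assM \<one>\<^sub>C c m"
    using pentagon[of "\<one>\<^sub>C" "\<one>\<^sub>C" c m] by (simp add: C.tarr)
  have tri: "?u \<cdot>\<^sub>M assM \<one>\<^sub>C \<one>\<^sub>C (c \<rhd>\<^sub>O m) = idM (\<one>\<^sub>C \<rhd>\<^sub>O c \<rhd>\<^sub>O m)"
    using triangle[of "\<one>\<^sub>C" "c \<rhd>\<^sub>O m"] by (simp add: C.tarr actO_in)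
  have "?u \<cdot>\<^sub>M ?a \<cdot>\<^sub>M assM \<one>\<^sub>C c m = ?u \<cdot>\<^sub>M (assM \<one>\<^sub>C \<one>\<^sub>C (c \<rhd>\<^sub>O m) \<cdot>\<^sub>M assM \<one>\<^sub>C c m)"
    unfolding pent by (simp add: marr cong: typing_cong)
  also have "\<dots> = assM \<one>\<^sub>C c m"
    by (simp add: marr M.comp_eq_assoc[OF tri] cong: typing_cong)
  finally have "?u \<cdot>\<^sub>M ?a \<cdot>\<^sub>M assM \<one>\<^sub>C c m = idM (\<one>\<^sub>C \<rhd>\<^sub>O c \<rhd>\<^sub>O m) \<cdot>\<^sub>M assM \<one>\<^sub>C c m"
    by (simp add: marr)
  hence "?u \<cdot>\<^sub>M ?a = idM (\<one>\<^sub>C \<rhd>\<^sub>O c \<rhd>\<^sub>O m)"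
    by (rule M.right_cancel[OF act_assoc_in _ assM_inv(2), rotated -1])
      (simp_all add: marr in_Hom_iff cong: typing_cong)
  thus "idC \<one>\<^sub>C \<rhd> (uniM (c \<rhd>\<^sub>O m) \<cdot>\<^sub>M assM \<one>\<^sub>C c m) = idC \<one>\<^sub>C \<rhd> idM (c \<rhd>\<^sub>O m)"
    by (simp add: act_whisker marr)
qed (use c m in \<open>simp_all add: marr in_Hom_iff\<close>)

text \<open>For an evaluation \<open>e : y \<otimes> x \<rightarrow> 1\<close>, the mate \<open>(y \<otimes> c) \<triangleright> n \<rightarrow> n'\<close> of \<open>F : c \<triangleright> n \<rightarrow> x \<triangleright> n'\<close>.\<close>

definition bend where
  "bend y x c n n' e F =
     uniM n' \<cdot>\<^sub>M (e \<rhd> idM n') \<cdot>\<^sub>M inv_arr M (assM y x n') \<cdot>\<^sub>M (idC y \<rhd> F) \<cdot>\<^sub>M assM y c n"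

lemma bend_in:
  assumes "e \<in> Hom C (y \<otimes>\<^sub>O x) \<one>\<^sub>C" "F \<in> Hom M (c \<rhd>\<^sub>O n) (x \<rhd>\<^sub>O n')"
    "x \<in> Obj C" "y \<in> Obj C" "c \<in> Obj C" "n \<in> Obj M" "n' \<in> Obj M"
  shows "bend y x c n n' e F \<in> Hom M ((y \<otimes>\<^sub>O c) \<rhd>\<^sub>O n) n'"
  using assms unfolding bend_def in_Hom_iff by (simp add: marr cong: typing_cong)

text \<open>If \<open>F\<close> comes from a morphism \<open>f\<close> of \<open>C\<close>, its mate comes from the mate of \<open>f\<close> in \<open>C\<close>: all
  associativity and unit isomorphisms cancel, by two pentagons, the unit triangle and naturality.\<close>

lemma bend_internal:
  assumes e: "e \<in> Hom C (y \<otimes>\<^sub>O x) \<one>\<^sub>C" and f: "f \<in> Hom C c (x \<otimes>\<^sub>O b)"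
    and v: "v \<in> Hom M (b \<rhd>\<^sub>O n) n'"
    and obj: "x \<in> Obj C" "y \<in> Obj C" "b \<in> Obj C" "n \<in> Obj M"
  shows "bend y x c n n' e ((idC x \<rhd> v) \<cdot>\<^sub>M assM x b n \<cdot>\<^sub>M (f \<rhd> idM n))
    = v \<cdot>\<^sub>M (((e \<otimes>\<^sub>C idC b) \<cdot>\<^sub>C (idC y \<otimes>\<^sub>C f)) \<rhd> idM n)"
proof -
  note [simp] = obj in_HomD[OF e] in_HomD[OF f] in_HomD[OF v] C.Hom_obj[OF f] M.Hom_obj[OF v]
  have in1: "idC y \<in> Hom C y y" "idC b \<in> Hom C b b" "idM n \<in> Hom M n n" "idC (y \<otimes>\<^sub>O x) \<in> Hom C (y \<otimes>\<^sub>O x) (y \<otimes>\<^sub>O x)"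
    using obj by (simp_all add: C.ident_in M.ident_in C.tensO_in)
  have 1: "(idC y \<rhd> (f \<rhd> idM n)) \<cdot>\<^sub>M assM y c n = assM y (x \<otimes>\<^sub>O b) n \<cdot>\<^sub>M ((idC y \<otimes>\<^sub>C f) \<rhd> idM n)"
    using act_assoc_natural[OF in1(1) f in1(3)] by simp
  have 2: "(idC y \<rhd> assM x b n) \<cdot>\<^sub>M assM y (x \<otimes>\<^sub>O b) n = assM y x (b \<rhd>\<^sub>O n) \<cdot>\<^sub>M assM (y \<otimes>\<^sub>O x) b n"
    using pentagon[of y x b n] by simp
  have 3: "(idC y \<rhd> (idC x \<rhd> v)) \<cdot>\<^sub>M assM y x (b \<rhd>\<^sub>O n) = assM y x n' \<cdot>\<^sub>M (idC (y \<otimes>\<^sub>O x) \<rhd> v)"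
    using act_assoc_natural[OF in1(1) C.ident_in v, of x] by (simp add: C.tensM_ident)
  have 4: "(e \<rhd> idM n') \<cdot>\<^sub>M (idC (y \<otimes>\<^sub>O x) \<rhd> v) = (idC \<one>\<^sub>C \<rhd> v) \<cdot>\<^sub>M (e \<rhd> idM (b \<rhd>\<^sub>O n))"
    by (rule act_slide[OF e v])
  have 5: "uniM n' \<cdot>\<^sub>M (idC \<one>\<^sub>C \<rhd> v) = v \<cdot>\<^sub>M uniM (b \<rhd>\<^sub>O n)"
    by (rule act_unit_natural[OF v])
  have 6: "(e \<rhd> idM (b \<rhd>\<^sub>O n)) \<cdot>\<^sub>M assM (y \<otimes>\<^sub>O x) b n = assM \<one>\<^sub>C b n \<cdot>\<^sub>M ((e \<otimes>\<^sub>C idC b) \<rhd> idM n)"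
    using act_assoc_natural[OF e in1(2,3)] by (simp add: actM_ident)
  note eqs = 1 2 3 4 5 6 assM_inv(1)[OF obj(2,1) M.Hom_obj(2)[OF v]] unit_triangle[OF obj(3,4)]
  show ?thesis
    unfolding bend_def
    by (simp add: marr act_whisker whisker_act eqs eqs[THEN M.comp_eq_assoc] cong: typing_cong)
qed

lemma bend_assoc:
  assumes e: "e \<in> Hom C (y \<otimes>\<^sub>O x) \<one>\<^sub>C" and F: "F \<in> Hom M (c \<rhd>\<^sub>O d \<rhd>\<^sub>O n) (x \<rhd>\<^sub>O n')"
    and obj: "x \<in> Obj C" "y \<in> Obj C" "c \<in> Obj C" "d \<in> Obj C" "n \<in> Obj M" "n' \<in> Obj M"
  shows "bend y x c (d \<rhd>\<^sub>O n) n' e F \<cdot>\<^sub>M assM (y \<otimes>\<^sub>O c) d n = bend y x (c \<otimes>\<^sub>O d) n n' e (F \<cdot>\<^sub>M assM c d n)"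
proof -
  note [simp] = obj in_HomD[OF e] in_HomD[OF F]
  note eqs = pentagon[OF obj(2,3,4,5)]
  show ?thesis
    unfolding bend_def
    by (simp add: marr act_whisker eqs cong: typing_cong)
qed

text \<open>Bending back with the coevaluation recovers \<open>F\<close>. By naturality in the source this reduces to
  \<open>F = id\<close>, where it is the zigzag identity.\<close>

lemma unbend:
  assumes d: "dual_pair C x y e k" and F: "F \<in> Hom M (c \<rhd>\<^sub>O n) (x \<rhd>\<^sub>O n')"
    and obj: "c \<in> Obj C" "n \<in> Obj M" "n' \<in> Obj M"
  shows "(idC x \<rhd> bend y x c n n' e F) \<cdot>\<^sub>M assM x (y \<otimes>\<^sub>O c) n \<cdot>\<^sub>M ((k \<otimes>\<^sub>C idC c) \<rhd> idM n) = F"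
proof -
  have xy: "x \<in> Obj C" "y \<in> Obj C" and e: "e \<in> Hom C (y \<otimes>\<^sub>O x) \<one>\<^sub>C" and k: "k \<in> Hom C \<one>\<^sub>C (x \<otimes>\<^sub>O y)"
    and zig: "(idC x \<otimes>\<^sub>C e) \<cdot>\<^sub>C (k \<otimes>\<^sub>C idC x) = idC x"
    using d unfolding dual_pair_def by auto
  define B where "B = (idC x \<rhd> (uniM n' \<cdot>\<^sub>M (e \<rhd> idM n') \<cdot>\<^sub>M inv_arr M (assM y x n'))) \<cdot>\<^sub>M assM x y (x \<rhd>\<^sub>O n')
    \<cdot>\<^sub>M (k \<rhd> idM (x \<rhd>\<^sub>O n'))"
  have main: "(idC x \<rhd> bend y x c n n' e F) \<cdot>\<^sub>M assM x (y \<otimes>\<^sub>O c) n \<cdot>\<^sub>M ((k \<otimes>\<^sub>C idC c) \<rhd> idM n)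
      = B \<cdot>\<^sub>M (idC \<one>\<^sub>C \<rhd> F) \<cdot>\<^sub>M assM \<one>\<^sub>C c n"
    if F: "F \<in> Hom M (c \<rhd>\<^sub>O n) (x \<rhd>\<^sub>O n')" and obj: "c \<in> Obj C" "n \<in> Obj M" "n' \<in> Obj M" for F c n
  proof -
    note [simp] = obj xy in_HomD[OF e] in_HomD[OF F] in_HomD[OF k]
    have in1: "idC x \<in> Hom C x x" "idC y \<in> Hom C y y" "idC c \<in> Hom C c c" "idM n \<in> Hom M n n"
      using obj xy by (simp_all add: C.ident_in M.ident_in)
    have 1: "(idC x \<rhd> assM y c n) \<cdot>\<^sub>M assM x (y \<otimes>\<^sub>O c) n = assM x y (c \<rhd>\<^sub>O n) \<cdot>\<^sub>M assM (x \<otimes>\<^sub>O y) c n"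
      using pentagon[of x y c n] by simp
    have 2: "assM (x \<otimes>\<^sub>O y) c n \<cdot>\<^sub>M ((k \<otimes>\<^sub>C idC c) \<rhd> idM n) = (k \<rhd> idM (c \<rhd>\<^sub>O n)) \<cdot>\<^sub>M assM \<one>\<^sub>C c n"
      using act_assoc_natural[OF k in1(3,4)] by (simp add: actM_ident)
    have 3: "(idC x \<rhd> (idC y \<rhd> F)) \<cdot>\<^sub>M assM x y (c \<rhd>\<^sub>O n) = assM x y (x \<rhd>\<^sub>O n') \<cdot>\<^sub>M (idC (x \<otimes>\<^sub>O y) \<rhd> F)"
      using act_assoc_natural[OF in1(1,2) F] by (simp add: C.tensM_ident)
    have 4: "(idC (x \<otimes>\<^sub>O y) \<rhd> F) \<cdot>\<^sub>M (k \<rhd> idM (c \<rhd>\<^sub>O n)) = (k \<rhd> idM (x \<rhd>\<^sub>O n')) \<cdot>\<^sub>M (idC \<one>\<^sub>C \<rhd> F)"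
      by (rule act_slide[OF k F, symmetric])
    note eqs = 1 2 3 4
    show ?thesis
      unfolding bend_def B_def
      by (simp add: marr act_whisker eqs eqs[THEN M.comp_eq_assoc] cong: typing_cong)
  qed
  note [simp] = xy obj in_HomD[OF e] in_HomD[OF k] in_HomD[OF F]
  have "B \<cdot>\<^sub>M (idC \<one>\<^sub>C \<rhd> idM (x \<rhd>\<^sub>O n')) \<cdot>\<^sub>M assM \<one>\<^sub>C x n' = idM (x \<rhd>\<^sub>O n')"
  proof -
    have "bend y x x n' n' e (idM (x \<rhd>\<^sub>O n')) = uniM n' \<cdot>\<^sub>M (e \<rhd> idM n')"
      unfolding bend_def
      by (simp add: marr assM_inv assM_inv(1)[THEN M.comp_eq_assoc] cong: typing_cong)
    moreover have "assM x \<one>\<^sub>C n' \<cdot>\<^sub>M ((idC x \<otimes>\<^sub>C e) \<rhd> idM n') = (idC x \<rhd> (e \<rhd> idM n')) \<cdot>\<^sub>M assM x (y \<otimes>\<^sub>O x) n'"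
      using act_assoc_natural[OF C.ident_in e M.ident_in, of x n'] by simp
    moreover have "(idC x \<rhd> uniM n') \<cdot>\<^sub>M assM x \<one>\<^sub>C n' = idM (x \<rhd>\<^sub>O n')" by (simp add: triangle)
    ultimately have "(idC x \<rhd> bend y x x n' n' e (idM (x \<rhd>\<^sub>O n'))) \<cdot>\<^sub>M assM x (y \<otimes>\<^sub>O x) n' \<cdot>\<^sub>M ((k \<otimes>\<^sub>C idC x) \<rhd> idM n')
       = (((idC x \<otimes>\<^sub>C e) \<cdot>\<^sub>C (k \<otimes>\<^sub>C idC x)) \<rhd> idM n')"
      using M.comp_eq_assoc[where g = "idC x \<rhd> uniM n'" and f = "assM x \<one>\<^sub>C n'" and h = "(idC x \<otimes>\<^sub>C e) \<rhd> idM n' \<cdot>\<^sub>M (k \<otimes>\<^sub>C idC x) \<rhd> idM n'"]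
        M.comp_eq_assoc[where g = "assM x \<one>\<^sub>C n'" and f = "(idC x \<otimes>\<^sub>C e) \<rhd> idM n'" and h = "(k \<otimes>\<^sub>C idC x) \<rhd> idM n'"]
      by (simp add: marr act_whisker whisker_act cong: typing_cong)
    thus ?thesis using main[of "idM (x \<rhd>\<^sub>O n')" x n'] zig by (simp add: marr M.ident_in)
  qed
  moreover have Bin [simp]: "B \<in> Arr M" "Dom M B = \<one>\<^sub>C \<rhd>\<^sub>O x \<rhd>\<^sub>O n'" "Cod M B = x \<rhd>\<^sub>O n'"
    unfolding B_def by (simp_all add: marr cong: typing_cong)
  ultimately have "B \<cdot>\<^sub>M assM \<one>\<^sub>C x n' = uniM (x \<rhd>\<^sub>O n') \<cdot>\<^sub>M assM \<one>\<^sub>C x n'"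
    using unit_triangle[of x n'] by (simp add: marr cong: typing_cong)
  hence "B = uniM (x \<rhd>\<^sub>O n')"
    by (rule M.right_cancel[OF act_assoc_in _ assM_inv(2), rotated -1])
      (simp_all add: marr in_Hom_iff cong: typing_cong)
  hence "B \<cdot>\<^sub>M (idC \<one>\<^sub>C \<rhd> F) = F \<cdot>\<^sub>M uniM (c \<rhd>\<^sub>O n)" using act_unit_natural[OF F] by simp
  hence "B \<cdot>\<^sub>M (idC \<one>\<^sub>C \<rhd> F) \<cdot>\<^sub>M assM \<one>\<^sub>C c n = F \<cdot>\<^sub>M (uniM (c \<rhd>\<^sub>O n) \<cdot>\<^sub>M assM \<one>\<^sub>C c n)"
    by (simp add: marr cong: typing_cong)
  thus ?thesis using main[OF F obj] unit_triangle[OF obj(1,2)] by (simp add: marr)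
qed

end

section \<open>Internal endomorphisms\<close>

context strict_monoidal_category
begin

text \<open>The analogue of \<open>unbend\<close> inside \<open>C\<close>.\<close>

lemma unbend_tens:
  assumes d: "dual_pair C x y e k" and g: "g \<in> Hom C c (x \<otimes>\<^sub>o b)" and b: "b \<in> Obj C"
  shows "(ident C x \<otimes>\<^sub>m ((e \<otimes>\<^sub>m ident C b) \<cdot> (ident C y \<otimes>\<^sub>m g))) \<cdot> (k \<otimes>\<^sub>m ident C c) = g"
proof -
  have xy [simp]: "x \<in> Obj C" "y \<in> Obj C" and e: "e \<in> Hom C (y \<otimes>\<^sub>o x) (unit_obj C)"
    and k: "k \<in> Hom C (unit_obj C) (x \<otimes>\<^sub>o y)"
    and zig: "(ident C x \<otimes>\<^sub>m e) \<cdot> (k \<otimes>\<^sub>m ident C x) = ident C x"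
    using d unfolding dual_pair_def by auto
  note [simp] = b in_HomD[OF e] in_HomD[OF k] in_HomD[OF g] Hom_obj[OF g]
  have "(ident C x \<otimes>\<^sub>m ((e \<otimes>\<^sub>m ident C b) \<cdot> (ident C y \<otimes>\<^sub>m g))) \<cdot> (k \<otimes>\<^sub>m ident C c)
      = (ident C x \<otimes>\<^sub>m e \<otimes>\<^sub>m ident C b) \<cdot> ((ident C (x \<otimes>\<^sub>o y) \<otimes>\<^sub>m g) \<cdot> (k \<otimes>\<^sub>m ident C c))"
    by (simp add: layers cong: typing_cong)
  also have "\<dots> = (((ident C x \<otimes>\<^sub>m e) \<cdot> (k \<otimes>\<^sub>m ident C x)) \<otimes>\<^sub>m ident C b) \<cdot> g"
    unfolding slide_state(1)[OF g k, symmetric] by (simp add: layers cong: typing_cong)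
  also have "\<dots> = g" unfolding zig by (simp add: tarr)
  finally show ?thesis .
qed

end

locale internal_endomorphisms = inner_hom C M m m A \<alpha>
  for C :: "('o, 'a, 'x) rigid_cat_scheme" and M :: "('o, 'a, 'p, 'b, 'y) mod_cat_scheme"
    and m :: 'p and A :: 'o and \<alpha> :: "'o \<Rightarrow> 'b \<Rightarrow> 'a"
begin

abbreviation evA where "evA \<equiv> inner_ev C M m m A \<alpha>"
abbreviation \<mu> where "\<mu> \<equiv> inner_mult C M m A \<alpha>"
abbreviation \<eta> where "\<eta> \<equiv> inner_unit C M m \<alpha>"
abbreviation idA where "idA \<equiv> idC A"

lemmas [simp] = source_in inner_in

lemma alpha_bij:
  assumes "c \<in> Obj C"
  shows "bij_betw (\<alpha> c) (Hom M (c \<rhd>\<^sub>O m) m) (Hom C c A)"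
  using inner_iso[OF assms] by (simp add: linear_iso_def)

lemma evA_in: "evA \<in> Hom M (A \<rhd>\<^sub>O m) m" and alpha_evA: "\<alpha> A evA = idA"
proof -
  have "\<alpha> A ` Hom M (A \<rhd>\<^sub>O m) m = Hom C A A" using alpha_bij[of A] by (simp add: bij_betw_def)
  hence "idA \<in> \<alpha> A ` Hom M (A \<rhd>\<^sub>O m) m" using C.ident_in by simp
  thus "evA \<in> Hom M (A \<rhd>\<^sub>O m) m" "\<alpha> A evA = idA"
    unfolding inner_ev_def by (rule inv_into_into, rule f_inv_into_f)
qed

lemmas evA_arr [simp] = in_HomD[OF evA_in]

lemma alpha_factor: "h \<in> Hom C c A \<Longrightarrow> \<alpha> c (evA \<cdot>\<^sub>M (h \<rhd> idM m)) = h"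
  using inner_natural[OF _ evA_in, of h c] alpha_evA C.comp_ident_left[of h c A] by simp

lemma evA_act_in: "h \<in> Hom C c A \<Longrightarrow> evA \<cdot>\<^sub>M (h \<rhd> idM m) \<in> Hom M (c \<rhd>\<^sub>O m) m"
  using M.comp_in[OF actM_in evA_in] M.ident_in by simp

lemma evA_factor:
  assumes "F \<in> Hom M (c \<rhd>\<^sub>O m) m" "c \<in> Obj C"
  shows "\<alpha> c F \<in> Hom C c A" "evA \<cdot>\<^sub>M (\<alpha> c F \<rhd> idM m) = F"
proof -
  show in1: "\<alpha> c F \<in> Hom C c A" using alpha_bij assms by (metis bij_betw_apply)
  show "evA \<cdot>\<^sub>M (\<alpha> c F \<rhd> idM m) = F"
    using alpha_bij[OF assms(2)] alpha_factor[OF in1] evA_act_in[OF in1] assms(1)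
    unfolding bij_betw_def inj_on_def by blast
qed

lemma evA_cancel:
  assumes "h \<in> Hom C c A" "h' \<in> Hom C c A" "evA \<cdot>\<^sub>M (h \<rhd> idM m) = evA \<cdot>\<^sub>M (h' \<rhd> idM m)"
  shows "h = h'"
proof -
  have "h = \<alpha> c (evA \<cdot>\<^sub>M (h \<rhd> idM m))" by (rule alpha_factor[OF assms(1), symmetric])
  also have "\<dots> = \<alpha> c (evA \<cdot>\<^sub>M (h' \<rhd> idM m))" unfolding assms(3) ..
  also have "\<dots> = h'" by (rule alpha_factor[OF assms(2)])
  finally show ?thesis .
qed

lemma evA_mult: "\<mu> \<in> Hom C (A \<otimes>\<^sub>O A) A"
    "evA \<cdot>\<^sub>M (\<mu> \<rhd> idM m) = evA \<cdot>\<^sub>M ((idA \<rhd> evA) \<cdot>\<^sub>M assM A A m)"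
proof -
  have "evA \<cdot>\<^sub>M (idA \<rhd> evA) \<cdot>\<^sub>M assM A A m \<in> Hom M ((A \<otimes>\<^sub>O A) \<rhd>\<^sub>O m) m"
    by (simp add: marr in_Hom_iff cong: typing_cong)
  from evA_factor[OF this] show "\<mu> \<in> Hom C (A \<otimes>\<^sub>O A) A"
    "evA \<cdot>\<^sub>M (\<mu> \<rhd> idM m) = evA \<cdot>\<^sub>M ((idA \<rhd> evA) \<cdot>\<^sub>M assM A A m)"
    by (simp_all add: inner_mult_def marr)
qed

lemma evA_unit: "\<eta> \<in> Hom C \<one>\<^sub>C A" "evA \<cdot>\<^sub>M (\<eta> \<rhd> idM m) = uniM m"
  using evA_factor[OF act_unit_in C.unit_obj_in] by (simp_all add: inner_unit_def)

lemmas mult_arr [simp] = in_HomD[OF evA_mult(1)]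
lemmas unit_arr [simp] = in_HomD[OF evA_unit(1)]

text \<open>The category of objects \<open>c \<triangleright> m\<close> is equivalent to the category of free \<open>A\<close>-modules: the map
  \<open>free_map\<close> identifies \<open>Hom(c \<triangleright> m, d \<triangleright> m)\<close> with \<open>Hom(c, d \<otimes> A)\<close>. Since \<open>C\<close> is strict, all
  later computations can be done there, without associativity isomorphisms.\<close>

definition free_map where
  "free_map d g = (idC d \<rhd> evA) \<cdot>\<^sub>M assM d A m \<cdot>\<^sub>M (g \<rhd> idM m)"

lemma free_map_in:
  assumes "g \<in> Hom C c (d \<otimes>\<^sub>O A)" "d \<in> Obj C"
  shows "free_map d g \<in> Hom M (c \<rhd>\<^sub>O m) (d \<rhd>\<^sub>O m)"
  using assms C.Hom_obj[OF assms(1)] in_HomD[OF assms(1)]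
  unfolding free_map_def in_Hom_iff by (simp add: marr cong: typing_cong)

lemma linear_free_map:
  assumes "c \<in> Obj C" "d \<in> Obj C"
  shows "linear_map (hom_module C c (d \<otimes>\<^sub>O A)) (hom_module M (c \<rhd>\<^sub>O m) (d \<rhd>\<^sub>O m)) (free_map d)"
proof -
  have "(idC d \<rhd> evA) \<cdot>\<^sub>M assM d A m \<in> Hom M ((d \<otimes>\<^sub>O A) \<rhd>\<^sub>O m) (d \<rhd>\<^sub>O m)"
    using assms by (simp add: marr in_Hom_iff cong: typing_cong)
  from linear_map_comp[OF actM_linear_left M.comp_linear_right[OF this, of "c \<rhd>\<^sub>O m"]]
  show ?thesis
    unfolding free_map_def using assms by (simp add: M.ident_in C.tensO_in actO_in)
qed

lemma bend_free_map:
  assumes "e \<in> Hom C (y \<otimes>\<^sub>O d) \<one>\<^sub>C" "g \<in> Hom C c (d \<otimes>\<^sub>O A)" "d \<in> Obj C" "y \<in> Obj C"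
  shows "bend y d c m m e (free_map d g) = evA \<cdot>\<^sub>M (((e \<otimes>\<^sub>C idA) \<cdot>\<^sub>C (idC y \<otimes>\<^sub>C g)) \<rhd> idM m)"
  using bend_internal[OF assms(1,2) evA_in assms(3,4)] by (simp add: free_map_def)

text \<open>\<open>free_map\<close> is bijective because bending with the right dual of \<open>d\<close> moves \<open>d\<close> to the other side,
  where the defining isomorphism of the inner hom applies.\<close>

lemma free_map_inj:
  assumes g: "g \<in> Hom C c (d \<otimes>\<^sub>O A)" and g': "g' \<in> Hom C c (d \<otimes>\<^sub>O A)" and d: "d \<in> Obj C"
    and eq: "free_map d g = free_map d g'"
  shows "g = g'"
proof -
  define y e k where "y = rdual C d" and "e = ev C d" and "k = coev C d"
  have dp: "dual_pair C d y e k" unfolding y_def e_def k_def by (rule C.right_dual[OF d])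
  have y: "y \<in> Obj C" and e: "e \<in> Hom C (y \<otimes>\<^sub>O d) \<one>\<^sub>C" using dp unfolding dual_pair_def by auto
  have in1: "(e \<otimes>\<^sub>C idA) \<cdot>\<^sub>C (idC y \<otimes>\<^sub>C h) \<in> Hom C (y \<otimes>\<^sub>O c) A" if "h \<in> Hom C c (d \<otimes>\<^sub>O A)" for h
    using that y d in_HomD[OF e] by (simp add: marr in_Hom_iff cong: typing_cong)
  have eq': "(e \<otimes>\<^sub>C idA) \<cdot>\<^sub>C (idC y \<otimes>\<^sub>C g) = (e \<otimes>\<^sub>C idA) \<cdot>\<^sub>C (idC y \<otimes>\<^sub>C g')"
    using evA_cancel[OF in1[OF g] in1[OF g']] bend_free_map[OF e g d y] bend_free_map[OF e g' d y] eq
    by simp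
  show ?thesis
    using C.unbend_tens[OF dp g inner_in] C.unbend_tens[OF dp g' inner_in] unfolding eq' by simp
qed

lemma free_map_surj:
  assumes F: "F \<in> Hom M (c \<rhd>\<^sub>O m) (d \<rhd>\<^sub>O m)" and c: "c \<in> Obj C" and d: "d \<in> Obj C"
  shows "\<exists>g \<in> Hom C c (d \<otimes>\<^sub>O A). free_map d g = F"
proof -
  define y e k where "y = rdual C d" and "e = ev C d" and "k = coev C d"
  have dp: "dual_pair C d y e k" unfolding y_def e_def k_def by (rule C.right_dual[OF d])
  have y: "y \<in> Obj C" and e: "e \<in> Hom C (y \<otimes>\<^sub>O d) \<one>\<^sub>C" and k: "k \<in> Hom C \<one>\<^sub>C (d \<otimes>\<^sub>O y)"
    using dp unfolding dual_pair_def by auto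
  define h where "h = \<alpha> (y \<otimes>\<^sub>O c) (bend y d c m m e F)"
  have h: "h \<in> Hom C (y \<otimes>\<^sub>O c) A" "evA \<cdot>\<^sub>M (h \<rhd> idM m) = bend y d c m m e F"
    unfolding h_def using bend_in[OF e F d y c] evA_factor c y by (simp_all add: C.tensO_in)
  note [simp] = c d y in_HomD[OF e] in_HomD[OF k] in_HomD[OF h(1)]
  define g where "g = (idC d \<otimes>\<^sub>C h) \<cdot>\<^sub>C (k \<otimes>\<^sub>C idC c)"
  have g: "g \<in> Hom C c (d \<otimes>\<^sub>O A)"
    unfolding g_def by (simp add: marr in_Hom_iff cong: typing_cong)
  have nat: "assM d A m \<cdot>\<^sub>M ((idC d \<otimes>\<^sub>C h) \<rhd> idM m) = (idC d \<rhd> (h \<rhd> idM m)) \<cdot>\<^sub>M assM d (y \<otimes>\<^sub>O c) m"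
    using act_assoc_natural[OF C.ident_in h(1) M.ident_in, of d m] by simp
  have "free_map d g = (idC d \<rhd> (evA \<cdot>\<^sub>M (h \<rhd> idM m))) \<cdot>\<^sub>M assM d (y \<otimes>\<^sub>O c) m \<cdot>\<^sub>M ((k \<otimes>\<^sub>C idC c) \<rhd> idM m)"
    unfolding free_map_def g_def
    by (simp add: marr act_whisker whisker_act nat[THEN M.comp_eq_assoc] cong: typing_cong)
  also have "\<dots> = F" unfolding h(2) by (rule unbend[OF dp F c]) simp_all
  finally show ?thesis using g by blast
qed

text \<open>Composition becomes the composition of maps between free \<open>A\<close>-modules.\<close>

lemma free_map_comp:
  assumes f: "f \<in> Hom C c (d \<otimes>\<^sub>O A)" and g: "g \<in> Hom C d (b \<otimes>\<^sub>O A)" and b: "b \<in> Obj C"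
  shows "free_map b g \<cdot>\<^sub>M free_map d f = free_map b ((idC b \<otimes>\<^sub>C \<mu>) \<cdot>\<^sub>C ((g \<otimes>\<^sub>C idA) \<cdot>\<^sub>C f))"
proof -
  note [simp] = b in_HomD[OF f] in_HomD[OF g] C.Hom_obj[OF f] C.Hom_obj[OF g]
  have 1: "(g \<rhd> idM m) \<cdot>\<^sub>M (idC d \<rhd> evA) = (idC (b \<otimes>\<^sub>O A) \<rhd> evA) \<cdot>\<^sub>M (g \<rhd> idM (A \<rhd>\<^sub>O m))"
    by (rule act_slide[OF g evA_in])
  have 2: "(g \<rhd> idM (A \<rhd>\<^sub>O m)) \<cdot>\<^sub>M assM d A m = assM (b \<otimes>\<^sub>O A) A m \<cdot>\<^sub>M ((g \<otimes>\<^sub>C idA) \<rhd> idM m)"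
    using act_assoc_natural[OF g C.ident_in M.ident_in, of A m] by (simp add: actM_ident)
  have 3: "assM b A m \<cdot>\<^sub>M (idC (b \<otimes>\<^sub>O A) \<rhd> evA) = (idC b \<rhd> (idA \<rhd> evA)) \<cdot>\<^sub>M assM b A (A \<rhd>\<^sub>O m)"
    using act_assoc_natural[OF C.ident_in C.ident_in evA_in, of b A] by (simp add: C.tensM_ident)
  have 4: "assM b A (A \<rhd>\<^sub>O m) \<cdot>\<^sub>M assM (b \<otimes>\<^sub>O A) A m = (idC b \<rhd> assM A A m) \<cdot>\<^sub>M assM b (A \<otimes>\<^sub>O A) m"
    by (rule pentagon) simp_all
  have 5: "(idC b \<rhd> evA) \<cdot>\<^sub>M ((idC b \<rhd> (idA \<rhd> evA)) \<cdot>\<^sub>M (idC b \<rhd> assM A A m))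
      = (idC b \<rhd> evA) \<cdot>\<^sub>M (idC b \<rhd> (\<mu> \<rhd> idM m))"
  proof -
    have "(idC b \<rhd> evA) \<cdot>\<^sub>M ((idC b \<rhd> (idA \<rhd> evA)) \<cdot>\<^sub>M (idC b \<rhd> assM A A m))
        = idC b \<rhd> (evA \<cdot>\<^sub>M ((idA \<rhd> evA) \<cdot>\<^sub>M assM A A m))"
      by (simp add: marr act_whisker cong: typing_cong)
    also have "\<dots> = (idC b \<rhd> evA) \<cdot>\<^sub>M (idC b \<rhd> (\<mu> \<rhd> idM m))"
      unfolding evA_mult(2)[symmetric] by (simp add: marr act_whisker cong: typing_cong)
    finally show ?thesis .
  qed
  have 6: "(idC b \<rhd> (\<mu> \<rhd> idM m)) \<cdot>\<^sub>M assM b (A \<otimes>\<^sub>O A) m = assM b A m \<cdot>\<^sub>M ((idC b \<otimes>\<^sub>C \<mu>) \<rhd> idM m)"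
    using act_assoc_natural[OF C.ident_in evA_mult(1) M.ident_in, of b m] by simp
  note 12 = 1 2 3 4
  have "free_map b g \<cdot>\<^sub>M free_map d f
      = (idC b \<rhd> evA) \<cdot>\<^sub>M ((idC b \<rhd> (idA \<rhd> evA)) \<cdot>\<^sub>M (idC b \<rhd> assM A A m)) \<cdot>\<^sub>M
        (assM b (A \<otimes>\<^sub>O A) m \<cdot>\<^sub>M (((g \<otimes>\<^sub>C idA) \<rhd> idM m) \<cdot>\<^sub>M (f \<rhd> idM m)))"
    unfolding free_map_def
    by (simp add: marr 12 12[THEN M.comp_eq_assoc] cong: typing_cong)
  also have "\<dots> = (idC b \<rhd> evA) \<cdot>\<^sub>M (idC b \<rhd> (\<mu> \<rhd> idM m)) \<cdot>\<^sub>M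
        (assM b (A \<otimes>\<^sub>O A) m \<cdot>\<^sub>M (((g \<otimes>\<^sub>C idA) \<rhd> idM m) \<cdot>\<^sub>M (f \<rhd> idM m)))"
    unfolding 5 ..
  also have "\<dots> = free_map b ((idC b \<otimes>\<^sub>C \<mu>) \<cdot>\<^sub>C ((g \<otimes>\<^sub>C idA) \<cdot>\<^sub>C f))"
    unfolding free_map_def
    by (simp add: marr whisker_act 6[THEN M.comp_eq_assoc] cong: typing_cong)
  finally show ?thesis .
qed

lemma free_map_unit:
  assumes f: "f \<in> Hom C c d"
  shows "free_map d (f \<otimes>\<^sub>C \<eta>) = f \<rhd> idM m"
proof -
  note [simp] = in_HomD[OF f] C.Hom_obj[OF f]
  have 1: "assM d A m \<cdot>\<^sub>M ((f \<otimes>\<^sub>C \<eta>) \<rhd> idM m) = (f \<rhd> (\<eta> \<rhd> idM m)) \<cdot>\<^sub>M assM c \<one>\<^sub>C m"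
    using act_assoc_natural[OF f evA_unit(1) M.ident_in, of m] by simp
  have 2: "(idC d \<rhd> evA) \<cdot>\<^sub>M (f \<rhd> (\<eta> \<rhd> idM m)) = f \<rhd> uniM m"
    using act_comp[of f "idC d" "\<eta> \<rhd> idM m" evA] evA_unit(2) by (simp add: marr cong: typing_cong)
  have 3: "f \<rhd> uniM m = (f \<rhd> idM m) \<cdot>\<^sub>M (idC c \<rhd> uniM m)"
    using act_comp[of "idC c" f "uniM m" "idM m"] by (simp add: marr cong: typing_cong)
  have 4: "(idC c \<rhd> uniM m) \<cdot>\<^sub>M assM c \<one>\<^sub>C m = idM (c \<rhd>\<^sub>O m)" by (rule triangle) simp_all
  have "free_map d (f \<otimes>\<^sub>C \<eta>) = (f \<rhd> uniM m) \<cdot>\<^sub>M assM c \<one>\<^sub>C m"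
    unfolding free_map_def by (simp add: marr 1 2[THEN M.comp_eq_assoc] cong: typing_cong)
  also have "\<dots> = (f \<rhd> idM m) \<cdot>\<^sub>M ((idC c \<rhd> uniM m) \<cdot>\<^sub>M assM c \<one>\<^sub>C m)"
    unfolding 3 by (simp add: marr cong: typing_cong)
  finally show ?thesis unfolding 4 by (simp add: marr cong: typing_cong)
qed

text \<open>Associativity and unitality of \<open>\<mu>\<close> and \<open>\<eta>\<close> are the category laws for the morphisms
  \<open>(A \<otimes> A \<otimes> A) \<triangleright> m \<rightarrow> (A \<otimes> A) \<triangleright> m \<rightarrow> A \<triangleright> m \<rightarrow> m\<close> given by identities of \<open>C\<close>.\<close>

lemma internal_algebra: "algebra_in C A \<mu> \<eta>"
proof -
  let ?B = "A \<otimes>\<^sub>O A"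
  have B [simp]: "?B \<in> Obj C" by (simp add: C.tensO_in)
  have in1: "idC (A \<otimes>\<^sub>O ?B) \<in> Hom C (A \<otimes>\<^sub>O ?B) (?B \<otimes>\<^sub>O A)" "idC ?B \<in> Hom C ?B (A \<otimes>\<^sub>O A)"
    "idA \<in> Hom C A (\<one>\<^sub>C \<otimes>\<^sub>O A)"
    by (simp_all add: C.tarr in_Hom_iff)
  let ?f = "free_map ?B (idC (A \<otimes>\<^sub>O ?B))" and ?g = "free_map A (idC ?B)" and ?h = "free_map \<one>\<^sub>C idA"
  have hg: "?h \<cdot>\<^sub>M ?g = free_map \<one>\<^sub>C \<mu>"
    using free_map_comp[OF in1(2,3)] by (simp add: C.tarr cong: typing_cong)
  have gf: "?g \<cdot>\<^sub>M ?f = free_map A (idA \<otimes>\<^sub>C \<mu>)"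
    using free_map_comp[OF in1(1,2)] by (simp add: C.tarr cong: typing_cong)
  have \<mu>1: "\<mu> \<in> Hom C ?B (\<one>\<^sub>C \<otimes>\<^sub>O A)" "idA \<otimes>\<^sub>C \<mu> \<in> Hom C (A \<otimes>\<^sub>O ?B) (A \<otimes>\<^sub>O A)"
    by (simp_all add: C.tarr in_Hom_iff)
  have "free_map \<one>\<^sub>C (\<mu> \<cdot>\<^sub>C (\<mu> \<otimes>\<^sub>C idA)) = ?h \<cdot>\<^sub>M ?g \<cdot>\<^sub>M ?f"
    unfolding hg using free_map_comp[OF in1(1) \<mu>1(1)] by (simp add: C.tarr cong: typing_cong)
  also have "\<dots> = ?h \<cdot>\<^sub>M (?g \<cdot>\<^sub>M ?f)"
    by (rule M.comp_assoc[OF free_map_in[OF in1(1)] free_map_in[OF in1(2)] free_map_in[OF in1(3)]])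
      (simp_all add: C.tarr)
  also have "\<dots> = free_map \<one>\<^sub>C (\<mu> \<cdot>\<^sub>C (idA \<otimes>\<^sub>C \<mu>))"
    unfolding gf using free_map_comp[OF \<mu>1(2) in1(3)] by (simp add: C.tarr cong: typing_cong)
  finally have assoc: "\<mu> \<cdot>\<^sub>C (\<mu> \<otimes>\<^sub>C idA) = \<mu> \<cdot>\<^sub>C (idA \<otimes>\<^sub>C \<mu>)"
    by (rule free_map_inj[rotated 3]) (simp_all add: C.tarr in_Hom_iff cong: typing_cong)
  have u1: "free_map \<one>\<^sub>C \<eta> = idM (\<one>\<^sub>C \<rhd>\<^sub>O m)"
    using free_map_unit[OF C.ident_in[OF C.unit_obj_in]] by (simp add: C.tarr marr)
  have u2: "free_map A (idA \<otimes>\<^sub>C \<eta>) = idM (A \<rhd>\<^sub>O m)"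
    using free_map_unit[OF C.ident_in[of A]] by (simp add: C.tarr marr)
  have \<eta>1: "\<eta> \<in> Hom C \<one>\<^sub>C (\<one>\<^sub>C \<otimes>\<^sub>O A)" "idA \<otimes>\<^sub>C \<eta> \<in> Hom C A (A \<otimes>\<^sub>O A)"
    by (simp_all add: C.tarr in_Hom_iff)
  have h: "?h \<in> Hom M (A \<rhd>\<^sub>O m) (\<one>\<^sub>C \<rhd>\<^sub>O m)" by (rule free_map_in[OF in1(3)]) (simp add: C.tarr)
  have "free_map \<one>\<^sub>C (\<mu> \<cdot>\<^sub>C (\<eta> \<otimes>\<^sub>C idA)) = free_map \<one>\<^sub>C \<eta> \<cdot>\<^sub>M ?h"
    using free_map_comp[OF in1(3) \<eta>1(1)] by (simp add: C.tarr cong: typing_cong)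
  also have "\<dots> = ?h" unfolding u1 by (rule M.comp_ident_left[OF h])
  finally have unit1: "\<mu> \<cdot>\<^sub>C (\<eta> \<otimes>\<^sub>C idA) = idA"
    by (rule free_map_inj[rotated 3]) (simp_all add: C.tarr in_Hom_iff cong: typing_cong)
  have "free_map \<one>\<^sub>C (\<mu> \<cdot>\<^sub>C (idA \<otimes>\<^sub>C \<eta>)) = ?h \<cdot>\<^sub>M free_map A (idA \<otimes>\<^sub>C \<eta>)"
    using free_map_comp[OF \<eta>1(2) in1(3)] by (simp add: C.tarr cong: typing_cong)
  also have "\<dots> = ?h" unfolding u2 by (rule M.comp_ident_right[OF h])
  finally have unit2: "\<mu> \<cdot>\<^sub>C (idA \<otimes>\<^sub>C \<eta>) = idA"
    by (rule free_map_inj[rotated 3]) (simp_all add: C.tarr in_Hom_iff cong: typing_cong)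
  show ?thesis
    unfolding algebra_in_def using evA_mult(1) evA_unit(1) assoc unit1 unit2 by simp
qed

end

section \<open>Partial traces\<close>

context strict_monoidal_category
begin

lemma transp_in:
  assumes "k \<in> Hom C (unit_obj C) (x \<otimes>\<^sub>o y)" "e' \<in> Hom C (y' \<otimes>\<^sub>o x') (unit_obj C)" "f \<in> Hom C x x'"
    "y \<in> Obj C" "y' \<in> Obj C"
  shows "transp C y k y' e' f \<in> Hom C y' y"
  using assms Hom_obj[OF assms(3)] in_HomD[OF assms(1)] in_HomD[OF assms(2)] in_HomD[OF assms(3)]
  unfolding transp_def in_Hom_iff by (simp add: tarr cong: typing_cong)

end

context pivotal_fusion_category
begin

lemma rdual_props:
  assumes "c \<in> Obj C"
  shows "rdual C c \<in> Obj C" "ev C c \<in> Hom C (rdual C c \<otimes>\<^sub>o c) (unit_obj C)"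
    "coev C c \<in> Hom C (unit_obj C) (c \<otimes>\<^sub>o rdual C c)"
  using right_dual[OF assms] unfolding dual_pair_def by auto

lemma ldual_props:
  assumes "c \<in> Obj C"
  shows "ldual C c \<in> Obj C" "lev C c \<in> Hom C (c \<otimes>\<^sub>o ldual C c) (unit_obj C)"
    "lcoev C c \<in> Hom C (unit_obj C) (ldual C c \<otimes>\<^sub>o c)"
  using left_dual[OF assms] unfolding dual_pair_def by auto

lemma rdualM_in:
  assumes "f \<in> Hom C c d"
  shows "rdualM C f \<in> Hom C (rdual C d) (rdual C c)"
  unfolding rdualM_def in_HomD(2,3)[OF assms]
  by (rule transp_in[OF rdual_props(3) rdual_props(2) assms rdual_props(1) rdual_props(1)])
    (use Hom_obj[OF assms] in simp_all)

lemma piv_ldual_in: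
  assumes "c \<in> Obj C"
  shows "piv_ldual C c \<in> Hom C (ldual C c) (rdual C c)"
proof -
  have l: "ldual C c \<in> Obj C" using ldual_props(1)[OF assms] .
  have "can_ldual C c \<in> Hom C c (rdual C (ldual C c))"
    unfolding can_ldual_def
    by (rule transp_in[OF rdual_props(3)[OF l] ldual_props(2)[OF assms] ident_in[OF l]
          rdual_props(1)[OF l] assms])
  thus ?thesis
    unfolding piv_ldual_def using comp_in[OF piv_in rdualM_in] ldual_props(1)[OF assms] by simp
qed

lemma dual_arr:
  assumes "c \<in> Obj C"
  shows "rdual C c \<in> Obj C" "ldual C c \<in> Obj C"
    "ev C c \<in> Arr C" "Dom C (ev C c) = rdual C c \<otimes>\<^sub>o c" "Cod C (ev C c) = unit_obj C"
    "coev C c \<in> Arr C" "Dom C (coev C c) = unit_obj C" "Cod C (coev C c) = c \<otimes>\<^sub>o rdual C c"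
    "lcoev C c \<in> Arr C" "Dom C (lcoev C c) = unit_obj C" "Cod C (lcoev C c) = ldual C c \<otimes>\<^sub>o c"
    "piv_ldual C c \<in> Arr C" "Dom C (piv_ldual C c) = ldual C c" "Cod C (piv_ldual C c) = rdual C c"
  using rdual_props[OF assms] ldual_props[OF assms] piv_ldual_in[OF assms] by (simp_all add: Hom_def)

text \<open>The partial left trace over \<open>c\<close> of a morphism \<open>c \<otimes> d \<rightarrow> c \<otimes> b\<close>. For \<open>d = b = 1\<close> it is the
  left trace.\<close>

definition left_ptr where
  "left_ptr c d b f =
     (ev C c \<otimes>\<^sub>m ident C b) \<cdot> ((piv_ldual C c \<otimes>\<^sub>m f) \<cdot> (lcoev C c \<otimes>\<^sub>m ident C d))"

lemma left_ptr_in: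
  assumes "f \<in> Hom C (c \<otimes>\<^sub>o d) (c \<otimes>\<^sub>o b)" "c \<in> Obj C" "d \<in> Obj C" "b \<in> Obj C"
  shows "left_ptr c d b f \<in> Hom C d b"
  using assms(2-) in_HomD[OF assms(1)]
  unfolding left_ptr_def in_Hom_iff by (simp add: tarr dual_arr cong: typing_cong)

lemma left_trace_ptr:
  assumes "f \<in> Hom C c c"
  shows "left_trace C c f = left_ptr c (unit_obj C) (unit_obj C) f"
  using in_HomD[OF assms] Hom_obj[OF assms]
  unfolding left_ptr_def left_trace_def
  by (simp add: tarr dual_arr comp_assoc_arr cong: typing_cong)

text \<open>The partial trace, computed by first applying \<open>f\<close> and then the pivotal structure.\<close>

lemma left_ptr_alt:
  assumes f: "f \<in> Hom C (c \<otimes>\<^sub>o d) (c \<otimes>\<^sub>o b)" and obj: "c \<in> Obj C" "d \<in> Obj C" "b \<in> Obj C"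
  shows "left_ptr c d b f = (ev C c \<otimes>\<^sub>m ident C b) \<cdot> (ident C (rdual C c) \<otimes>\<^sub>m f)
    \<cdot> (((piv_ldual C c \<otimes>\<^sub>m ident C c) \<cdot> lcoev C c) \<otimes>\<^sub>m ident C d)"
proof -
  note [simp] = obj in_HomD[OF f]
  have "piv_ldual C c \<otimes>\<^sub>m f = (ident C (rdual C c) \<otimes>\<^sub>m f) \<cdot> (piv_ldual C c \<otimes>\<^sub>m ident C (c \<otimes>\<^sub>o d))"
    using exchange(2)[of "piv_ldual C c" f] by (simp add: dual_arr)
  thus ?thesis unfolding left_ptr_def by (simp add: layers dual_arr cong: typing_cong)
qed

definition trace where
  "trace c f = eigenvalue C (unit_obj C) (left_trace C c f)"

lemma left_trace_in: "f \<in> Hom C c c \<Longrightarrow> left_trace C c f \<in> Hom C (unit_obj C) (unit_obj C)"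
  using left_ptr_in[of f c "unit_obj C" "unit_obj C"] left_trace_ptr[of f c] Hom_obj[of f c c]
  by (simp add: tensO_unit unit_obj_in)

lemma linear_left_trace:
  assumes c: "c \<in> Obj C"
  shows "linear_map (hom_module C c c) (hom_module C (unit_obj C) (unit_obj C)) (left_trace C c)"
proof -
  note d = rdual_props[OF c] ldual_props[OF c]
  have "linear_map (hom_module C c c) (hom_module C (unit_obj C) (unit_obj C))
      (\<lambda>f. ev C c \<cdot> (piv_ldual C c \<otimes>\<^sub>m f) \<cdot> lcoev C c)"
    by (rule linear_map_comp[OF linear_map_comp[OF tensM_linear_right[OF piv_ldual_in[OF c] c c]
            comp_linear_right[OF d(2)]] comp_linear_left[OF d(6)]])
      (simp_all add: c d tensO_in unit_obj_in)
  thus ?thesis by (simp add: left_trace_def[abs_def])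
qed

lemma linear_trace:
  assumes "c \<in> Obj C"
  shows "linear_map (hom_module C c c) complex_module (trace c)"
  using linear_map_comp[OF linear_left_trace[OF assms] linear_eigenvalue[OF simple_unit]]
  by (simp add: trace_def[abs_def])

end

section \<open>The counit defined by a module trace\<close>

locale traced_internal_endomorphisms =
  internal_endomorphisms C M m A \<alpha> + module_trace C M \<Theta>
  for C :: "('o, 'a, 'x) pivotal_cat_scheme" and M :: "('o, 'a, 'p, 'b, 'y) mod_cat_scheme"
    and m :: 'p and A :: 'o and \<alpha> :: "'o \<Rightarrow> 'b \<Rightarrow> 'a" and \<Theta> :: "'p \<Rightarrow> 'b \<Rightarrow> complex"
begin

lemma partial_trace_bend:
  assumes F: "F \<in> Hom M (c \<rhd>\<^sub>O n) (c \<rhd>\<^sub>O n)" and c: "c \<in> Obj C" and n: "n \<in> Obj M"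
  shows "partial_trace C M c n F = bend (rdual C c) c c n n (ev C c) F
    \<cdot>\<^sub>M (((piv_ldual C c \<otimes>\<^sub>C idC c) \<cdot>\<^sub>C lcoev C c) \<rhd> idM n) \<cdot>\<^sub>M inv_arr M (uniM n)"
proof -
  note [simp] = c n in_HomD[OF F] C.dual_arr[OF c]
  have 1: "piv_ldual C c \<rhd> F = (idC (rdual C c) \<rhd> F) \<cdot>\<^sub>M (piv_ldual C c \<rhd> idM (c \<rhd>\<^sub>O n))"
    by (rule act_split[OF C.piv_ldual_in[OF c] F])
  have 2: "(piv_ldual C c \<rhd> idM (c \<rhd>\<^sub>O n)) \<cdot>\<^sub>M assM (ldual C c) c n
      = assM (rdual C c) c n \<cdot>\<^sub>M ((piv_ldual C c \<otimes>\<^sub>C idC c) \<rhd> idM n)"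
    using act_assoc_natural[OF C.piv_ldual_in[OF c] C.ident_in[OF c] M.ident_in[OF n]]
    by (simp add: actM_ident)
  show ?thesis
    unfolding partial_trace_def bend_def 1
    by (simp add: marr whisker_act 2[THEN M.comp_eq_assoc] cong: typing_cong)
qed

text \<open>The two computations of partial traces in \<open>M\<close> that are needed: both reduce to partial traces in \<open>C\<close>,
  for morphisms \<open>c \<triangleright> m \<rightarrow> c \<triangleright> m\<close> in terms of \<open>A\<close>, and for the action of an endomorphism of
  \<open>c \<otimes> d\<close>.\<close>

lemma partial_trace_free_map:
  assumes g: "g \<in> Hom C c (c \<otimes>\<^sub>O A)" and c: "c \<in> Obj C"
  shows "partial_trace C M c m (free_map c g)
    = evA \<cdot>\<^sub>M (C.left_ptr c \<one>\<^sub>C A g \<rhd> idM m) \<cdot>\<^sub>M inv_arr M (uniM m)"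
proof -
  note [simp] = c in_HomD[OF g] C.dual_arr[OF c]
  have g1: "g \<in> Hom C (c \<otimes>\<^sub>O \<one>\<^sub>C) (c \<otimes>\<^sub>O A)" using g by (simp add: C.tarr)
  have "partial_trace C M c m (free_map c g)
      = evA \<cdot>\<^sub>M (((ev C c \<otimes>\<^sub>C idA) \<cdot>\<^sub>C (idC (rdual C c) \<otimes>\<^sub>C g)) \<rhd> idM m)
        \<cdot>\<^sub>M (((piv_ldual C c \<otimes>\<^sub>C idC c) \<cdot>\<^sub>C lcoev C c) \<rhd> idM m) \<cdot>\<^sub>M inv_arr M (uniM m)"
    using partial_trace_bend[OF free_map_in[OF g c] c] bend_free_map[OF C.rdual_props(2)[OF c] g c]
    by simp
  also have "\<dots> = evA \<cdot>\<^sub>M (C.left_ptr c \<one>\<^sub>C A g \<rhd> idM m) \<cdot>\<^sub>M inv_arr M (uniM m)"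
    unfolding C.left_ptr_alt[OF g1 c C.unit_obj_in inner_in]
    by (simp add: marr whisker_act cong: typing_cong)
  finally show ?thesis .
qed

lemma partial_trace_act:
  assumes f: "f \<in> Hom C (c \<otimes>\<^sub>O d) (c \<otimes>\<^sub>O d)" and c: "c \<in> Obj C" and d: "d \<in> Obj C"
  shows "partial_trace C M c (d \<rhd>\<^sub>O m) (assM c d m \<cdot>\<^sub>M (f \<rhd> idM m) \<cdot>\<^sub>M inv_arr M (assM c d m))
    = C.left_ptr c d d f \<rhd> idM m"
proof -
  note [simp] = c d in_HomD[OF f] C.dual_arr[OF c]
  define q where "q = (piv_ldual C c \<otimes>\<^sub>C idC c) \<cdot>\<^sub>C lcoev C c"
  have q: "q \<in> Hom C \<one>\<^sub>C (rdual C c \<otimes>\<^sub>O c)"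
    unfolding q_def by (simp add: C.tarr in_Hom_iff cong: typing_cong)
  note [simp] = in_HomD[OF q]
  let ?n = "d \<rhd>\<^sub>O m" and ?y = "rdual C c"
  define F where "F = assM c d m \<cdot>\<^sub>M (f \<rhd> idM m) \<cdot>\<^sub>M inv_arr M (assM c d m)"
  have F: "F \<in> Hom M (c \<rhd>\<^sub>O ?n) (c \<rhd>\<^sub>O ?n)"
    unfolding F_def by (simp add: marr in_Hom_iff cong: typing_cong)
  have n [simp]: "?n \<in> Obj M" by (simp add: actO_in)
  have Fa: "F \<cdot>\<^sub>M assM c d m = (idC c \<rhd> idM ?n) \<cdot>\<^sub>M assM c d m \<cdot>\<^sub>M (f \<rhd> idM m)"
    unfolding F_def by (simp add: marr assM_inv cong: typing_cong)
  have 1: "inv_arr M (uniM ?n) = assM \<one>\<^sub>C d m"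
  proof -
    have "uniM ?n \<cdot>\<^sub>M assM \<one>\<^sub>C d m = idM ?n" by (rule unit_triangle) simp_all
    from M.comp_eq_assoc[OF uniM_inv(1)[OF n], of "assM \<one>\<^sub>C d m"] this
    show ?thesis by (simp add: marr)
  qed
  have 2: "(q \<rhd> idM ?n) \<cdot>\<^sub>M assM \<one>\<^sub>C d m = assM (?y \<otimes>\<^sub>O c) d m \<cdot>\<^sub>M ((q \<otimes>\<^sub>C idC d) \<rhd> idM m)"
    using act_assoc_natural[OF q C.ident_in[OF d] M.ident_in[of m]] by (simp add: actM_ident)
  have 3: "bend ?y c c ?n ?n (ev C c) F \<cdot>\<^sub>M assM (?y \<otimes>\<^sub>O c) d m
      = ((ev C c \<otimes>\<^sub>C idC d) \<cdot>\<^sub>C (idC ?y \<otimes>\<^sub>C f)) \<rhd> idM m"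
    unfolding bend_assoc[OF C.rdual_props(2)[OF c] F c C.rdual_props(1)[OF c] c d source_in n] Fa
      bend_internal[OF C.rdual_props(2)[OF c] f M.ident_in[OF n] c C.rdual_props(1)[OF c] d source_in]
    by (simp add: marr cong: typing_cong)
  have bin: "bend ?y c c ?n ?n (ev C c) F \<in> Hom M ((?y \<otimes>\<^sub>O c) \<rhd>\<^sub>O ?n) ?n"
    by (rule bend_in[OF C.rdual_props(2)[OF c] F]) simp_all
  have "partial_trace C M c ?n F = bend ?y c c ?n ?n (ev C c) F \<cdot>\<^sub>M (q \<rhd> idM ?n) \<cdot>\<^sub>M assM \<one>\<^sub>C d m"
    unfolding partial_trace_bend[OF F c n] q_def[symmetric] 1 ..
  also have "\<dots> = (bend ?y c c ?n ?n (ev C c) F \<cdot>\<^sub>M assM (?y \<otimes>\<^sub>O c) d m) \<cdot>\<^sub>M ((q \<otimes>\<^sub>C idC d) \<rhd> idM m)"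
    using in_HomD[OF bin] by (simp add: marr 2 cong: typing_cong)
  also have "\<dots> = C.left_ptr c d d f \<rhd> idM m"
    unfolding 3 C.left_ptr_alt[OF f c d d] q_def[symmetric]
    by (simp add: marr whisker_act cong: typing_cong)
  finally show ?thesis unfolding F_def .
qed

lemma trace_act:
  assumes f: "f \<in> Hom C (c \<otimes>\<^sub>O d) (c \<otimes>\<^sub>O d)" and c: "c \<in> Obj C" and d: "d \<in> Obj C"
  shows "\<Theta> ((c \<otimes>\<^sub>O d) \<rhd>\<^sub>O m) (f \<rhd> idM m) = \<Theta> (d \<rhd>\<^sub>O m) (C.left_ptr c d d f \<rhd> idM m)"
proof -
  note [simp] = c d in_HomD[OF f]
  let ?a = "assM c d m" and ?F = "assM c d m \<cdot>\<^sub>M (f \<rhd> idM m) \<cdot>\<^sub>M inv_arr M (assM c d m)"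
  have in1: "?a \<cdot>\<^sub>M (f \<rhd> idM m) \<in> Hom M ((c \<otimes>\<^sub>O d) \<rhd>\<^sub>O m) (c \<rhd>\<^sub>O d \<rhd>\<^sub>O m)"
    "inv_arr M ?a \<in> Hom M (c \<rhd>\<^sub>O d \<rhd>\<^sub>O m) ((c \<otimes>\<^sub>O d) \<rhd>\<^sub>O m)"
    "?F \<in> Hom M (c \<rhd>\<^sub>O d \<rhd>\<^sub>O m) (c \<rhd>\<^sub>O d \<rhd>\<^sub>O m)"
    by (simp_all add: marr in_Hom_iff cong: typing_cong)
  have "f \<rhd> idM m = inv_arr M ?a \<cdot>\<^sub>M (?a \<cdot>\<^sub>M (f \<rhd> idM m))"
    by (simp add: marr assM_inv(1)[THEN M.comp_eq_assoc] cong: typing_cong)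
  hence "\<Theta> ((c \<otimes>\<^sub>O d) \<rhd>\<^sub>O m) (f \<rhd> idM m) = \<Theta> (c \<rhd>\<^sub>O d \<rhd>\<^sub>O m) ?F"
    using trace_symmetric[OF in1(1,2)] by simp
  also have "\<dots> = \<Theta> (d \<rhd>\<^sub>O m) (C.left_ptr c d d f \<rhd> idM m)"
    using trace_compatible[OF c _ in1(3)] partial_trace_act[OF f c d] by (simp add: actO_in)
  finally show ?thesis .
qed

text \<open>A state \<open>q : 1 \<rightarrow> A\<close> is the same as an endomorphism of \<open>m\<close>, and \<open>unit_trace\<close> is the module
  trace of the latter. The counit is the morphism \<open>A \<rightarrow> 1\<close> that induces this functional on states; it
  is the only one, since states separate morphisms to \<open>1\<close>.\<close>

definition unit_trace where
  "unit_trace q = \<Theta> m (evA \<cdot>\<^sub>M (q \<rhd> idM m) \<cdot>\<^sub>M inv_arr M (uniM m))"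

lemma linear_unit_trace: "linear_map (hom_module C \<one>\<^sub>C A) complex_module unit_trace"
proof -
  have u: "inv_arr M (uniM m) \<in> Hom M m (\<one>\<^sub>C \<rhd>\<^sub>O m)" by (simp add: marr in_Hom_iff)
  have "linear_map (hom_module C \<one>\<^sub>C A) complex_module
      (\<lambda>q. \<Theta> m (evA \<cdot>\<^sub>M (q \<rhd> idM m) \<cdot>\<^sub>M inv_arr M (uniM m)))"
    by (rule linear_map_comp[OF linear_map_comp[OF linear_map_comp[OF
              actM_linear_left[OF M.ident_in] M.comp_linear_right[OF evA_in]]
            M.comp_linear_left[OF u]] trace_linear])
      (simp_all add: actO_in C.unit_obj_in)
  thus ?thesis by (simp add: unit_trace_def[abs_def])
qed

lemma trace_free_map:
  assumes "g \<in> Hom C c (c \<otimes>\<^sub>O A)" "c \<in> Obj C"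
  shows "\<Theta> (c \<rhd>\<^sub>O m) (free_map c g) = unit_trace (C.left_ptr c \<one>\<^sub>C A g)"
  using trace_compatible[OF assms(2) source_in free_map_in[OF assms]]
    partial_trace_free_map[OF assms] by (simp add: unit_trace_def)

lemma trace_free_map_unit:
  assumes q: "q \<in> Hom C \<one>\<^sub>C A"
  shows "\<Theta> (\<one>\<^sub>C \<rhd>\<^sub>O m) (free_map \<one>\<^sub>C q) = unit_trace q"
proof -
  note [simp] = in_HomD[OF q]
  have 1: "uniM m \<cdot>\<^sub>M (idC \<one>\<^sub>C \<rhd> evA) = evA \<cdot>\<^sub>M uniM (A \<rhd>\<^sub>O m)"
    by (rule act_unit_natural[OF evA_in])
  have 2: "uniM (A \<rhd>\<^sub>O m) \<cdot>\<^sub>M assM \<one>\<^sub>C A m = idM (A \<rhd>\<^sub>O m)" by (rule unit_triangle) simp_all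
  have "uniM m \<cdot>\<^sub>M free_map \<one>\<^sub>C q = evA \<cdot>\<^sub>M (q \<rhd> idM m)"
    unfolding free_map_def
    by (simp add: marr 1[THEN M.comp_eq_assoc] 2[THEN M.comp_eq_assoc] cong: typing_cong)
  moreover have K: "free_map \<one>\<^sub>C q \<in> Hom M (\<one>\<^sub>C \<rhd>\<^sub>O m) (\<one>\<^sub>C \<rhd>\<^sub>O m)"
    by (rule free_map_in) (simp_all add: C.tarr q)
  ultimately have "free_map \<one>\<^sub>C q = inv_arr M (uniM m) \<cdot>\<^sub>M (evA \<cdot>\<^sub>M (q \<rhd> idM m))"
    using M.comp_eq_assoc[OF uniM_inv(1)[OF source_in], of "free_map \<one>\<^sub>C q"] in_HomD[OF K]
    by (simp add: marr)
  moreover have "inv_arr M (uniM m) \<in> Hom M m (\<one>\<^sub>C \<rhd>\<^sub>O m)" by (simp add: marr in_Hom_iff)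
  ultimately show ?thesis
    using trace_symmetric[of "inv_arr M (uniM m)" m "\<one>\<^sub>C \<rhd>\<^sub>O m" "evA \<cdot>\<^sub>M (q \<rhd> idM m)"] evA_act_in[OF q]
    by (simp add: unit_trace_def)
qed

definition counit where
  "counit = (SOME \<epsilon>. \<epsilon> \<in> Hom C A \<one>\<^sub>C \<and>
     (\<forall>q\<in>Hom C \<one>\<^sub>C A. \<epsilon> \<cdot>\<^sub>C q = Scale C (unit_trace q) (idC \<one>\<^sub>C)))"

lemma counit:
  shows counit_in: "counit \<in> Hom C A \<one>\<^sub>C"
    and counit_comp: "q \<in> Hom C \<one>\<^sub>C A \<Longrightarrow> counit \<cdot>\<^sub>C q = Scale C (unit_trace q) (idC \<one>\<^sub>C)"
proof -
  have "\<exists>\<epsilon>. \<epsilon> \<in> Hom C A \<one>\<^sub>C \<and> (\<forall>q\<in>Hom C \<one>\<^sub>C A. \<epsilon> \<cdot>\<^sub>C q = Scale C (unit_trace q) (idC \<one>\<^sub>C))"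
    using C.functional_by_simple[OF C.simple_unit inner_in linear_unit_trace] by blast
  from someI_ex[OF this] show "counit \<in> Hom C A \<one>\<^sub>C"
    "q \<in> Hom C \<one>\<^sub>C A \<Longrightarrow> counit \<cdot>\<^sub>C q = Scale C (unit_trace q) (idC \<one>\<^sub>C)"
    unfolding counit_def by blast+
qed

lemmas counit_arr [simp] = in_HomD[OF counit_in]

subsection \<open>Nondegeneracy\<close>

text \<open>The trace pairing of \<open>Hom(x \<triangleright> m, m)\<close> with \<open>Hom(m, x \<triangleright> m)\<close>, read off in \<open>C\<close>.\<close>

definition pairing where
  "pairing x h k = \<Theta> (\<one>\<^sub>C \<rhd>\<^sub>O m) (free_map \<one>\<^sub>C h \<cdot>\<^sub>M free_map x k)"

lemma counit_pairing:
  assumes h: "h \<in> Hom C x A" and k: "k \<in> Hom C \<one>\<^sub>C (x \<otimes>\<^sub>O A)"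
  shows "(counit \<cdot>\<^sub>C \<mu>) \<cdot>\<^sub>C ((h \<otimes>\<^sub>C idA) \<cdot>\<^sub>C k) = Scale C (pairing x h k) (idC \<one>\<^sub>C)"
proof -
  note [simp] = in_HomD[OF h] in_HomD[OF k] C.Hom_obj[OF h]
  have in1: "\<mu> \<cdot>\<^sub>C ((h \<otimes>\<^sub>C idA) \<cdot>\<^sub>C k) \<in> Hom C \<one>\<^sub>C A"
    by (simp add: C.tarr in_Hom_iff cong: typing_cong)
  have "h \<in> Hom C x (\<one>\<^sub>C \<otimes>\<^sub>O A)" using h by (simp add: C.tarr)
  from free_map_comp[OF k this] have "free_map \<one>\<^sub>C h \<cdot>\<^sub>M free_map x k = free_map \<one>\<^sub>C (\<mu> \<cdot>\<^sub>C ((h \<otimes>\<^sub>C idA) \<cdot>\<^sub>C k))"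
    by (simp add: C.tarr)
  hence "pairing x h k = unit_trace (\<mu> \<cdot>\<^sub>C ((h \<otimes>\<^sub>C idA) \<cdot>\<^sub>C k))"
    unfolding pairing_def using trace_free_map_unit[OF in1] by simp
  thus ?thesis
    using counit_comp[OF in1] by (simp add: C.tarr C.comp_assoc_arr cong: typing_cong)
qed

lemma linear_pairing:
  shows "h \<in> Hom C x A \<Longrightarrow> linear_map (hom_module C \<one>\<^sub>C (x \<otimes>\<^sub>O A)) complex_module (pairing x h)"
    and "k \<in> Hom C \<one>\<^sub>C (x \<otimes>\<^sub>O A) \<Longrightarrow> x \<in> Obj C \<Longrightarrow>
      linear_map (hom_module C x A) complex_module (\<lambda>h. pairing x h k)"
proof -
  have 1: "\<one>\<^sub>C \<in> Obj C" "\<one>\<^sub>C \<otimes>\<^sub>O A = A" "\<one>\<^sub>C \<rhd>\<^sub>O m \<in> Obj M" by (simp_all add: C.tarr marr)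
  {
    assume h: "h \<in> Hom C x A"
    hence x: "x \<in> Obj C" and h': "h \<in> Hom C x (\<one>\<^sub>C \<otimes>\<^sub>O A)" using C.Hom_obj 1 by auto
    show "linear_map (hom_module C \<one>\<^sub>C (x \<otimes>\<^sub>O A)) complex_module (pairing x h)"
      unfolding pairing_def[abs_def]
      by (rule linear_map_comp[OF linear_map_comp[OF linear_free_map[OF 1(1) x]
            M.comp_linear_right[OF free_map_in[OF h' 1(1)] 1(3)]] trace_linear[OF 1(3)]])
  }
  {
    assume k: "k \<in> Hom C \<one>\<^sub>C (x \<otimes>\<^sub>O A)" and x: "x \<in> Obj C"
    show "linear_map (hom_module C x A) complex_module (\<lambda>h. pairing x h k)"
      unfolding pairing_def[abs_def]
      using linear_map_comp[OF linear_map_comp[OF linear_free_map[OF x 1(1)]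
            M.comp_linear_left[OF free_map_in[OF k x] 1(3)]] trace_linear[OF 1(3)]] 1(2) by simp
  }
qed

lemma free_map_zero:
  assumes "g \<in> Hom C c (d \<otimes>\<^sub>O A)" "d \<in> Obj C" "free_map d g = Zero M (c \<rhd>\<^sub>O m) (d \<rhd>\<^sub>O m)"
  shows "g = Zero C c (d \<otimes>\<^sub>O A)"
proof (rule free_map_inj[OF assms(1) _ assms(2)])
  have obj: "c \<in> Obj C" "d \<otimes>\<^sub>O A \<in> Obj C" using C.Hom_obj[OF assms(1)] .
  show "Zero C c (d \<otimes>\<^sub>O A) \<in> Hom C c (d \<otimes>\<^sub>O A)" by (rule C.Zero_in[OF obj])
  show "free_map d g = free_map d (Zero C c (d \<otimes>\<^sub>O A))"
    using linear_map_zero[OF C.module_Hom[OF obj] M.module_Hom linear_free_map[OF obj(1) assms(2)]]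
      assms obj by (simp add: actO_in)
qed

lemma pairing_nondegenerate:
  shows "k \<in> Hom C \<one>\<^sub>C (x \<otimes>\<^sub>O A) \<Longrightarrow> x \<in> Obj C \<Longrightarrow>
      (\<And>h. h \<in> Hom C x A \<Longrightarrow> pairing x h k = 0) \<Longrightarrow> k = Zero C \<one>\<^sub>C (x \<otimes>\<^sub>O A)"
    and "h \<in> Hom C x A \<Longrightarrow> (\<And>k. k \<in> Hom C \<one>\<^sub>C (x \<otimes>\<^sub>O A) \<Longrightarrow> pairing x h k = 0) \<Longrightarrow> h = Zero C x A"
proof -
  have 1: "\<one>\<^sub>C \<in> Obj C" "\<one>\<^sub>C \<otimes>\<^sub>O A = A" by (simp_all add: C.tarr)
  {
    assume k: "k \<in> Hom C \<one>\<^sub>C (x \<otimes>\<^sub>O A)" and x: "x \<in> Obj C"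
      and 0: "\<And>h. h \<in> Hom C x A \<Longrightarrow> pairing x h k = 0"
    have "free_map x k = Zero M (\<one>\<^sub>C \<rhd>\<^sub>O m) (x \<rhd>\<^sub>O m)"
    proof (rule trace_nondegenerate_left[OF free_map_in[OF k x]])
      fix G assume "G \<in> Hom M (x \<rhd>\<^sub>O m) (\<one>\<^sub>C \<rhd>\<^sub>O m)"
      from free_map_surj[OF this x 1(1)] obtain h where "h \<in> Hom C x A" "free_map \<one>\<^sub>C h = G"
        using 1(2) by auto
      thus "\<Theta> (\<one>\<^sub>C \<rhd>\<^sub>O m) (G \<cdot>\<^sub>M free_map x k) = 0" using 0[of h] by (simp add: pairing_def)
    qed
    thus "k = Zero C \<one>\<^sub>C (x \<otimes>\<^sub>O A)" by (rule free_map_zero[OF k x])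
  }
  {
    assume h: "h \<in> Hom C x A" and 0: "\<And>k. k \<in> Hom C \<one>\<^sub>C (x \<otimes>\<^sub>O A) \<Longrightarrow> pairing x h k = 0"
    have x: "x \<in> Obj C" using C.Hom_obj[OF h] by simp
    have h': "h \<in> Hom C x (\<one>\<^sub>C \<otimes>\<^sub>O A)" using h 1(2) by simp
    have "free_map \<one>\<^sub>C h = Zero M (x \<rhd>\<^sub>O m) (\<one>\<^sub>C \<rhd>\<^sub>O m)"
    proof (rule trace_nondegenerate_right[OF free_map_in[OF h' 1(1)]])
      fix F assume "F \<in> Hom M (\<one>\<^sub>C \<rhd>\<^sub>O m) (x \<rhd>\<^sub>O m)"
      from free_map_surj[OF this 1(1) x] obtain k where "k \<in> Hom C \<one>\<^sub>C (x \<otimes>\<^sub>O A)" "free_map x k = F"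
        by auto
      thus "\<Theta> (\<one>\<^sub>C \<rhd>\<^sub>O m) (free_map \<one>\<^sub>C h \<cdot>\<^sub>M F) = 0" using 0[of k] by (simp add: pairing_def)
    qed
    from free_map_zero[OF h' 1(1) this] show "h = Zero C x A" using 1(2) by simp
  }
qed

text \<open>Evaluation on \<open>A\<^sup>* \<otimes> A\<close> is a functional on \<open>Hom(1, A\<^sup>* \<otimes> A)\<close>, hence is represented by some
  \<open>r : A\<^sup>* \<rightarrow> A\<close>. Transporting the coevaluation along \<open>r\<close> gives the copairing \<open>\<delta>\<close>; one zigzag
  is immediate, and the other one holds after pairing with \<open>A\<close>, which loses nothing.\<close>

lemma nondegenerate_form:
  obtains \<delta> where "\<delta> \<in> Hom C \<one>\<^sub>C (A \<otimes>\<^sub>O A)"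
    "(idA \<otimes>\<^sub>C (counit \<cdot>\<^sub>C \<mu>)) \<cdot>\<^sub>C (\<delta> \<otimes>\<^sub>C idA) = idA"
    "((counit \<cdot>\<^sub>C \<mu>) \<otimes>\<^sub>C idA) \<cdot>\<^sub>C (idA \<otimes>\<^sub>C \<delta>) = idA"
proof -
  define y where "y = rdual C A"
  note D = C.dual_arr[OF inner_in]
  have y [simp]: "y \<in> Obj C" unfolding y_def using D by simp
  note [simp] = D[folded y_def]
  have ev: "ev C A \<in> Hom C (y \<otimes>\<^sub>O A) \<one>\<^sub>C" and coev: "coev C A \<in> Hom C \<one>\<^sub>C (A \<otimes>\<^sub>O y)"
    and zig: "(idA \<otimes>\<^sub>C ev C A) \<cdot>\<^sub>C (coev C A \<otimes>\<^sub>C idA) = idA"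
    using C.right_dual[OF inner_in] unfolding dual_pair_def y_def by auto
  have yA [simp]: "y \<otimes>\<^sub>O A \<in> Obj C" by (simp add: C.tarr)
  define \<kappa> where "\<kappa> = counit \<cdot>\<^sub>C \<mu>"
  have \<kappa>: "\<kappa> \<in> Hom C (A \<otimes>\<^sub>O A) \<one>\<^sub>C" unfolding \<kappa>_def by (simp add: C.tarr in_Hom_iff)
  note [simp] = in_HomD[OF \<kappa>]
  have \<kappa>_pairing: "\<kappa> \<cdot>\<^sub>C (h \<otimes>\<^sub>C idA) \<cdot>\<^sub>C k = Scale C (pairing x h k) (idC \<one>\<^sub>C)"
    if "h \<in> Hom C x A" "k \<in> Hom C \<one>\<^sub>C (x \<otimes>\<^sub>O A)" for x h k
    using counit_pairing[OF that] in_HomD[OF that(1)] in_HomD[OF that(2)] C.Hom_obj[OF that(1)]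
    by (simp add: \<kappa>_def[symmetric] C.tarr C.comp_assoc_arr cong: typing_cong)
  define \<phi> where "\<phi> k = eigenvalue C \<one>\<^sub>C (ev C A \<cdot>\<^sub>C k)" for k
  have \<phi>: "linear_map (hom_module C \<one>\<^sub>C (y \<otimes>\<^sub>O A)) complex_module \<phi>"
    unfolding \<phi>_def[abs_def]
    by (rule linear_map_comp[OF C.comp_linear_right[OF ev C.unit_obj_in]
          C.linear_eigenvalue[OF C.simple_unit]])
  have "\<exists>r\<in>carrier (hom_module C y A). \<forall>k\<in>carrier (hom_module C \<one>\<^sub>C (y \<otimes>\<^sub>O A)). pairing y r k = \<phi> k"
    by (rule functional_represented[OF C.module_Hom C.module_Hom C.finite_dimensional_Hom _ _ _ \<phi>])
      (use linear_pairing pairing_nondegenerate(1) in \<open>auto simp: C.unit_obj_in\<close>)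
  then obtain r where r: "r \<in> Hom C y A" "\<And>k. k \<in> Hom C \<one>\<^sub>C (y \<otimes>\<^sub>O A) \<Longrightarrow> pairing y r k = \<phi> k" by auto
  note [simp] = in_HomD[OF r(1)]
  have \<kappa>r: "\<kappa> \<cdot>\<^sub>C (r \<otimes>\<^sub>C idA) = ev C A"
  proof (rule C.eq_if_agree_on_simple[OF C.simple_unit _ ev])
    show "\<kappa> \<cdot>\<^sub>C (r \<otimes>\<^sub>C idA) \<in> Hom C (y \<otimes>\<^sub>O A) \<one>\<^sub>C" by (simp add: C.tarr in_Hom_iff)
    fix k assume k: "k \<in> Hom C \<one>\<^sub>C (y \<otimes>\<^sub>O A)"
    show "\<kappa> \<cdot>\<^sub>C (r \<otimes>\<^sub>C idA) \<cdot>\<^sub>C k = ev C A \<cdot>\<^sub>C k"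
      using \<kappa>_pairing[OF r(1) k] r(2)[OF k] C.eigenvalue[OF C.simple_unit C.comp_in[OF k ev]]
      by (simp add: \<phi>_def)
  qed
  define \<delta> where "\<delta> = (idA \<otimes>\<^sub>C r) \<cdot>\<^sub>C coev C A"
  have \<delta>: "\<delta> \<in> Hom C \<one>\<^sub>C (A \<otimes>\<^sub>O A)" unfolding \<delta>_def by (simp add: C.tarr in_Hom_iff cong: typing_cong)
  note [simp] = in_HomD[OF \<delta>]
  have zig1: "(idA \<otimes>\<^sub>C \<kappa>) \<cdot>\<^sub>C (\<delta> \<otimes>\<^sub>C idA) = idA"
  proof -
    have "(idA \<otimes>\<^sub>C \<kappa>) \<cdot>\<^sub>C (\<delta> \<otimes>\<^sub>C idA) = (idA \<otimes>\<^sub>C (\<kappa> \<cdot>\<^sub>C (r \<otimes>\<^sub>C idA))) \<cdot>\<^sub>C (coev C A \<otimes>\<^sub>C idA)"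
      unfolding \<delta>_def by (simp add: C.layers cong: typing_cong)
    thus ?thesis unfolding \<kappa>r using zig by simp
  qed
  define z where "z = (\<kappa> \<otimes>\<^sub>C idA) \<cdot>\<^sub>C (idA \<otimes>\<^sub>C \<delta>)"
  have z: "z \<in> Hom C A A" unfolding z_def by (simp add: C.tarr in_Hom_iff cong: typing_cong)
  note [simp] = in_HomD[OF z]
  have \<kappa>z: "\<kappa> \<cdot>\<^sub>C (z \<otimes>\<^sub>C idA) = \<kappa> \<cdot>\<^sub>C (idA \<otimes>\<^sub>C idA)"
  proof -
    have s: "\<kappa> \<cdot>\<^sub>C (\<kappa> \<otimes>\<^sub>C idC (A \<otimes>\<^sub>O A)) = \<kappa> \<cdot>\<^sub>C (idC (A \<otimes>\<^sub>O A) \<otimes>\<^sub>C \<kappa>)"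
      using C.slide[OF \<kappa> \<kappa>] by (simp add: C.tarr)
    have "\<kappa> \<cdot>\<^sub>C (z \<otimes>\<^sub>C idA) = (\<kappa> \<cdot>\<^sub>C (\<kappa> \<otimes>\<^sub>C idC (A \<otimes>\<^sub>O A))) \<cdot>\<^sub>C (idA \<otimes>\<^sub>C \<delta> \<otimes>\<^sub>C idA)"
      unfolding z_def by (simp add: C.layers cong: typing_cong)
    also have "\<dots> = \<kappa> \<cdot>\<^sub>C (idA \<otimes>\<^sub>C ((idA \<otimes>\<^sub>C \<kappa>) \<cdot>\<^sub>C (\<delta> \<otimes>\<^sub>C idA)))"
      unfolding s by (simp add: C.layers cong: typing_cong)
    finally show ?thesis unfolding zig1 .
  qed
  have "z = idA"
  proof (rule C.difference_zero[OF z C.ident_in[OF inner_in]], rule pairing_nondegenerate(2))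
    have mid: "Scale C (-1) idA \<in> Hom C A A" using C.Hom_module_laws(1)[OF C.ident_in] by simp
    show "Add C z (Scale C (-1) idA) \<in> Hom C A A" by (rule C.Hom_module_laws(2)[OF z mid])
    fix k assume k: "k \<in> Hom C \<one>\<^sub>C (A \<otimes>\<^sub>O A)"
    have "Scale C (pairing A z k) (idC \<one>\<^sub>C) = Scale C (pairing A idA k) (idC \<one>\<^sub>C)"
      using \<kappa>_pairing[OF z k] \<kappa>_pairing[OF C.ident_in k] \<kappa>z by simp
    hence "pairing A z k = pairing A idA k"
      using C.Scale_ident_eq C.simple_obj[OF C.simple_unit] by blast
    thus "pairing A (Add C z (Scale C (-1) idA)) k = 0"
      using linear_map_add[OF linear_pairing(2)[OF k], of z "Scale C (-1) idA"] z mid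
        linear_map_smult[OF linear_pairing(2)[OF k], of idA "-1"] C.ident_in by simp
  qed
  hence zig2: "(\<kappa> \<otimes>\<^sub>C idA) \<cdot>\<^sub>C (idA \<otimes>\<^sub>C \<delta>) = idA" unfolding z_def .
  show ?thesis
    using that[OF \<delta>] zig1 zig2 unfolding \<kappa>_def by simp
qed

end

context traced_internal_endomorphisms
begin

lemma frobenius_structure:
  obtains \<delta> \<Delta> where "\<Delta> = (idA \<otimes>\<^sub>C \<mu>) \<cdot>\<^sub>C (\<delta> \<otimes>\<^sub>C idA)" "\<Delta> \<cdot>\<^sub>C \<eta> = \<delta>"
    "frobenius_algebra C A \<mu> \<eta> \<Delta> counit"
proof -
  obtain \<delta> where \<delta>: "\<delta> \<in> Hom C \<one>\<^sub>C (A \<otimes>\<^sub>O A)"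
    "(idA \<otimes>\<^sub>C (counit \<cdot>\<^sub>C \<mu>)) \<cdot>\<^sub>C (\<delta> \<otimes>\<^sub>C idA) = idA"
    "((counit \<cdot>\<^sub>C \<mu>) \<otimes>\<^sub>C idA) \<cdot>\<^sub>C (idA \<otimes>\<^sub>C \<delta>) = idA"
    using nondegenerate_form by blast
  from C.frobenius_from_nondegenerate_form[OF internal_algebra counit_in \<delta>] that
  show ?thesis by blast
qed

lemma counit_left_ptr:
  assumes g: "g \<in> Hom C c (c \<otimes>\<^sub>O A)" and c: "c \<in> Obj C"
  shows "counit \<cdot>\<^sub>C C.left_ptr c \<one>\<^sub>C A g = left_trace C c ((idC c \<otimes>\<^sub>C counit) \<cdot>\<^sub>C g)"
proof -
  note [simp] = c in_HomD[OF g] C.dual_arr[OF c]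
  let ?p = "piv_ldual C c"
  have pg: "?p \<otimes>\<^sub>C g = (idC (rdual C c) \<otimes>\<^sub>C g) \<cdot>\<^sub>C (?p \<otimes>\<^sub>C idC c)"
    using C.exchange(2)[of ?p g] by (simp add: C.tarr)
  have pg': "?p \<otimes>\<^sub>C ((idC c \<otimes>\<^sub>C counit) \<cdot>\<^sub>C g)
      = (idC (rdual C c) \<otimes>\<^sub>C ((idC c \<otimes>\<^sub>C counit) \<cdot>\<^sub>C g)) \<cdot>\<^sub>C (?p \<otimes>\<^sub>C idC c)"
    using C.exchange(2)[of ?p "(idC c \<otimes>\<^sub>C counit) \<cdot>\<^sub>C g"] by (simp add: C.tarr)
  have s: "counit \<cdot>\<^sub>C (ev C c \<otimes>\<^sub>C idA) = ev C c \<cdot>\<^sub>C (idC (rdual C c \<otimes>\<^sub>O c) \<otimes>\<^sub>C counit)"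
    using C.slide[OF C.rdual_props(2)[OF c] counit_in] by (simp add: C.tarr)
  show ?thesis
    unfolding C.left_ptr_def left_trace_def pg pg'
    by (simp add: C.layers s[THEN C.comp_eq_assoc] cong: typing_cong)
qed

text \<open>Compatibility of the module trace with the action, read off in \<open>C\<close>: composing with the counit
  turns the module trace into the left trace.\<close>

lemma trace_free_map_counit:
  assumes g: "g \<in> Hom C c (c \<otimes>\<^sub>O A)" and c: "c \<in> Obj C"
  shows "\<Theta> (c \<rhd>\<^sub>O m) (free_map c g) = C.trace c ((idC c \<otimes>\<^sub>C counit) \<cdot>\<^sub>C g)"
proof -
  have "g \<in> Hom C (c \<otimes>\<^sub>O \<one>\<^sub>C) (c \<otimes>\<^sub>O A)" using g c by (simp add: C.tarr)
  hence in1: "C.left_ptr c \<one>\<^sub>C A g \<in> Hom C \<one>\<^sub>C A" by (rule C.left_ptr_in) (simp_all add: c C.unit_obj_in)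
  show ?thesis
    unfolding trace_free_map[OF assms] C.trace_def counit_left_ptr[OF assms, symmetric] counit_comp[OF in1]
    using C.eigenvalue_Scale[OF C.simple_unit] by simp
qed

text \<open>By symmetry of the module trace, the composite \<open>1 \<rightarrow> A \<otimes> A \<rightarrow> A \<rightarrow> 1\<close>, a trace of
  \<open>m \<rightarrow> A \<triangleright> m \<rightarrow> m\<close>, equals the trace of \<open>A \<triangleright> m \<rightarrow> m \<rightarrow> A \<triangleright> m\<close>; the latter endomorphism
  corresponds to the comultiplication, and its trace is the dimension of \<open>A\<close> by the counit law.\<close>

lemma counit_mult_copairing:
  assumes \<delta>: "\<delta> \<in> Hom C \<one>\<^sub>C (A \<otimes>\<^sub>O A)" and \<Delta>: "\<Delta> = (idA \<otimes>\<^sub>C \<mu>) \<cdot>\<^sub>C (\<delta> \<otimes>\<^sub>C idA)"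
    and cu: "(idA \<otimes>\<^sub>C counit) \<cdot>\<^sub>C \<Delta> = idA"
  shows "(counit \<cdot>\<^sub>C \<mu>) \<cdot>\<^sub>C \<delta> = Scale C (C.trace A idA) (idC \<one>\<^sub>C)"
proof -
  note [simp] = in_HomD[OF \<delta>]
  have id1: "idA \<in> Hom C A (\<one>\<^sub>C \<otimes>\<^sub>O A)" by (simp add: C.tarr in_Hom_iff)
  have \<Delta>_in: "\<Delta> \<in> Hom C A (A \<otimes>\<^sub>O A)" unfolding \<Delta> by (simp add: C.tarr in_Hom_iff cong: typing_cong)
  have "pairing A idA \<delta> = \<Theta> (A \<rhd>\<^sub>O m) (free_map A \<delta> \<cdot>\<^sub>M free_map \<one>\<^sub>C idA)"
    unfolding pairing_def
    by (rule trace_symmetric[OF free_map_in[OF \<delta> inner_in] free_map_in[OF id1 C.unit_obj_in]])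
  also have "free_map A \<delta> \<cdot>\<^sub>M free_map \<one>\<^sub>C idA = free_map A \<Delta>"
    using free_map_comp[OF id1 \<delta> inner_in] by (simp add: \<Delta> C.tarr cong: typing_cong)
  also have "\<Theta> (A \<rhd>\<^sub>O m) (free_map A \<Delta>) = C.trace A idA"
    using trace_free_map_counit[OF \<Delta>_in inner_in] cu by simp
  finally have "pairing A idA \<delta> = C.trace A idA" .
  moreover have "(counit \<cdot>\<^sub>C \<mu>) \<cdot>\<^sub>C ((idA \<otimes>\<^sub>C idA) \<cdot>\<^sub>C \<delta>) = (counit \<cdot>\<^sub>C \<mu>) \<cdot>\<^sub>C \<delta>"
    by (simp add: C.tarr cong: typing_cong)
  ultimately show ?thesis using counit_pairing[OF C.ident_in[OF inner_in] \<delta>] by simp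
qed

text \<open>All endomorphisms of \<open>n\<close> are scalars, so if the identity had trace zero, it would pair to zero with
  everything.\<close>

lemma trace_ident_nonzero:
  assumes "simple M n"
  shows "\<Theta> n (idM n) \<noteq> 0"
proof
  assume 0: "\<Theta> n (idM n) = 0"
  note n = M.simple_obj[OF assms]
  have "idM n = Zero M n n"
  proof (rule trace_nondegenerate_left[OF n(2)])
    fix g assume g: "g \<in> Hom M n n"
    have "\<Theta> n g = eigenvalue M n g * \<Theta> n (idM n)"
      using linear_map_smult[OF trace_linear[OF n(1)], of "idM n"] n(2) M.eigenvalue[OF assms g]
      by (metis complex_module_simps(4) hom_module_simps(1,4))
    thus "\<Theta> n (g \<cdot>\<^sub>M idM n) = 0" using 0 M.comp_ident_right[OF g] by simp
  qed
  thus False using n(3) by simp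
qed

end

section \<open>Simple objects: special and symmetric\<close>

locale simple_internal_endomorphisms = traced_internal_endomorphisms C M m A \<alpha> \<Theta>
  for C :: "('o, 'a, 'x) pivotal_cat_scheme" and M :: "('o, 'a, 'p, 'b, 'y) mod_cat_scheme"
    and m :: 'p and A :: 'o and \<alpha> :: "'o \<Rightarrow> 'b \<Rightarrow> 'a" and \<Theta> :: "'p \<Rightarrow> 'b \<Rightarrow> complex" +
  assumes simple_source: "simple M m"
begin

definition t where "t = \<Theta> m (idM m)"

lemma t_nonzero: "t \<noteq> 0"
  unfolding t_def by (rule trace_ident_nonzero[OF simple_source])

lemma unit_trace_unit: "unit_trace \<eta> = t"
  unfolding unit_trace_def t_def using evA_unit(2) uniM_inv(2)[OF source_in] by simp

lemma counit_unit: "counit \<cdot>\<^sub>C \<eta> = Scale C t (idC \<one>\<^sub>C)"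
  using counit_comp[OF evA_unit(1)] unit_trace_unit by simp

text \<open>States of \<open>A\<close> are endomorphisms of the simple object \<open>m\<close>, hence multiples of \<open>\<eta>\<close>, and \<open>t\<close> is the
  value of the functional \<open>unit_trace\<close> on \<open>\<eta>\<close>.\<close>

lemma unit_multiple:
  assumes q: "q \<in> Hom C \<one>\<^sub>C A"
  shows "q = Scale C (unit_trace q / t) \<eta>"
proof -
  note [simp] = in_HomD[OF q]
  have u: "inv_arr M (uniM m) \<in> Hom M m (\<one>\<^sub>C \<rhd>\<^sub>O m)" by (simp add: marr in_Hom_iff)
  have F: "evA \<cdot>\<^sub>M (q \<rhd> idM m) \<in> Hom M (\<one>\<^sub>C \<rhd>\<^sub>O m) m" by (rule evA_act_in[OF q])
  define G where "G = evA \<cdot>\<^sub>M (q \<rhd> idM m) \<cdot>\<^sub>M inv_arr M (uniM m)"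
  have G: "G \<in> Hom M m m" unfolding G_def by (rule M.comp_in[OF u F])
  define z where "z = eigenvalue M m G"
  have z: "G = Scale M z (idM m)" unfolding z_def by (rule M.eigenvalue[OF simple_source G])
  have act_z: "Scale C z \<eta> \<rhd> idM m = Scale M z (\<eta> \<rhd> idM m)"
    using linear_map_smult[OF actM_linear_left[OF M.ident_in[OF source_in] C.unit_obj_in inner_in], of \<eta> z]
      evA_unit(1) by simp
  have "evA \<cdot>\<^sub>M (q \<rhd> idM m) = G \<cdot>\<^sub>M uniM m"
    unfolding G_def by (simp add: marr uniM_inv cong: typing_cong)
  also have "\<dots> = Scale M z (uniM m)"
    unfolding z by (simp add: marr M.comp_scale)
  also have "\<dots> = Scale M z (evA \<cdot>\<^sub>M (\<eta> \<rhd> idM m))" unfolding evA_unit(2) ..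
  also have "\<dots> = evA \<cdot>\<^sub>M (Scale C z \<eta> \<rhd> idM m)"
    unfolding act_z by (simp add: marr M.comp_scale)
  finally have q_eq: "q = Scale C z \<eta>"
    using evA_cancel[OF q] C.Hom_module_laws(1)[OF evA_unit(1)] by blast
  have "unit_trace q = z * t"
    unfolding q_eq
    using linear_map_smult[OF linear_unit_trace, of \<eta> z] evA_unit(1) unit_trace_unit by simp
  thus ?thesis using q_eq t_nonzero by simp
qed

lemma internal_haploid: "haploid C A"
proof -
  have "bij_betw unit_trace (Hom C \<one>\<^sub>C A) UNIV"
  proof (rule bij_betwI')
    fix q q' assume q: "q \<in> Hom C \<one>\<^sub>C A" "q' \<in> Hom C \<one>\<^sub>C A"
    show "(unit_trace q = unit_trace q') = (q = q')"
      using unit_multiple[OF q(1)] unit_multiple[OF q(2)] by metis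
  next
    fix z :: complex
    show "\<exists>q\<in>Hom C \<one>\<^sub>C A. z = unit_trace q"
      using linear_map_smult[OF linear_unit_trace, of \<eta> "z / t"] evA_unit(1) unit_trace_unit t_nonzero
        C.Hom_module_laws(1)[OF evA_unit(1), of "z / t"]
      by (intro bexI[of _ "Scale C (z / t) \<eta>"]) simp_all
  qed simp
  thus ?thesis
    unfolding haploid_def linear_iso_def using linear_unit_trace by auto
qed

subsection \<open>The left trace of the fusion category\<close>

text \<open>Up to the factor \<open>t \<noteq> 0\<close>, the left trace of \<open>f : c \<rightarrow> c\<close> is the module trace of \<open>f \<triangleright> m\<close>. This is
  why it is cyclic and multiplicative.\<close>

lemma module_trace_act:
  assumes f: "f \<in> Hom C c c"
  shows "\<Theta> (c \<rhd>\<^sub>O m) (f \<rhd> idM m) = t * C.trace c f"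
proof -
  have c [simp]: "c \<in> Obj C" using C.Hom_obj[OF f] by simp
  note [simp] = in_HomD[OF f]
  have in1: "f \<otimes>\<^sub>C \<eta> \<in> Hom C c (c \<otimes>\<^sub>O A)" by (simp add: C.tarr in_Hom_iff)
  have "f \<otimes>\<^sub>C \<eta> = (idC c \<otimes>\<^sub>C \<eta>) \<cdot>\<^sub>C f" using C.exchange(2)[of f \<eta>] by (simp add: C.tarr)
  hence "(idC c \<otimes>\<^sub>C counit) \<cdot>\<^sub>C (f \<otimes>\<^sub>C \<eta>) = (idC c \<otimes>\<^sub>C (counit \<cdot>\<^sub>C \<eta>)) \<cdot>\<^sub>C f"
    by (simp add: C.layers cong: typing_cong)
  also have "idC c \<otimes>\<^sub>C (counit \<cdot>\<^sub>C \<eta>) = Scale C t (idC c)"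
    unfolding counit_unit
    using linear_map_smult[OF C.tensM_linear_right[OF C.ident_in[OF c] C.unit_obj_in C.unit_obj_in], of "idC \<one>\<^sub>C" t]
    by (simp add: C.ident_in C.unit_obj_in C.tarr)
  also have "Scale C t (idC c) \<cdot>\<^sub>C f = Scale C t f"
    by (simp add: C.comp_scale C.arr)
  finally have "(idC c \<otimes>\<^sub>C counit) \<cdot>\<^sub>C (f \<otimes>\<^sub>C \<eta>) = Scale C t f" .
  thus ?thesis
    using trace_free_map_counit[OF in1 c] free_map_unit[OF f]
      linear_map_smult[OF C.linear_trace[OF c], of f t] f by simp
qed

lemma trace_cyclic:
  assumes f: "f \<in> Hom C c d" and g: "g \<in> Hom C d c"
  shows "C.trace c (g \<cdot>\<^sub>C f) = C.trace d (f \<cdot>\<^sub>C g)"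
proof -
  note [simp] = in_HomD[OF f] in_HomD[OF g] C.Hom_obj[OF f]
  have in1: "f \<rhd> idM m \<in> Hom M (c \<rhd>\<^sub>O m) (d \<rhd>\<^sub>O m)" "g \<rhd> idM m \<in> Hom M (d \<rhd>\<^sub>O m) (c \<rhd>\<^sub>O m)"
    by (simp_all add: marr in_Hom_iff)
  have "t * C.trace c (g \<cdot>\<^sub>C f) = t * C.trace d (f \<cdot>\<^sub>C g)"
    using trace_symmetric[OF in1] module_trace_act[OF C.comp_in[OF f g]]
      module_trace_act[OF C.comp_in[OF g f]]
    by (simp add: whisker_act)
  thus ?thesis using t_nonzero by simp
qed

lemma trace_tensor:
  assumes "f \<in> Hom C (c \<otimes>\<^sub>O d) (c \<otimes>\<^sub>O d)" "c \<in> Obj C" "d \<in> Obj C"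
  shows "C.trace (c \<otimes>\<^sub>O d) f = C.trace d (C.left_ptr c d d f)"
proof -
  have "t * C.trace (c \<otimes>\<^sub>O d) f = t * C.trace d (C.left_ptr c d d f)"
    using trace_act[OF assms] module_trace_act[OF assms(1)]
      module_trace_act[OF C.left_ptr_in[OF assms(1-3) assms(3)]] by simp
  thus ?thesis using t_nonzero by simp
qed

lemma trace_unit_obj: "C.trace \<one>\<^sub>C (idC \<one>\<^sub>C) = 1"
proof -
  have in1: "inv_arr M (uniM m) \<in> Hom M m (\<one>\<^sub>C \<rhd>\<^sub>O m)" "uniM m \<in> Hom M (\<one>\<^sub>C \<rhd>\<^sub>O m) m"
    by (simp_all add: marr in_Hom_iff)
  have "\<Theta> m (uniM m \<cdot>\<^sub>M inv_arr M (uniM m)) = \<Theta> (\<one>\<^sub>C \<rhd>\<^sub>O m) (inv_arr M (uniM m) \<cdot>\<^sub>M uniM m)"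
    by (rule trace_symmetric[OF in1])
  hence "t = \<Theta> (\<one>\<^sub>C \<rhd>\<^sub>O m) (idC \<one>\<^sub>C \<rhd> idM m)"
    by (simp add: uniM_inv t_def actM_ident C.unit_obj_in)
  hence "t * C.trace \<one>\<^sub>C (idC \<one>\<^sub>C) = t * 1"
    using module_trace_act[OF C.ident_in[OF C.unit_obj_in]] by simp
  thus ?thesis using t_nonzero by simp
qed

text \<open>An endomorphism of the free module \<open>c \<otimes> A\<close> is given by \<open>g : c \<rightarrow> c \<otimes> A\<close>. Tracing out \<open>c\<close> first
  leaves a multiple of \<open>id\<^sub>A\<close>, because \<open>A\<close> is haploid.\<close>

lemma trace_free_module:
  assumes g: "g \<in> Hom C c (c \<otimes>\<^sub>O A)" and c: "c \<in> Obj C"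
  shows "C.trace (c \<otimes>\<^sub>O A) ((idC c \<otimes>\<^sub>C \<mu>) \<cdot>\<^sub>C (g \<otimes>\<^sub>C idA))
    = \<Theta> (c \<rhd>\<^sub>O m) (free_map c g) / t * C.trace A idA"
proof -
  note [simp] = c in_HomD[OF g] C.dual_arr[OF c]
  define G where "G = (idC c \<otimes>\<^sub>C \<mu>) \<cdot>\<^sub>C (g \<otimes>\<^sub>C idA)"
  have G: "G \<in> Hom C (c \<otimes>\<^sub>O A) (c \<otimes>\<^sub>O A)"
    unfolding G_def by (simp add: C.tarr in_Hom_iff cong: typing_cong)
  have g1: "g \<in> Hom C (c \<otimes>\<^sub>O \<one>\<^sub>C) (c \<otimes>\<^sub>O A)" using g by (simp add: C.tarr)
  define q where "q = C.left_ptr c \<one>\<^sub>C A g"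
  have q: "q \<in> Hom C \<one>\<^sub>C A"
    unfolding q_def by (rule C.left_ptr_in[OF g1]) (simp_all add: C.unit_obj_in)
  define z where "z = unit_trace q / t"
  have z: "q = Scale C z \<eta>" unfolding z_def by (rule unit_multiple[OF q])
  have s: "\<mu> \<cdot>\<^sub>C (ev C c \<otimes>\<^sub>C idC (A \<otimes>\<^sub>O A)) = (ev C c \<otimes>\<^sub>C idA) \<cdot>\<^sub>C (idC (rdual C c \<otimes>\<^sub>O c) \<otimes>\<^sub>C \<mu>)"
    using C.slide[OF C.rdual_props(2)[OF c] evA_mult(1)] by (simp add: C.tarr)
  have "C.left_ptr c A A G = \<mu> \<cdot>\<^sub>C (q \<otimes>\<^sub>C idA)"
    unfolding C.left_ptr_alt[OF G c inner_in inner_in] q_def C.left_ptr_alt[OF g1 c C.unit_obj_in inner_in]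
    unfolding G_def
    by (simp add: C.layers s[THEN C.comp_eq_assoc] cong: typing_cong)
  also have "q \<otimes>\<^sub>C idA = Scale C z (\<eta> \<otimes>\<^sub>C idA)"
    unfolding z
    using linear_map_smult[OF C.tensM_linear_left[OF C.ident_in[OF inner_in] C.unit_obj_in inner_in], of \<eta> z]
      evA_unit(1) by simp
  also have "\<mu> \<cdot>\<^sub>C Scale C z (\<eta> \<otimes>\<^sub>C idA) = Scale C z idA"
    using C.comp_scale(2)[of "\<eta> \<otimes>\<^sub>C idA" \<mu> z] internal_algebra
    by (simp add: C.tarr algebra_in_def)
  finally have "C.left_ptr c A A G = Scale C z idA" .
  hence "C.trace (c \<otimes>\<^sub>O A) G = z * C.trace A idA"
    using trace_tensor[OF G c inner_in] linear_map_smult[OF C.linear_trace[OF inner_in], of idA z]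
      C.ident_in by simp
  moreover have "\<Theta> (c \<rhd>\<^sub>O m) (free_map c g) / t = z"
    unfolding trace_free_map[OF g c] z_def q_def ..
  ultimately show ?thesis unfolding G_def by simp
qed

subsection \<open>Speciality and symmetry from nonzero dimension\<close>

text \<open>The endomorphism \<open>\<mu> \<Delta>\<close> of \<open>A\<close> is right \<open>A\<close>-linear, hence a multiple \<open>\<beta>\<close> of the identity; applying
  \<open>\<epsilon>\<close> and \<open>\<eta>\<close> gives \<open>\<beta> t = dim A\<close>.\<close>

lemma special_if_dimension_nonzero:
  assumes F: "frobenius_algebra C A \<mu> \<eta> \<Delta> counit" and \<delta>: "\<Delta> \<cdot>\<^sub>C \<eta> = \<delta>"
    and \<Delta>_eq: "\<Delta> = (idA \<otimes>\<^sub>C \<mu>) \<cdot>\<^sub>C (\<delta> \<otimes>\<^sub>C idA)" and D: "C.trace A idA \<noteq> 0"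
  shows "special C A \<mu> \<eta> \<Delta> counit"
proof -
  have \<Delta>: "\<Delta> \<in> Hom C A (A \<otimes>\<^sub>O A)" and cu: "(idA \<otimes>\<^sub>C counit) \<cdot>\<^sub>C \<Delta> = idA"
    and assoc: "\<mu> \<cdot>\<^sub>C (\<mu> \<otimes>\<^sub>C idA) = \<mu> \<cdot>\<^sub>C (idA \<otimes>\<^sub>C \<mu>)" and unit: "\<mu> \<cdot>\<^sub>C (\<eta> \<otimes>\<^sub>C idA) = idA"
    using F unfolding frobenius_algebra_def algebra_in_def coalgebra_in_def by auto
  note [simp] = in_HomD[OF \<Delta>]
  have \<delta>_in: "\<delta> \<in> Hom C \<one>\<^sub>C (A \<otimes>\<^sub>O A)" unfolding \<delta>[symmetric] by (simp add: C.tarr in_Hom_iff)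
  note [simp] = in_HomD[OF \<delta>_in]
  have q: "\<mu> \<cdot>\<^sub>C \<delta> \<in> Hom C \<one>\<^sub>C A" by (simp add: C.tarr in_Hom_iff)
  define \<beta> where "\<beta> = unit_trace (\<mu> \<cdot>\<^sub>C \<delta>) / t"
  have \<beta>: "\<mu> \<cdot>\<^sub>C \<delta> = Scale C \<beta> \<eta>" unfolding \<beta>_def by (rule unit_multiple[OF q])
  have "\<mu> \<cdot>\<^sub>C \<Delta> = \<mu> \<cdot>\<^sub>C (idA \<otimes>\<^sub>C \<mu>) \<cdot>\<^sub>C (\<delta> \<otimes>\<^sub>C idA)"
    unfolding \<Delta>_eq by (simp add: C.tarr C.comp_assoc_arr cong: typing_cong)
  also have "\<dots> = \<mu> \<cdot>\<^sub>C ((\<mu> \<cdot>\<^sub>C \<delta>) \<otimes>\<^sub>C idA)"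
    unfolding assoc[symmetric] by (simp add: C.layers cong: typing_cong)
  also have "(\<mu> \<cdot>\<^sub>C \<delta>) \<otimes>\<^sub>C idA = Scale C \<beta> (\<eta> \<otimes>\<^sub>C idA)"
    unfolding \<beta>
    using linear_map_smult[OF C.tensM_linear_left[OF C.ident_in[OF inner_in] C.unit_obj_in inner_in], of \<eta> \<beta>]
      evA_unit(1) by simp
  also have "\<mu> \<cdot>\<^sub>C Scale C \<beta> (\<eta> \<otimes>\<^sub>C idA) = Scale C \<beta> idA"
    using C.comp_scale(2)[of "\<eta> \<otimes>\<^sub>C idA" \<mu> \<beta>] unit by (simp add: C.tarr)
  finally have \<mu>\<Delta>: "\<mu> \<cdot>\<^sub>C \<Delta> = Scale C \<beta> idA" .
  have "Scale C (C.trace A idA) (idC \<one>\<^sub>C) = counit \<cdot>\<^sub>C (\<mu> \<cdot>\<^sub>C \<delta>)"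
    using counit_mult_copairing[OF \<delta>_in \<Delta>_eq cu] by (simp add: C.tarr C.comp_assoc_arr)
  also have "\<dots> = Scale C (\<beta> * t) (idC \<one>\<^sub>C)"
    unfolding \<beta> using C.comp_scale(2)[of \<eta> counit \<beta>] counit_unit
      C.Hom_module_laws(5)[OF C.ident_in[OF C.unit_obj_in]] by simp
  finally have "C.trace A idA = \<beta> * t"
    using C.Scale_ident_eq C.simple_obj[OF C.simple_unit] by blast
  hence "\<beta> \<noteq> 0" using D by auto
  thus ?thesis
    unfolding special_def using t_nonzero counit_unit \<mu>\<Delta> by blast
qed

text \<open>By a zigzag, \<open>f\<close> can be recovered from its form.\<close>

lemma form_determines:
  assumes f: "f \<in> Hom C x (rdual C A)" and f': "f' \<in> Hom C x (rdual C A)"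
    and eq: "ev C A \<cdot>\<^sub>C (f \<otimes>\<^sub>C idA) = ev C A \<cdot>\<^sub>C (f' \<otimes>\<^sub>C idA)"
  shows "f = f'"
proof -
  define y where "y = rdual C A"
  note D = C.dual_arr[OF inner_in]
  note [simp] = D[folded y_def]
  have zig: "(ev C A \<otimes>\<^sub>C idC y) \<cdot>\<^sub>C (idC y \<otimes>\<^sub>C coev C A) = idC y"
    using C.right_dual[OF inner_in] unfolding dual_pair_def y_def by auto
  have x [simp]: "x \<in> Obj C" using C.Hom_obj[OF f] by simp
  have main: "((ev C A \<cdot>\<^sub>C (h \<otimes>\<^sub>C idA)) \<otimes>\<^sub>C idC y) \<cdot>\<^sub>C (idC x \<otimes>\<^sub>C coev C A) = h" if h: "h \<in> Hom C x y" for h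
  proof -
    note [simp] = in_HomD[OF h]
    have coev: "coev C A \<in> Hom C \<one>\<^sub>C (A \<otimes>\<^sub>O y)" by (simp add: in_Hom_iff)
    have "((ev C A \<cdot>\<^sub>C (h \<otimes>\<^sub>C idA)) \<otimes>\<^sub>C idC y) \<cdot>\<^sub>C (idC x \<otimes>\<^sub>C coev C A)
        = (ev C A \<otimes>\<^sub>C idC y) \<cdot>\<^sub>C ((h \<otimes>\<^sub>C idC (A \<otimes>\<^sub>O y)) \<cdot>\<^sub>C (idC x \<otimes>\<^sub>C coev C A))"
      by (simp add: C.layers cong: typing_cong)
    also have "\<dots> = ((ev C A \<otimes>\<^sub>C idC y) \<cdot>\<^sub>C (idC y \<otimes>\<^sub>C coev C A)) \<cdot>\<^sub>C h"
      unfolding C.slide_state(2)[OF h coev, symmetric] by (simp add: C.layers cong: typing_cong)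
    finally show ?thesis unfolding zig by (simp add: C.arr)
  qed
  have "f = ((ev C A \<cdot>\<^sub>C (f \<otimes>\<^sub>C idA)) \<otimes>\<^sub>C idC y) \<cdot>\<^sub>C (idC x \<otimes>\<^sub>C coev C A)"
    by (rule main[OF f[folded y_def], symmetric])
  also have "\<dots> = f'" unfolding eq by (rule main[OF f'[folded y_def]])
  finally show ?thesis .
qed

text \<open>The form \<open>\<epsilon>' \<mu>\<close> of the left trace of right multiplication, \<open>\<epsilon>'(b) = tr(a \<mapsto> a b)\<close>, is symmetric
  because the left trace is cyclic and multiplicative. As \<open>A\<close> is haploid, \<open>\<epsilon>'\<close> is proportional to
  \<open>\<epsilon>\<close>: evaluated on \<open>\<eta>\<close>, they are \<open>dim A\<close> and \<open>t\<close>.\<close>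

lemma symmetric_if_dimension_nonzero:
  assumes D: "C.trace A idA \<noteq> 0"
  shows "symmetric_form C A \<mu> counit"
proof -
  define D where "D = C.trace A idA"
  define y l p where "y = rdual C A" and "l = ldual C A" and "p = piv_ldual C A"
  note [simp] = C.dual_arr[OF inner_in, folded y_def l_def p_def]
  have assoc: "\<mu> \<cdot>\<^sub>C (\<mu> \<otimes>\<^sub>C idA) = \<mu> \<cdot>\<^sub>C (idA \<otimes>\<^sub>C \<mu>)" and unit: "\<mu> \<cdot>\<^sub>C (idA \<otimes>\<^sub>C \<eta>) = idA"
    using internal_algebra unfolding algebra_in_def by auto
  let ?B = "A \<otimes>\<^sub>O A"
  have B [simp]: "?B \<in> Obj C" by (simp add: C.tarr)
  define \<kappa> where "\<kappa> = counit \<cdot>\<^sub>C \<mu>"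
  have \<kappa>: "\<kappa> \<in> Hom C ?B \<one>\<^sub>C" unfolding \<kappa>_def by (simp add: C.tarr in_Hom_iff)
  note [simp] = in_HomD[OF \<kappa>]
  define q where "q = (p \<otimes>\<^sub>C idA) \<cdot>\<^sub>C lcoev C A"
  have q: "q \<in> Hom C \<one>\<^sub>C (y \<otimes>\<^sub>O A)" unfolding q_def by (simp add: C.tarr in_Hom_iff cong: typing_cong)
  note [simp] = in_HomD[OF q]
  have \<mu>1: "\<mu> \<in> Hom C (A \<otimes>\<^sub>O A) (A \<otimes>\<^sub>O \<one>\<^sub>C)" by (simp add: C.tarr in_Hom_iff)
  define \<epsilon>' where "\<epsilon>' = C.left_ptr A A \<one>\<^sub>C \<mu>"
  have \<epsilon>': "\<epsilon>' \<in> Hom C A \<one>\<^sub>C" unfolding \<epsilon>'_def by (rule C.left_ptr_in[OF \<mu>1]) (simp_all add: C.tarr)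
  note [simp] = in_HomD[OF \<epsilon>']
  have \<epsilon>'_eq: "\<epsilon>' = ev C A \<cdot>\<^sub>C ((idC y \<otimes>\<^sub>C \<mu>) \<cdot>\<^sub>C (q \<otimes>\<^sub>C idA))"
    unfolding \<epsilon>'_def C.left_ptr_alt[OF \<mu>1 inner_in inner_in C.unit_obj_in, folded y_def p_def, folded q_def]
    by (simp add: C.layers cong: typing_cong)
  have tr_eq: "left_trace C A f = ev C A \<cdot>\<^sub>C ((idC y \<otimes>\<^sub>C f) \<cdot>\<^sub>C q)" if "f \<in> Hom C A A" for f
  proof -
    have "f \<in> Hom C (A \<otimes>\<^sub>O \<one>\<^sub>C) (A \<otimes>\<^sub>O \<one>\<^sub>C)" using that by (simp add: C.tarr)
    from C.left_ptr_alt[OF this inner_in C.unit_obj_in C.unit_obj_in, folded y_def p_def, folded q_def]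
      C.left_trace_ptr[OF that]
    show ?thesis
      using in_HomD[OF that] by (simp add: C.layers cong: typing_cong)
  qed
  have \<epsilon>'_comp: "\<epsilon>' \<cdot>\<^sub>C b = left_trace C A (\<mu> \<cdot>\<^sub>C (idA \<otimes>\<^sub>C b))" if b: "b \<in> Hom C \<one>\<^sub>C A" for b
  proof -
    note [simp] = in_HomD[OF b]
    have "\<mu> \<cdot>\<^sub>C (idA \<otimes>\<^sub>C b) \<in> Hom C A A" by (simp add: C.tarr in_Hom_iff cong: typing_cong)
    hence "left_trace C A (\<mu> \<cdot>\<^sub>C (idA \<otimes>\<^sub>C b)) = ev C A \<cdot>\<^sub>C ((idC y \<otimes>\<^sub>C \<mu>) \<cdot>\<^sub>C ((idC (y \<otimes>\<^sub>O A) \<otimes>\<^sub>C b) \<cdot>\<^sub>C (q \<otimes>\<^sub>C idC \<one>\<^sub>C)))"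
      by (subst tr_eq) (simp_all add: C.layers cong: typing_cong)
    also have "(idC (y \<otimes>\<^sub>O A) \<otimes>\<^sub>C b) \<cdot>\<^sub>C (q \<otimes>\<^sub>C idC \<one>\<^sub>C) = (q \<otimes>\<^sub>C idA) \<cdot>\<^sub>C b"
      by (rule C.slide_state(1)[OF b q, symmetric])
    finally show ?thesis unfolding \<epsilon>'_eq by (simp add: C.layers cong: typing_cong)
  qed
  have left_trace_trace: "left_trace C A f = Scale C (C.trace A f) (idC \<one>\<^sub>C)" if "f \<in> Hom C A A" for f
    unfolding C.trace_def using C.eigenvalue[OF C.simple_unit C.left_trace_in[OF that]] .
  have proportional: "Scale C D counit = Scale C t \<epsilon>'"
  proof (rule C.eq_if_agree_on_simple[OF C.simple_unit])
    show "Scale C D counit \<in> Hom C A \<one>\<^sub>C" "Scale C t \<epsilon>' \<in> Hom C A \<one>\<^sub>C"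
      using C.Hom_module_laws(1) counit_in \<epsilon>' by auto
    fix b assume b: "b \<in> Hom C \<one>\<^sub>C A"
    define z where "z = unit_trace b / t"
    have z: "b = Scale C z \<eta>" unfolding z_def by (rule unit_multiple[OF b])
    have "\<epsilon>' \<cdot>\<^sub>C \<eta> = Scale C D (idC \<one>\<^sub>C)"
      using \<epsilon>'_comp[OF evA_unit(1)] unit left_trace_trace[OF C.ident_in[OF inner_in]] D_def by simp
    thus "Scale C D counit \<cdot>\<^sub>C b = Scale C t \<epsilon>' \<cdot>\<^sub>C b"
      unfolding z using counit_unit C.Hom_module_laws(5)[OF C.ident_in[OF C.unit_obj_in]]
      by (simp add: C.comp_scale C.scale_arr mult_ac)
  qed
  \<comment> \<open>The right hand side is the form \<open>\<kappa>\<close> with its second leg moved round to the front. On a state \<open>g\<close>,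
    its value is the left trace of \<open>R counit\<close>, and so is the value of \<open>\<kappa>\<close>: that is, up to the factor
    \<open>t / D\<close>, the trace of right multiplication by \<open>\<mu> g\<close>, which is the composite of \<open>f1\<close> and \<open>\<mu>\<close>; by
    cyclicity it may be computed on \<open>A \<otimes> A\<close>, where tracing out the first factor leaves \<open>R \<epsilon>'\<close>.\<close>
  have rot: "\<kappa> = ev C A \<cdot>\<^sub>C ((p \<otimes>\<^sub>C idA) \<cdot>\<^sub>C ((idC l \<otimes>\<^sub>C \<kappa> \<otimes>\<^sub>C idA) \<cdot>\<^sub>C (lcoev C A \<otimes>\<^sub>C idC ?B)))"
    (is "_ = ?rot")
  proof (rule C.eq_if_agree_on_simple[OF C.simple_unit \<kappa>])
    show "?rot \<in> Hom C ?B \<one>\<^sub>C" by (simp add: C.tarr in_Hom_iff cong: typing_cong)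
    fix g assume g: "g \<in> Hom C \<one>\<^sub>C ?B"
    note [simp] = in_HomD[OF g]
    define f1 where "f1 = (\<mu> \<otimes>\<^sub>C idA) \<cdot>\<^sub>C (idA \<otimes>\<^sub>C g)"
    have f1: "f1 \<in> Hom C A ?B" unfolding f1_def by (simp add: C.tarr in_Hom_iff cong: typing_cong)
    note [simp] = in_HomD[OF f1]
    have f12: "f1 \<cdot>\<^sub>C \<mu> \<in> Hom C ?B ?B" by (rule C.comp_in[OF evA_mult(1) f1])
    define R where "R \<epsilon> = ((\<epsilon> \<cdot>\<^sub>C \<mu>) \<otimes>\<^sub>C idA) \<cdot>\<^sub>C (idA \<otimes>\<^sub>C g)" for \<epsilon>
    have R_in: "R \<epsilon> \<in> Hom C A A" if "\<epsilon> \<in> Hom C A \<one>\<^sub>C" for \<epsilon>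
      unfolding R_def using in_HomD[OF that] by (simp add: C.tarr in_Hom_iff cong: typing_cong)
    have R_scale: "R (Scale C z \<epsilon>) = Scale C z (R \<epsilon>)" if \<epsilon>: "\<epsilon> \<in> Hom C A \<one>\<^sub>C" for z \<epsilon>
    proof -
      note [simp] = in_HomD[OF \<epsilon>]
      have "Scale C z \<epsilon> \<cdot>\<^sub>C \<mu> = Scale C z (\<epsilon> \<cdot>\<^sub>C \<mu>)" by (simp add: C.comp_scale)
      moreover have "Scale C z (\<epsilon> \<cdot>\<^sub>C \<mu>) \<otimes>\<^sub>C idA = Scale C z ((\<epsilon> \<cdot>\<^sub>C \<mu>) \<otimes>\<^sub>C idA)"
        using linear_map_smult[OF C.tensM_linear_left[OF C.ident_in[OF inner_in] B C.unit_obj_in], of "\<epsilon> \<cdot>\<^sub>C \<mu>" z]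
          C.comp_in[OF evA_mult(1) \<epsilon>] by simp
      ultimately show ?thesis unfolding R_def by (simp add: C.comp_scale C.tarr cong: typing_cong)
    qed
    have ptr: "C.left_ptr A A A (f1 \<cdot>\<^sub>C \<mu>) = R \<epsilon>'"
    proof -
      have s1: "(idA \<otimes>\<^sub>C g) \<cdot>\<^sub>C \<mu> = (\<mu> \<otimes>\<^sub>C idC ?B) \<cdot>\<^sub>C (idC ?B \<otimes>\<^sub>C g)"
        by (rule C.slide_state(2)[OF evA_mult(1) g])
      have s2: "(idC (y \<otimes>\<^sub>O A) \<otimes>\<^sub>C (idA \<otimes>\<^sub>C g)) \<cdot>\<^sub>C (q \<otimes>\<^sub>C idA) = (q \<otimes>\<^sub>C idC (A \<otimes>\<^sub>O ?B)) \<cdot>\<^sub>C (idA \<otimes>\<^sub>C g)"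
        by (rule C.slide_state(1)[OF _ q, symmetric]) (simp add: C.tarr in_Hom_iff)
      have s3: "(idC (y \<otimes>\<^sub>O A) \<otimes>\<^sub>C \<mu>) \<cdot>\<^sub>C (q \<otimes>\<^sub>C idC ?B) = (q \<otimes>\<^sub>C idA) \<cdot>\<^sub>C \<mu>"
        by (rule C.slide_state(1)[OF evA_mult(1) q, symmetric])
      have "f1 \<cdot>\<^sub>C \<mu> = ((\<mu> \<cdot>\<^sub>C (\<mu> \<otimes>\<^sub>C idA)) \<otimes>\<^sub>C idA) \<cdot>\<^sub>C (idC ?B \<otimes>\<^sub>C g)"
        unfolding f1_def by (simp add: C.layers s1 cong: typing_cong)
      also have "\<dots> = (\<mu> \<otimes>\<^sub>C idA) \<cdot>\<^sub>C ((idA \<otimes>\<^sub>C \<mu> \<otimes>\<^sub>C idA) \<cdot>\<^sub>C (idA \<otimes>\<^sub>C (idA \<otimes>\<^sub>C g)))"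
        unfolding assoc by (simp add: C.layers cong: typing_cong)
      finally have f12_eq: "f1 \<cdot>\<^sub>C \<mu> = (\<mu> \<otimes>\<^sub>C idA) \<cdot>\<^sub>C ((idA \<otimes>\<^sub>C \<mu> \<otimes>\<^sub>C idA) \<cdot>\<^sub>C (idA \<otimes>\<^sub>C (idA \<otimes>\<^sub>C g)))" .
      have "C.left_ptr A A A (f1 \<cdot>\<^sub>C \<mu>) = (ev C A \<otimes>\<^sub>C idA) \<cdot>\<^sub>C (idC y \<otimes>\<^sub>C (f1 \<cdot>\<^sub>C \<mu>)) \<cdot>\<^sub>C (q \<otimes>\<^sub>C idA)"
        by (rule C.left_ptr_alt[OF f12 inner_in inner_in inner_in, folded y_def p_def, folded q_def])
      also have "\<dots> = (ev C A \<otimes>\<^sub>C idA) \<cdot>\<^sub>C ((idC y \<otimes>\<^sub>C \<mu> \<otimes>\<^sub>C idA) \<cdot>\<^sub>C ((idC (y \<otimes>\<^sub>O A) \<otimes>\<^sub>C \<mu> \<otimes>\<^sub>C idA)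
          \<cdot>\<^sub>C ((idC (y \<otimes>\<^sub>O A) \<otimes>\<^sub>C (idA \<otimes>\<^sub>C g)) \<cdot>\<^sub>C (q \<otimes>\<^sub>C idA))))"
        unfolding f12_eq by (simp add: C.layers cong: typing_cong)
      also have "\<dots> = (ev C A \<otimes>\<^sub>C idA) \<cdot>\<^sub>C ((idC y \<otimes>\<^sub>C \<mu> \<otimes>\<^sub>C idA)
          \<cdot>\<^sub>C ((((idC (y \<otimes>\<^sub>O A) \<otimes>\<^sub>C \<mu>) \<cdot>\<^sub>C (q \<otimes>\<^sub>C idC ?B)) \<otimes>\<^sub>C idA) \<cdot>\<^sub>C (idA \<otimes>\<^sub>C g)))"
        unfolding s2 by (simp add: C.layers cong: typing_cong)
      also have "\<dots> = ((\<epsilon>' \<cdot>\<^sub>C \<mu>) \<otimes>\<^sub>C idA) \<cdot>\<^sub>C (idA \<otimes>\<^sub>C g)"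
        unfolding s3 \<epsilon>'_eq by (simp add: C.layers cong: typing_cong)
      finally show ?thesis unfolding R_def .
    qed
    have \<mu>g: "\<mu> \<cdot>\<^sub>C g \<in> Hom C \<one>\<^sub>C A" by (simp add: C.tarr in_Hom_iff)
    have "\<epsilon>' \<cdot>\<^sub>C (\<mu> \<cdot>\<^sub>C g) = left_trace C A (\<mu> \<cdot>\<^sub>C (idA \<otimes>\<^sub>C \<mu>) \<cdot>\<^sub>C (idA \<otimes>\<^sub>C g))"
      unfolding \<epsilon>'_comp[OF \<mu>g] by (simp add: C.layers cong: typing_cong)
    also have "\<mu> \<cdot>\<^sub>C (idA \<otimes>\<^sub>C \<mu>) \<cdot>\<^sub>C (idA \<otimes>\<^sub>C g) = \<mu> \<cdot>\<^sub>C f1"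
      unfolding assoc[symmetric] f1_def by (simp add: C.layers cong: typing_cong)
    also have "left_trace C A (\<mu> \<cdot>\<^sub>C f1) = Scale C (C.trace A (\<mu> \<cdot>\<^sub>C f1)) (idC \<one>\<^sub>C)"
      by (rule left_trace_trace[OF C.comp_in[OF f1 evA_mult(1)]])
    also have "C.trace A (\<mu> \<cdot>\<^sub>C f1) = C.trace A (R \<epsilon>')"
      using trace_cyclic[OF f1 evA_mult(1)] trace_tensor[OF f12 inner_in inner_in] ptr by simp
    finally have e1: "\<epsilon>' \<cdot>\<^sub>C (\<mu> \<cdot>\<^sub>C g) = Scale C (C.trace A (R \<epsilon>')) (idC \<one>\<^sub>C)" .
    note id1 = C.ident_in[OF C.unit_obj_in]
    have "Scale C D (\<kappa> \<cdot>\<^sub>C g) = Scale C D counit \<cdot>\<^sub>C (\<mu> \<cdot>\<^sub>C g)"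
      unfolding \<kappa>_def by (simp add: C.tarr C.comp_scale C.comp_assoc_arr)
    also have "\<dots> = Scale C (t * C.trace A (R \<epsilon>')) (idC \<one>\<^sub>C)"
      unfolding proportional using e1 C.Hom_module_laws(5)[OF id1] by (simp add: C.comp_scale C.tarr)
    also have "t * C.trace A (R \<epsilon>') = C.trace A (R (Scale C t \<epsilon>'))"
      using linear_map_smult[OF C.linear_trace[OF inner_in], of "R \<epsilon>'" t] R_in[OF \<epsilon>'] R_scale[OF \<epsilon>']
      by simp
    also have "\<dots> = D * C.trace A (R counit)"
      unfolding proportional[symmetric]
      using linear_map_smult[OF C.linear_trace[OF inner_in], of "R counit" D] R_in[OF counit_in]
        R_scale[OF counit_in] by simp
    also have "Scale C (D * C.trace A (R counit)) (idC \<one>\<^sub>C) = Scale C D (left_trace C A (R counit))"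
      using left_trace_trace[OF R_in[OF counit_in]] C.Hom_module_laws(5)[OF id1] by simp
    finally have "Scale C (1 / D) (Scale C D (\<kappa> \<cdot>\<^sub>C g)) = Scale C (1 / D) (Scale C D (left_trace C A (R counit)))"
      by simp
    hence "\<kappa> \<cdot>\<^sub>C g = left_trace C A (R counit)"
      using C.Hom_module_laws(3,5)[OF C.comp_in[OF g \<kappa>]]
        C.Hom_module_laws(3,5)[OF C.left_trace_in[OF R_in[OF counit_in]]] D
      by (simp add: D_def)
    also have "\<dots> = ?rot \<cdot>\<^sub>C g"
    proof -
      have lc: "lcoev C A \<in> Hom C \<one>\<^sub>C (l \<otimes>\<^sub>O A)" by (simp add: in_Hom_iff)
      have s: "(lcoev C A \<otimes>\<^sub>C idC ?B) \<cdot>\<^sub>C g = (idC (l \<otimes>\<^sub>O A) \<otimes>\<^sub>C g) \<cdot>\<^sub>C (lcoev C A \<otimes>\<^sub>C idC \<one>\<^sub>C)"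
        by (rule C.slide_state(1)[OF g lc])
      have Rc: "R counit = (\<kappa> \<otimes>\<^sub>C idA) \<cdot>\<^sub>C (idA \<otimes>\<^sub>C g)" unfolding R_def \<kappa>_def ..
      have s': "(idC y \<otimes>\<^sub>C R counit) \<cdot>\<^sub>C (p \<otimes>\<^sub>C idA) = (p \<otimes>\<^sub>C idA) \<cdot>\<^sub>C (idC l \<otimes>\<^sub>C R counit)"
        by (rule C.slide[symmetric]) (use R_in[OF counit_in] in \<open>simp_all add: in_Hom_iff\<close>)
      have "left_trace C A (R counit) = ev C A \<cdot>\<^sub>C (((idC y \<otimes>\<^sub>C R counit) \<cdot>\<^sub>C (p \<otimes>\<^sub>C idA)) \<cdot>\<^sub>C lcoev C A)"
        unfolding tr_eq[OF R_in[OF counit_in]] q_def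
        using in_HomD[OF R_in[OF counit_in]] by (simp add: C.tarr C.comp_assoc_arr cong: typing_cong)
      also have "\<dots> = ev C A \<cdot>\<^sub>C ((p \<otimes>\<^sub>C idA) \<cdot>\<^sub>C ((idC l \<otimes>\<^sub>C \<kappa> \<otimes>\<^sub>C idA) \<cdot>\<^sub>C ((idC (l \<otimes>\<^sub>O A) \<otimes>\<^sub>C g) \<cdot>\<^sub>C (lcoev C A \<otimes>\<^sub>C idC \<one>\<^sub>C))))"
        unfolding s' unfolding Rc by (simp add: C.layers cong: typing_cong)
      also have "\<dots> = ?rot \<cdot>\<^sub>C g"
        unfolding s[symmetric] by (simp add: C.tarr C.comp_assoc_arr cong: typing_cong)
      finally show ?thesis .
    qed
    finally show "\<kappa> \<cdot>\<^sub>C g = ?rot \<cdot>\<^sub>C g" .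
  qed
  have "(\<kappa> \<otimes>\<^sub>C idC y) \<cdot>\<^sub>C (idA \<otimes>\<^sub>C coev C A) = p \<cdot>\<^sub>C (idC l \<otimes>\<^sub>C \<kappa>) \<cdot>\<^sub>C (lcoev C A \<otimes>\<^sub>C idA)"
  proof (rule form_determines)
    show "(\<kappa> \<otimes>\<^sub>C idC y) \<cdot>\<^sub>C (idA \<otimes>\<^sub>C coev C A) \<in> Hom C A (rdual C A)"
      "p \<cdot>\<^sub>C (idC l \<otimes>\<^sub>C \<kappa>) \<cdot>\<^sub>C (lcoev C A \<otimes>\<^sub>C idA) \<in> Hom C A (rdual C A)"
      by (simp_all add: C.tarr in_Hom_iff y_def[symmetric] cong: typing_cong)
    have zig: "(idA \<otimes>\<^sub>C ev C A) \<cdot>\<^sub>C (coev C A \<otimes>\<^sub>C idA) = idA"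
      using C.right_dual[OF inner_in] unfolding dual_pair_def by auto
    have ev: "ev C A \<in> Hom C (y \<otimes>\<^sub>O A) \<one>\<^sub>C" by (simp add: in_Hom_iff)
    have s: "ev C A \<cdot>\<^sub>C (\<kappa> \<otimes>\<^sub>C idC (y \<otimes>\<^sub>O A)) = \<kappa> \<cdot>\<^sub>C (idC ?B \<otimes>\<^sub>C ev C A)"
      using C.slide[OF \<kappa> ev] by (simp add: C.tarr)
    have "ev C A \<cdot>\<^sub>C (((\<kappa> \<otimes>\<^sub>C idC y) \<cdot>\<^sub>C (idA \<otimes>\<^sub>C coev C A)) \<otimes>\<^sub>C idA)
        = (ev C A \<cdot>\<^sub>C (\<kappa> \<otimes>\<^sub>C idC (y \<otimes>\<^sub>O A))) \<cdot>\<^sub>C (idA \<otimes>\<^sub>C coev C A \<otimes>\<^sub>C idA)"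
      by (simp add: C.layers cong: typing_cong)
    also have "\<dots> = \<kappa> \<cdot>\<^sub>C (idA \<otimes>\<^sub>C ((idA \<otimes>\<^sub>C ev C A) \<cdot>\<^sub>C (coev C A \<otimes>\<^sub>C idA)))"
      unfolding s by (simp add: C.layers cong: typing_cong)
    also have "\<dots> = \<kappa>" unfolding zig by (simp add: C.tarr)
    also note rot
    also have "ev C A \<cdot>\<^sub>C ((p \<otimes>\<^sub>C idA) \<cdot>\<^sub>C ((idC l \<otimes>\<^sub>C \<kappa> \<otimes>\<^sub>C idA) \<cdot>\<^sub>C (lcoev C A \<otimes>\<^sub>C idC ?B))) = ev C A \<cdot>\<^sub>C ((p \<cdot>\<^sub>C (idC l \<otimes>\<^sub>C \<kappa>) \<cdot>\<^sub>C (lcoev C A \<otimes>\<^sub>C idA)) \<otimes>\<^sub>C idA)"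
      by (simp add: C.layers cong: typing_cong)
    finally show "ev C A \<cdot>\<^sub>C (((\<kappa> \<otimes>\<^sub>C idC y) \<cdot>\<^sub>C (idA \<otimes>\<^sub>C coev C A)) \<otimes>\<^sub>C idA)
        = ev C A \<cdot>\<^sub>C ((p \<cdot>\<^sub>C (idC l \<otimes>\<^sub>C \<kappa>) \<cdot>\<^sub>C (lcoev C A \<otimes>\<^sub>C idA)) \<otimes>\<^sub>C idA)" .
  qed
  thus ?thesis unfolding symmetric_form_def \<kappa>_def y_def l_def p_def .
qed

end

section \<open>Multiplicities\<close>

lemma linear_map_inv_into:
  assumes V: "module complex_ring V" and \<phi>: "linear_map V W \<phi>"
    and bij: "bij_betw \<phi> (carrier V) (carrier W)"
  shows "linear_map W V (inv_into (carrier V) \<phi>)"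
proof -
  interpret V: module complex_ring V by fact
  let ?\<psi> = "inv_into (carrier V) \<phi>"
  have \<psi>: "?\<psi> w \<in> carrier V" "\<phi> (?\<psi> w) = w" if "w \<in> carrier W" for w
    using bij that by (auto simp: bij_betw_def inv_into_into f_inv_into_f)
  have eq: "?\<psi> (\<phi> v) = v" if "v \<in> carrier V" for v
    using bij that by (simp add: bij_betw_def inv_into_f_f)
  show ?thesis
    unfolding linear_map_def
  proof (intro conjI ballI allI)
    fix u w assume u: "u \<in> carrier W" and w: "w \<in> carrier W"
    show "?\<psi> (u \<oplus>\<^bsub>W\<^esub> w) = ?\<psi> u \<oplus>\<^bsub>V\<^esub> ?\<psi> w"
      using linear_map_add[OF \<phi> \<psi>(1)[OF u] \<psi>(1)[OF w]] eq[of "?\<psi> u \<oplus>\<^bsub>V\<^esub> ?\<psi> w"] \<psi>[OF u] \<psi>[OF w] by simp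
  next
    fix z w assume w: "w \<in> carrier W"
    show "?\<psi> (z \<odot>\<^bsub>W\<^esub> w) = z \<odot>\<^bsub>V\<^esub> ?\<psi> w"
      using linear_map_smult[OF \<phi> \<psi>(1)[OF w], of z] eq[of "z \<odot>\<^bsub>V\<^esub> ?\<psi> w"] \<psi>[OF w] by simp
  qed (use \<psi> in auto)
qed

context semisimple_category
begin

lemma direct_sum_over_representatives:
  assumes S: "\<And>x. simple C x \<Longrightarrow> \<exists>d\<in>S. isomorphic C x d" and x: "x \<in> Obj C"
  shows "\<exists>n X \<iota> \<pi>. direct_sum C n X x \<iota> \<pi> \<and> (\<forall>k<n. X k \<in> S)"
proof -
  obtain n X \<iota> \<pi> where X: "\<forall>k<n. simple C (X k)" and ds: "direct_sum C n X x \<iota> \<pi>"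
    using semisimple[OF x] by blast
  note D = direct_sumD[OF ds]
  have "\<exists>d u w. k < n \<longrightarrow> d \<in> S \<and> u \<in> Hom C d (X k) \<and> w \<in> Hom C (X k) d \<and>
      w \<cdot> u = ident C d \<and> u \<cdot> w = ident C (X k)" for k
  proof (cases "k < n")
    case True
    then obtain d where "d \<in> S" "isomorphic C (X k) d" using S X by blast
    thus ?thesis using isomorphicE by metis
  qed simp
  then obtain d u w where *: "\<And>k. k < n \<longrightarrow> d k \<in> S \<and> u k \<in> Hom C (d k) (X k) \<and> w k \<in> Hom C (X k) (d k) \<and>
      w k \<cdot> u k = ident C (d k) \<and> u k \<cdot> w k = ident C (X k)" by metis
  hence duw: "d k \<in> S" "u k \<in> Hom C (d k) (X k)" "w k \<in> Hom C (X k) (d k)"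
      "w k \<cdot> u k = ident C (d k)" "u k \<cdot> w k = ident C (X k)" if "k < n" for k
    using that by auto
  have "direct_sum C n d x (\<lambda>k. \<iota> k \<cdot> u k) (\<lambda>k. w k \<cdot> \<pi> k)"
    unfolding direct_sum_def
  proof (intro conjI allI impI)
    fix k assume k: "k < n"
    show "d k \<in> Obj C" using Hom_obj duw(2)[OF k] by blast
    show "\<iota> k \<cdot> u k \<in> Hom C (d k) x" by (rule comp_in[OF duw(2)[OF k] D(3)[OF k]])
    show "w k \<cdot> \<pi> k \<in> Hom C x (d k)" by (rule comp_in[OF D(4)[OF k] duw(3)[OF k]])
  next
    fix j k assume j: "j < n" and k: "k < n"
    note [simp] = in_HomD[OF duw(2)[OF k]] in_HomD[OF duw(3)[OF j]] in_HomD[OF D(3)[OF k]]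
      in_HomD[OF D(4)[OF j]]
    have "w j \<cdot> \<pi> j \<cdot> (\<iota> k \<cdot> u k) = w j \<cdot> ((\<pi> j \<cdot> \<iota> k) \<cdot> u k)"
      by (simp add: arr comp_assoc_arr cong: typing_cong)
    also have "\<dots> = (if j = k then ident C (d k) else Zero C (d k) (d j))"
    proof (cases "j = k")
      case True
      thus ?thesis using D(5)[OF j k] duw[OF k] comp_ident_left[OF duw(2)[OF k]] by simp
    next
      case False
      have "\<pi> j \<cdot> \<iota> k \<cdot> u k = Zero C (d k) (X j)"
        using False D(5)[OF j k] comp_zero(1)[OF duw(2)[OF k] D(2)[OF j]] by simp
      thus ?thesis using False comp_zero(2)[OF duw(3)[OF j]] Hom_obj(1)[OF duw(2)[OF k]] by simp
    qed
    finally show "w j \<cdot> \<pi> j \<cdot> (\<iota> k \<cdot> u k) = (if j = k then ident C (d k) else Zero C (d k) (d j))" .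
  next
    interpret V: module complex_ring "hom_module C x x" by (rule module_Hom[OF x x])
    have "\<iota> k \<cdot> u k \<cdot> (w k \<cdot> \<pi> k) = \<iota> k \<cdot> \<pi> k" if k: "k < n" for k
    proof -
      note [simp] = in_HomD[OF duw(2)[OF k]] in_HomD[OF duw(3)[OF k]] in_HomD[OF D(3)[OF k]]
        in_HomD[OF D(4)[OF k]]
      show ?thesis
        using comp_eq_assoc[OF duw(5)[OF k], of "\<pi> k"] by (simp add: arr comp_assoc_arr cong: typing_cong)
    qed
    moreover have "\<iota> k \<cdot> \<pi> k \<in> Hom C x x" if "k < n" for k using comp_in[OF D(4) D(3)] that by blast
    ultimately have "finsum (hom_module C x x) (\<lambda>k. \<iota> k \<cdot> u k \<cdot> (w k \<cdot> \<pi> k)) {..<n}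
        = finsum (hom_module C x x) (\<lambda>k. \<iota> k \<cdot> \<pi> k) {..<n}"
      by (intro V.finsum_cong') auto
    thus "finsum (hom_module C x x) (\<lambda>k. \<iota> k \<cdot> u k \<cdot> (w k \<cdot> \<pi> k)) {..<n} = ident C x"
      using D(6) by simp
  qed (rule x)
  thus ?thesis using duw(1) by blast
qed

end

text \<open>The given finite set may contain isomorphic objects or objects that are not simple. Both
  defects disappear when every isomorphism class that contains a simple object is represented by one
  that is chosen by a predicate depending only on the class.\<close>

lemma (in fusion_category) simple_representatives:
  obtains S where "finite S" "\<And>d. d \<in> S \<Longrightarrow> simple C d"
    "\<And>d d'. d \<in> S \<Longrightarrow> d' \<in> S \<Longrightarrow> isomorphic C d d' \<Longrightarrow> d = d'"
    "\<And>x. simple C x \<Longrightarrow> \<exists>d\<in>S. isomorphic C x d"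
proof -
  obtain R where R: "finite R" "R \<subseteq> Obj C" "\<And>x. simple C x \<Longrightarrow> \<exists>y\<in>R. isomorphic C x y"
    using finitely_many_simples by blast
  define P where "P y x \<longleftrightarrow> simple C x \<and> isomorphic C x y" for y x
  define S where "S = (\<lambda>y. SOME x. P y x) ` {y \<in> R. \<exists>x. P y x}"
  have some: "P y (SOME x. P y x)" if "\<exists>x. P y x" for y using someI_ex[OF that] .
  show ?thesis
  proof (rule that[of S])
    show "finite S" using R(1) by (simp add: S_def)
    show "simple C d" if "d \<in> S" for d using that some by (auto simp: S_def P_def)
    show "d = d'" if d: "d \<in> S" "d' \<in> S" "isomorphic C d d'" for d d'
    proof -
      obtain y y' where y: "\<exists>x. P y x" "d = (SOME x. P y x)" "\<exists>x. P y' x" "d' = (SOME x. P y' x)"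
        using d by (auto simp: S_def)
      have "isomorphic C d y" "isomorphic C d' y'" using some y by (auto simp: P_def)
      hence "isomorphic C y y'" using d(3) isomorphic_sym isomorphic_trans by blast
      hence "P y = P y'" unfolding P_def fun_eq_iff using isomorphic_sym isomorphic_trans by blast
      thus "d = d'" using y by simp
    qed
    show "\<exists>d\<in>S. isomorphic C x d" if x: "simple C x" for x
    proof -
      obtain y where y: "y \<in> R" "isomorphic C x y" using R(3)[OF x] by blast
      hence ex: "\<exists>x. P y x" using x by (auto simp: P_def)
      have "isomorphic C (SOME x. P y x) y" using some[OF ex] by (simp add: P_def)
      thus ?thesis using y ex isomorphic_sym isomorphic_trans unfolding S_def by blast
    qed
  qed
qed

context internal_endomorphisms
begin

text \<open>Let \<open>n\<close> be a simple summand of \<open>c \<triangleright> m\<close>, cut out by the idempotent \<open>\<iota> \<pi>\<close>, and let \<open>G\<close> be the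
  corresponding idempotent of the free module \<open>c \<otimes> A\<close>. It acts on \<open>Hom(d, c \<otimes> A) = Hom(d \<triangleright> m, c \<triangleright> m)\<close>
  as the projection onto \<open>Hom(d \<triangleright> m, n)\<close>. Both sides below are its trace: on the left computed in the
  basis \<open>\<beta> j\<close> of inclusions of \<open>d\<close> into \<open>c \<otimes> A\<close>, on the right in the basis of \<open>Hom(d \<triangleright> m, n)\<close> that
  comes from the decomposition of \<open>d \<triangleright> m\<close>.\<close>

lemma multiplicity_as_trace:
  assumes c: "c \<in> Obj C" and g: "g \<in> Hom C c (c \<otimes>\<^sub>O A)"
    and n: "simple M n" and \<iota>: "\<iota> \<in> Hom M n (c \<rhd>\<^sub>O m)" and \<pi>: "\<pi> \<in> Hom M (c \<rhd>\<^sub>O m) n"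
    and \<pi>\<iota>: "\<pi> \<cdot>\<^sub>M \<iota> = idM n" and g_eq: "free_map c g = \<iota> \<cdot>\<^sub>M \<pi>"
    and d: "simple C d" and dsM: "direct_sum M L X (d \<rhd>\<^sub>O m) i p" and X: "\<And>l. l < L \<Longrightarrow> simple M (X l)"
    and dsC: "direct_sum C N D (c \<otimes>\<^sub>O A) \<beta> \<beta>'" and D: "\<And>j. j < N \<Longrightarrow> simple C (D j)"
    and D_iso: "\<And>j. j < N \<Longrightarrow> isomorphic C (D j) d \<Longrightarrow> D j = d"
  defines "G \<equiv> (idC c \<otimes>\<^sub>C \<mu>) \<cdot>\<^sub>C (g \<otimes>\<^sub>C idA)"
  shows "(\<Sum>j | j < N \<and> D j = d. eigenvalue C d (\<beta>' j \<cdot>\<^sub>C G \<cdot>\<^sub>C \<beta> j))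
    = of_nat (card {l. l < L \<and> isomorphic M (X l) n})"
proof -
  let ?x = "c \<otimes>\<^sub>O A" and ?J = "{j. j < N \<and> D j = d}" and ?L = "{l. l < L \<and> isomorphic M (X l) n}"
  have d' [simp]: "d \<in> Obj C" using C.simple_obj[OF d] by simp
  have n' [simp]: "n \<in> Obj M" using M.simple_obj[OF n] by simp
  have x [simp]: "?x \<in> Obj C" using c by (simp add: C.tarr)
  have dm [simp]: "d \<rhd>\<^sub>O m \<in> Obj M" "c \<rhd>\<^sub>O m \<in> Obj M" using c by (simp_all add: marr)
  note [simp] = c in_HomD[OF g] in_HomD[OF \<iota>] in_HomD[OF \<pi>]
  note SM = M.direct_sumD[OF dsM] and SC = C.direct_sumD[OF dsC]
  have G: "G \<in> Hom C ?x ?x" unfolding G_def by (simp add: C.tarr in_Hom_iff cong: typing_cong)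
  note [simp] = in_HomD[OF G]
  \<comment> \<open>The inverse of \<open>free_map\<close> on \<open>Hom(d \<triangleright> m, c \<triangleright> m)\<close>.\<close>
  define F where "F = inv_into (carrier (hom_module C d ?x)) (free_map c)"
  have bij: "bij_betw (free_map c) (carrier (hom_module C d ?x)) (carrier (hom_module M (d \<rhd>\<^sub>O m) (c \<rhd>\<^sub>O m)))"
  proof (rule bij_betwI')
    show "(free_map c h = free_map c h') = (h = h')"
      if "h \<in> carrier (hom_module C d ?x)" "h' \<in> carrier (hom_module C d ?x)" for h h'
      using free_map_inj[OF _ _ c] that by auto
    show "free_map c h \<in> carrier (hom_module M (d \<rhd>\<^sub>O m) (c \<rhd>\<^sub>O m))"
      if "h \<in> carrier (hom_module C d ?x)" for h
      using free_map_in[OF _ c] that by simp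
    show "\<exists>h\<in>carrier (hom_module C d ?x). H = free_map c h"
      if "H \<in> carrier (hom_module M (d \<rhd>\<^sub>O m) (c \<rhd>\<^sub>O m))" for H
      using free_map_surj[OF _ d' c] that by force
  qed
  have lin_F: "linear_map (hom_module M (d \<rhd>\<^sub>O m) (c \<rhd>\<^sub>O m)) (hom_module C d ?x) F"
    unfolding F_def by (rule linear_map_inv_into[OF C.module_Hom[OF d' x] linear_free_map[OF d' c] bij])
  have F_free: "F (free_map c h) = h" if "h \<in> Hom C d ?x" for h
    unfolding F_def using bij that by (simp add: bij_betw_def inv_into_f_f)
  have free_F: "free_map c (F H) = H" if "H \<in> Hom M (d \<rhd>\<^sub>O m) (c \<rhd>\<^sub>O m)" for H
    unfolding F_def using bij that by (simp add: bij_betw_def f_inv_into_f)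
  define iso_pair where "iso_pair l f h \<longleftrightarrow> f \<in> Hom M (X l) n \<and> h \<in> Hom M n (X l) \<and>
      h \<cdot>\<^sub>M f = idM (X l) \<and> f \<cdot>\<^sub>M h = idM n" for l f h
  have "\<exists>f h. iso_pair l f h" if "l \<in> ?L" for l
  proof -
    have "isomorphic M (X l) n" using that by simp
    then obtain f h where "f \<in> Hom M (X l) n" "h \<in> Hom M n (X l)" "h \<cdot>\<^sub>M f = idM (X l)"
        "f \<cdot>\<^sub>M h = idM n" by (rule M.isomorphicE)
    thus ?thesis unfolding iso_pair_def by blast
  qed
  hence "\<forall>l\<in>?L. \<exists>vw. iso_pair l (fst vw) (snd vw)" by simp
  then obtain vw where "\<forall>l\<in>?L. iso_pair l (fst (vw l)) (snd (vw l))" using bchoice by meson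
  then obtain v w where vw: "\<And>l. l \<in> ?L \<Longrightarrow> iso_pair l (v l) (w l)"
    using that[of "\<lambda>l. fst (vw l)" "\<lambda>l. snd (vw l)"] by blast
  have vw: "v l \<in> Hom M (X l) n" "w l \<in> Hom M n (X l)" "w l \<cdot>\<^sub>M v l = idM (X l)" "v l \<cdot>\<^sub>M w l = idM n"
    if "l \<in> ?L" for l using vw[OF that] unfolding iso_pair_def by blast+
  define W where "W l = F (\<iota> \<cdot>\<^sub>M (v l \<cdot>\<^sub>M p l))" for l
  have vp: "\<iota> \<cdot>\<^sub>M (v l \<cdot>\<^sub>M p l) \<in> Hom M (d \<rhd>\<^sub>O m) (c \<rhd>\<^sub>O m)" if "l \<in> ?L" for l
    using M.comp_in[OF M.comp_in[OF SM(4) vw(1)[OF that]] \<iota>] that by simp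
  have W: "W l \<in> Hom C d ?x" "free_map c (W l) = \<iota> \<cdot>\<^sub>M (v l \<cdot>\<^sub>M p l)" if "l \<in> ?L" for l
    using linear_map_closed[OF lin_F, of "\<iota> \<cdot>\<^sub>M (v l \<cdot>\<^sub>M p l)"] free_F vp[OF that] by (simp_all add: W_def)
  \<comment> \<open>The composites of \<open>\<pi>\<close> with the \<open>\<beta> j\<close> have the matrix \<open>a\<close> in the basis \<open>v l p l\<close>, whose images \<open>W l\<close>
    have the matrix \<open>b\<close> in the basis \<open>\<beta> j\<close>. Then \<open>b a\<close> is an identity matrix, and \<open>a b\<close> is the matrix
    of \<open>G\<close>.\<close>
  define a where "a j l = eigenvalue M n (\<pi> \<cdot>\<^sub>M free_map c (\<beta> j) \<cdot>\<^sub>M (i l \<cdot>\<^sub>M w l))" for j l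
  define b where "b l j = eigenvalue C d (\<beta>' j \<cdot>\<^sub>C W l)" for l j
  have \<beta>: "\<beta> j \<in> Hom C d ?x" "\<beta>' j \<in> Hom C ?x d" "free_map c (\<beta> j) \<in> Hom M (d \<rhd>\<^sub>O m) (c \<rhd>\<^sub>O m)"
    if "j \<in> ?J" for j
    using SC(3,4)[of j] that free_map_in[OF _ c, of "\<beta> j" d] by auto
  have entry: "eigenvalue C d (\<beta>' j \<cdot>\<^sub>C G \<cdot>\<^sub>C \<beta> j) = (\<Sum>l\<in>?L. a j l * b l j)" if j: "j \<in> ?J" for j
  proof -
    note \<beta>j = \<beta>[OF j]
    note [simp] = in_HomD[OF \<beta>j(1)] in_HomD[OF \<beta>j(2)] in_HomD[OF \<beta>j(3)]
    define H where "H = \<iota> \<cdot>\<^sub>M (\<pi> \<cdot>\<^sub>M free_map c (\<beta> j))"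
    have H: "H \<in> Hom M (d \<rhd>\<^sub>O m) (c \<rhd>\<^sub>O m)" unfolding H_def by (simp add: M.arr in_Hom_iff)
    have G\<beta>: "G \<cdot>\<^sub>C \<beta> j \<in> Hom C d ?x" by (rule C.comp_in[OF \<beta>j(1) G])
    have "free_map c (G \<cdot>\<^sub>C \<beta> j) = free_map c g \<cdot>\<^sub>M free_map c (\<beta> j)"
      using free_map_comp[OF \<beta>j(1) g c] unfolding G_def
      by (simp add: C.tarr C.comp_assoc_arr cong: typing_cong)
    also have "\<dots> = H" unfolding g_eq H_def by (simp add: M.arr M.comp_assoc_arr)
    finally have FH: "F H = G \<cdot>\<^sub>C \<beta> j" using F_free[OF G\<beta>] by simp
    define \<Phi> where "\<Phi> h = eigenvalue C d (\<beta>' j \<cdot>\<^sub>C F (H \<cdot>\<^sub>M h))" for h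
    have lin: "linear_map (hom_module M (d \<rhd>\<^sub>O m) (d \<rhd>\<^sub>O m)) complex_module \<Phi>"
      unfolding \<Phi>_def[abs_def]
      by (rule linear_map_comp[OF linear_map_comp[OF linear_map_comp[OF
                M.comp_linear_right[OF H dm(1)] lin_F]
              C.comp_linear_right[OF \<beta>j(2) d']] C.linear_eigenvalue[OF d]])
    have "eigenvalue C d (\<beta>' j \<cdot>\<^sub>C G \<cdot>\<^sub>C \<beta> j) = \<Phi> (idM (d \<rhd>\<^sub>O m))"
      unfolding \<Phi>_def M.comp_ident_right[OF H] FH by (simp add: C.arr C.comp_assoc_arr)
    also have "\<dots> = (\<Sum>l<L. \<Phi> (i l \<cdot>\<^sub>M p l))" by (rule M.direct_sum_functional[OF dsM lin])
    also have "\<dots> = (\<Sum>l<L. if isomorphic M (X l) n then a j l * b l j else 0)"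
    proof (rule sum.cong[OF refl])
      fix l assume "l \<in> {..<L}"
      hence l: "l < L" by simp
      note ip = SM(3)[OF l] SM(4)[OF l]
      note [simp] = in_HomD[OF ip(1)] in_HomD[OF ip(2)]
      define s where "s = \<pi> \<cdot>\<^sub>M free_map c (\<beta> j) \<cdot>\<^sub>M i l"
      have s: "s \<in> Hom M (X l) n" unfolding s_def by (simp add: M.arr in_Hom_iff)
      have Hs: "H \<cdot>\<^sub>M (i l \<cdot>\<^sub>M p l) = \<iota> \<cdot>\<^sub>M (s \<cdot>\<^sub>M p l)"
        unfolding H_def s_def by (simp add: M.arr M.comp_assoc_arr cong: typing_cong)
      show "\<Phi> (i l \<cdot>\<^sub>M p l) = (if isomorphic M (X l) n then a j l * b l j else 0)"
      proof (cases "isomorphic M (X l) n")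
        case True
        hence lL: "l \<in> ?L" using l by simp
        note vwl = vw[OF lL]
        note [simp] = in_HomD[OF vwl(1)] in_HomD[OF vwl(2)]
        have "eigenvalue M n (s \<cdot>\<^sub>M w l) = a j l"
          unfolding a_def s_def by (simp add: M.arr M.comp_assoc_arr cong: typing_cong)
        hence "s = Scale M (a j l) (v l)" using M.Hom_simple_iso[OF n vwl(1,2,3) s] by simp
        hence "H \<cdot>\<^sub>M (i l \<cdot>\<^sub>M p l) = Scale M (a j l) (\<iota> \<cdot>\<^sub>M (v l \<cdot>\<^sub>M p l))"
          unfolding Hs by (simp add: M.arr M.comp_scale cong: typing_cong)
        hence "F (H \<cdot>\<^sub>M (i l \<cdot>\<^sub>M p l)) = Scale C (a j l) (W l)"
          using linear_map_smult[OF lin_F, of _ "a j l"] vp[OF lL] by (simp add: W_def)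
        hence "\<beta>' j \<cdot>\<^sub>C F (H \<cdot>\<^sub>M (i l \<cdot>\<^sub>M p l)) = Scale C (a j l) (\<beta>' j \<cdot>\<^sub>C W l)"
          using in_HomD[OF W(1)[OF lL]] by (simp add: C.comp_scale)
        thus ?thesis
          using True linear_map_smult[OF C.linear_eigenvalue[OF d], of "\<beta>' j \<cdot>\<^sub>C W l" "a j l"]
            C.comp_in[OF W(1)[OF lL] \<beta>j(2)] by (simp add: \<Phi>_def b_def)
      next
        case False
        have "s = Zero M (X l) n" by (rule M.Hom_simple_not_iso[OF X[OF l] n False s])
        hence "H \<cdot>\<^sub>M (i l \<cdot>\<^sub>M p l) = Zero M (d \<rhd>\<^sub>O m) (c \<rhd>\<^sub>O m)"
          unfolding Hs using M.comp_zero(1)[OF ip(2) n'] M.comp_zero(2)[OF \<iota> dm(1)] by simp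
        hence "F (H \<cdot>\<^sub>M (i l \<cdot>\<^sub>M p l)) = Zero C d ?x"
          using linear_map_zero[OF M.module_Hom[OF dm] C.module_Hom[OF d' x] lin_F] by simp
        thus ?thesis
          using False C.comp_zero(2)[OF \<beta>j(2) d'] C.eigenvalue_zero[OF d] by (simp add: \<Phi>_def)
      qed
    qed
    also have "\<dots> = (\<Sum>l\<in>?L. a j l * b l j)"
      by (rule sum.mono_neutral_cong_right) auto
    finally show ?thesis .
  qed
  have unit: "(\<Sum>j\<in>?J. a j l * b l j) = 1" if l: "l \<in> ?L" for l
  proof -
    note vwl = vw[OF l] and Wl = W[OF l]
    have ip: "i l \<in> Hom M (X l) (d \<rhd>\<^sub>O m)" "p l \<in> Hom M (d \<rhd>\<^sub>O m) (X l)" "p l \<cdot>\<^sub>M i l = idM (X l)"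
      using SM(3,4,5) l by auto
    note [simp] = in_HomD[OF vwl(1)] in_HomD[OF vwl(2)] in_HomD[OF ip(1)] in_HomD[OF ip(2)] in_HomD[OF Wl(1)]
    have iw: "i l \<cdot>\<^sub>M w l \<in> Hom M n (d \<rhd>\<^sub>O m)" by (rule M.comp_in[OF vwl(2) ip(1)])
    define \<Psi> where "\<Psi> h = eigenvalue M n (\<pi> \<cdot>\<^sub>M free_map c (h \<cdot>\<^sub>C W l) \<cdot>\<^sub>M (i l \<cdot>\<^sub>M w l))" for h
    have lin: "linear_map (hom_module C ?x ?x) complex_module \<Psi>"
      unfolding \<Psi>_def[abs_def]
      by (rule linear_map_comp[OF linear_map_comp[OF linear_map_comp[OF linear_map_comp[OF
                  C.comp_linear_left[OF Wl(1) x] linear_free_map[OF d' c]]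
                M.comp_linear_right[OF \<pi> dm(1)]] M.comp_linear_left[OF iw n']] M.linear_eigenvalue[OF n]])
    have "\<pi> \<cdot>\<^sub>M (\<iota> \<cdot>\<^sub>M (v l \<cdot>\<^sub>M p l)) \<cdot>\<^sub>M (i l \<cdot>\<^sub>M w l) = idM n"
      by (simp add: M.arr M.comp_assoc_arr \<pi>\<iota>[THEN M.comp_eq_assoc] ip(3)[THEN M.comp_eq_assoc] vwl(4)
          cong: typing_cong)
    hence "1 = \<Psi> (idC ?x)"
      unfolding \<Psi>_def C.comp_ident_left[OF Wl(1)] Wl(2) using M.eigenvalue_ident[OF n] by simp
    also have "\<dots> = (\<Sum>j<N. \<Psi> (\<beta> j \<cdot>\<^sub>C \<beta>' j))" by (rule C.direct_sum_functional[OF dsC lin])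
    also have "\<dots> = (\<Sum>j<N. if D j = d then a j l * b l j else 0)"
    proof (rule sum.cong[OF refl])
      fix j assume "j \<in> {..<N}"
      hence j: "j < N" by simp
      note \<beta>j = SC(3)[OF j] SC(4)[OF j]
      note [simp] = in_HomD[OF \<beta>j(1)] in_HomD[OF \<beta>j(2)]
      have assoc: "\<beta> j \<cdot>\<^sub>C \<beta>' j \<cdot>\<^sub>C W l = \<beta> j \<cdot>\<^sub>C (\<beta>' j \<cdot>\<^sub>C W l)" by (simp add: C.arr C.comp_assoc_arr)
      have bW: "\<beta>' j \<cdot>\<^sub>C W l \<in> Hom C d (D j)" by (rule C.comp_in[OF Wl(1) \<beta>j(2)])
      show "\<Psi> (\<beta> j \<cdot>\<^sub>C \<beta>' j) = (if D j = d then a j l * b l j else 0)"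
      proof (cases "D j = d")
        case True
        hence jJ: "j \<in> ?J" using j by simp
        note \<beta>d = \<beta>[OF jJ]
        have "\<beta>' j \<cdot>\<^sub>C W l = Scale C (b l j) (idC d)"
          unfolding b_def using C.eigenvalue[OF d] bW True by simp
        hence "\<beta> j \<cdot>\<^sub>C \<beta>' j \<cdot>\<^sub>C W l = Scale C (b l j) (\<beta> j)"
          unfolding assoc using True by (simp add: C.arr C.comp_scale)
        hence "free_map c (\<beta> j \<cdot>\<^sub>C \<beta>' j \<cdot>\<^sub>C W l) = Scale M (b l j) (free_map c (\<beta> j))"
          using linear_map_smult[OF linear_free_map[OF d' c], of "\<beta> j" "b l j"] \<beta>d(1) by simp
        hence "\<pi> \<cdot>\<^sub>M free_map c (\<beta> j \<cdot>\<^sub>C \<beta>' j \<cdot>\<^sub>C W l) \<cdot>\<^sub>M (i l \<cdot>\<^sub>M w l)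
            = Scale M (b l j) (\<pi> \<cdot>\<^sub>M free_map c (\<beta> j) \<cdot>\<^sub>M (i l \<cdot>\<^sub>M w l))"
          using in_HomD[OF \<beta>d(3)] by (simp add: M.arr M.comp_scale cong: typing_cong)
        moreover have "\<pi> \<cdot>\<^sub>M free_map c (\<beta> j) \<cdot>\<^sub>M (i l \<cdot>\<^sub>M w l) \<in> Hom M n n"
          by (rule M.comp_in[OF iw M.comp_in[OF \<beta>d(3) \<pi>]])
        ultimately show ?thesis
          using True linear_map_smult[OF M.linear_eigenvalue[OF n], of _ "b l j"] by (simp add: \<Psi>_def a_def)
      next
        case False
        hence "\<not> isomorphic C d (D j)" using D_iso[OF j] C.isomorphic_sym by blast
        hence "\<beta>' j \<cdot>\<^sub>C W l = Zero C d (D j)" by (rule C.Hom_simple_not_iso[OF d D[OF j] _ bW])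
        hence "\<beta> j \<cdot>\<^sub>C \<beta>' j \<cdot>\<^sub>C W l = Zero C d ?x"
          unfolding assoc using C.comp_zero(2)[OF \<beta>j(1) d'] by simp
        hence "free_map c (\<beta> j \<cdot>\<^sub>C \<beta>' j \<cdot>\<^sub>C W l) = Zero M (d \<rhd>\<^sub>O m) (c \<rhd>\<^sub>O m)"
          using linear_map_zero[OF C.module_Hom[OF d' x] M.module_Hom[OF dm] linear_free_map[OF d' c]] by simp
        thus ?thesis
          using False M.comp_zero(2)[OF \<pi> dm(1)] M.comp_zero(1)[OF iw n'] M.eigenvalue_zero[OF n]
          by (simp add: \<Psi>_def)
      qed
    qed
    also have "\<dots> = (\<Sum>j\<in>?J. a j l * b l j)"
      by (rule sum.mono_neutral_cong_right) auto
    finally show ?thesis by simp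
  qed
  have "(\<Sum>j\<in>?J. eigenvalue C d (\<beta>' j \<cdot>\<^sub>C G \<cdot>\<^sub>C \<beta> j)) = (\<Sum>j\<in>?J. \<Sum>l\<in>?L. a j l * b l j)"
    using entry by (intro sum.cong) auto
  also have "\<dots> = (\<Sum>l\<in>?L. \<Sum>j\<in>?J. a j l * b l j)" by (rule sum.swap)
  also have "\<dots> = (\<Sum>l\<in>?L. 1)" using unit by (intro sum.cong) auto
  finally show ?thesis by simp
qed

end

section \<open>Positivity of the dimension\<close>

text \<open>If \<open>T\<close> is constant on classes and, up to the factor \<open>q\<close>, its value is the sum of \<open>\<delta>\<close> over the
  class, then summing over one representative of each class gives the claim; instead of choosing
  representatives, every index is weighted with the inverse of the size of its class.\<close>

lemma class_sum:
  fixes T \<delta> :: "'i \<Rightarrow> complex"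
  assumes J: "finite J" and refl: "\<And>i. i \<in> J \<Longrightarrow> r i i"
    and sym: "\<And>i j. r i j \<Longrightarrow> r j i" and trans: "\<And>i j k. r i j \<Longrightarrow> r j k \<Longrightarrow> r i k"
    and T: "\<And>i j. i \<in> J \<Longrightarrow> j \<in> J \<Longrightarrow> r i j \<Longrightarrow> T i = T j"
    and \<delta>: "\<And>i. i \<in> J \<Longrightarrow> T i * q = (\<Sum>j | j \<in> J \<and> r j i. \<delta> j)"
  shows "q * of_real (\<Sum>i\<in>J. (cmod (T i))\<^sup>2 / real (card {j \<in> J. r j i})) = (\<Sum>j\<in>J. \<delta> j * cnj (T j))"
proof -
  let ?c = "\<lambda>i. of_nat (card {j \<in> J. r j i}) :: complex"
  have cls: "{j' \<in> J. r j' i} = {j' \<in> J. r j' j}" if "r j i" for i j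
    using that sym trans by blast
  have pos: "?c i \<noteq> 0" if "i \<in> J" for i
    using J refl that by (auto simp: card_eq_0_iff)
  have "q * of_real (\<Sum>i\<in>J. (cmod (T i))\<^sup>2 / real (card {j \<in> J. r j i})) = (\<Sum>i\<in>J. T i * q * cnj (T i) / ?c i)"
    by (simp add: sum_distrib_left complex_norm_square mult_ac del: of_real_power)
  also have "\<dots> = (\<Sum>i\<in>J. \<Sum>j | j \<in> J \<and> r j i. \<delta> j * cnj (T i) / ?c i)"
    using \<delta> by (intro sum.cong) (simp_all add: sum_distrib_right sum_divide_distrib)
  also have "\<dots> = (\<Sum>i\<in>J. \<Sum>j | j \<in> J \<and> r j i. \<delta> j * cnj (T j) / ?c j)"
    using T cls by (intro sum.cong refl) auto
  also have "\<dots> = (\<Sum>j\<in>J. \<Sum>i | i \<in> J \<and> r j i. \<delta> j * cnj (T j) / ?c j)"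
    by (rule sum.swap_restrict[OF J J])
  also have "\<dots> = (\<Sum>j\<in>J. \<delta> j * cnj (T j))"
  proof (rule sum.cong[OF HOL.refl])
    fix j assume j: "j \<in> J"
    have "{i. i \<in> J \<and> r j i} = {i \<in> J. r i j}" using sym by blast
    thus "(\<Sum>i | i \<in> J \<and> r j i. \<delta> j * cnj (T j) / ?c j) = \<delta> j * cnj (T j)"
      using pos[OF j] by simp
  qed
  finally show ?thesis .
qed

context simple_internal_endomorphisms
begin

lemma module_trace_ident_iso:
  assumes "isomorphic M x y"
  shows "\<Theta> x (idM x) = \<Theta> y (idM y)"
proof -
  obtain f g where "f \<in> Hom M x y" "g \<in> Hom M y x" "g \<cdot>\<^sub>M f = idM x" "f \<cdot>\<^sub>M g = idM y"
    using M.isomorphicE[OF assms] .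
  thus ?thesis using trace_symmetric[of f x y g] by simp
qed

text \<open>Let \<open>T n\<close> be the trace of the identity of a simple object \<open>n\<close>. Decomposing \<open>d \<triangleright> m\<close> for the
  simple objects \<open>d\<close> of \<open>C\<close> gives \<open>dim d \<sqdot> T m = \<Sum> T n\<close>, over the summands. The left trace of the
  idempotent of \<open>c \<otimes> A\<close> that belongs to a summand \<open>n\<close> of \<open>c \<triangleright> m\<close> is computed in two ways: it is
  \<open>(T n / T m) dim A\<close>, and it is the sum of \<open>dim d\<close> over all occurrences of \<open>n\<close> in the \<open>d \<triangleright> m\<close>.
  Multiplying by the conjugate of \<open>T n\<close> and summing over \<open>n\<close>, one gets
  \<open>dim A \<sqdot> \<Sum>\<^sub>n |T n|\<^sup>2 = |T m|\<^sup>2 \<sqdot> \<Sum>\<^sub>d |dim d|\<^sup>2\<close>, whose right hand side is positive.\<close>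

lemma dimension_positive: "C.trace A idA \<in> \<real>" "0 < Re (C.trace A idA)"
proof -
  obtain S where S: "finite S" "\<And>d. d \<in> S \<Longrightarrow> simple C d"
    "\<And>d d'. d \<in> S \<Longrightarrow> d' \<in> S \<Longrightarrow> isomorphic C d d' \<Longrightarrow> d = d'"
    "\<And>x. simple C x \<Longrightarrow> \<exists>d\<in>S. isomorphic C x d"
    using C.simple_representatives by metis
  have S_obj: "d \<in> Obj C" if "d \<in> S" for d using C.simple_obj[OF S(2)[OF that]] by simp
  have dm: "d \<rhd>\<^sub>O m \<in> Obj M" if "d \<in> S" for d using S_obj[OF that] by (simp add: actO_in)
  have "\<exists>n X \<iota> \<pi>. d \<in> S \<longrightarrow> (\<forall>k<n. simple M (X k)) \<and> direct_sum M n X (d \<rhd>\<^sub>O m) \<iota> \<pi>" for d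
    using M.semisimple[OF dm] by blast
  then obtain n X \<iota> \<pi> where "\<And>d. d \<in> S \<longrightarrow> (\<forall>k<n d. simple M (X d k)) \<and>
      direct_sum M (n d) (X d) (d \<rhd>\<^sub>O m) (\<iota> d) (\<pi> d)" by metis
  hence X: "\<And>d k. d \<in> S \<Longrightarrow> k < n d \<Longrightarrow> simple M (X d k)"
    and ds: "\<And>d. d \<in> S \<Longrightarrow> direct_sum M (n d) (X d) (d \<rhd>\<^sub>O m) (\<iota> d) (\<pi> d)" by auto
  define dim where "dim d = C.trace d (idC d)" for d
  define T where "T i = \<Theta> (X (fst i) (snd i)) (idM (X (fst i) (snd i)))" for i
  define r where "r i j \<longleftrightarrow> isomorphic M (X (fst i) (snd i)) (X (fst j) (snd j))" for i j
  define J where "J = Sigma S (\<lambda>d. {..<n d})"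
  have J: "finite J" using S(1) by (simp add: J_def)
  have trace_summand: "\<Theta> (d \<rhd>\<^sub>O m) (\<iota> d k \<cdot>\<^sub>M \<pi> d k) = T (d, k)" if "d \<in> S" "k < n d" for d k
  proof -
    note D = M.direct_sumD[OF ds[OF that(1)]]
    show ?thesis using trace_symmetric[OF D(4,3)] D(5) that by (simp add: T_def)
  qed
  have dim_T: "t * dim d = (\<Sum>k<n d. T (d, k))" if d: "d \<in> S" for d
  proof -
    have "t * dim d = \<Theta> (d \<rhd>\<^sub>O m) (idM (d \<rhd>\<^sub>O m))"
      using module_trace_act[OF C.ident_in[OF S_obj[OF d]]] S_obj[OF d] by (simp add: dim_def actM_ident)
    also have "\<dots> = (\<Sum>k<n d. \<Theta> (d \<rhd>\<^sub>O m) (\<iota> d k \<cdot>\<^sub>M \<pi> d k))"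
      by (rule M.direct_sum_functional[OF ds[OF d] trace_linear[OF dm[OF d]]])
    finally show ?thesis using trace_summand[OF d] by simp
  qed
  define Q where "Q = C.trace A idA / t"
  have key: "T i * Q = (\<Sum>j | j \<in> J \<and> r j i. dim (fst j))" if i: "i \<in> J" for i
  proof -
    obtain c k where ck: "i = (c, k)" "c \<in> S" "k < n c" using i by (auto simp: J_def)
    note c = S_obj[OF ck(2)]
    note Dc = M.direct_sumD[OF ds[OF ck(2)]]
    have \<iota>: "\<iota> c k \<in> Hom M (X c k) (c \<rhd>\<^sub>O m)" and \<pi>: "\<pi> c k \<in> Hom M (c \<rhd>\<^sub>O m) (X c k)"
      and \<pi>\<iota>: "\<pi> c k \<cdot>\<^sub>M \<iota> c k = idM (X c k)" using Dc(3,4,5) ck(3) by auto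
    obtain g where g: "g \<in> Hom C c (c \<otimes>\<^sub>O A)" "free_map c g = \<iota> c k \<cdot>\<^sub>M \<pi> c k"
      using free_map_surj[OF M.comp_in[OF \<pi> \<iota>] c c] by blast
    define G where "G = (idC c \<otimes>\<^sub>C \<mu>) \<cdot>\<^sub>C (g \<otimes>\<^sub>C idA)"
    let ?x = "c \<otimes>\<^sub>O A"
    have x: "?x \<in> Obj C" using c by (simp add: C.tarr)
    have G: "G \<in> Hom C ?x ?x"
      unfolding G_def using c in_HomD[OF g(1)] by (simp add: C.tarr in_Hom_iff cong: typing_cong)
    have lhs: "T i * Q = C.trace ?x G"
      unfolding G_def trace_free_module[OF g(1) c] g(2) trace_summand[OF ck(2,3)] ck(1) Q_def by simp
    obtain N D \<beta> \<beta>' where dsC: "direct_sum C N D ?x \<beta> \<beta>'" and D: "\<And>j. j < N \<Longrightarrow> D j \<in> S"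
      using C.direct_sum_over_representatives[OF S(4) x] by blast
    note SC = C.direct_sumD[OF dsC]
    have lin: "linear_map (hom_module C ?x ?x) complex_module (\<lambda>h. C.trace ?x (G \<cdot>\<^sub>C h))"
      by (rule linear_map_comp[OF C.comp_linear_right[OF G x] C.linear_trace[OF x]])
    have "C.trace ?x G = (\<Sum>j<N. C.trace ?x (G \<cdot>\<^sub>C (\<beta> j \<cdot>\<^sub>C \<beta>' j)))"
      using C.direct_sum_functional[OF dsC lin] C.comp_ident_right[OF G] by simp
    also have "\<dots> = (\<Sum>j<N. eigenvalue C (D j) (\<beta>' j \<cdot>\<^sub>C G \<cdot>\<^sub>C \<beta> j) * dim (D j))"
    proof (rule sum.cong[OF refl])
      fix j assume "j \<in> {..<N}"
      hence j: "j < N" by simp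
      note [simp] = in_HomD[OF SC(3)[OF j]] in_HomD[OF SC(4)[OF j]] in_HomD[OF G]
      define s where "s = \<beta>' j \<cdot>\<^sub>C G \<cdot>\<^sub>C \<beta> j"
      have G\<beta>: "G \<cdot>\<^sub>C \<beta> j \<in> Hom C (D j) ?x" by (rule C.comp_in[OF SC(3)[OF j] G])
      have s: "s \<in> Hom C (D j) (D j)" unfolding s_def by (simp add: C.arr in_Hom_iff)
      have "C.trace ?x (G \<cdot>\<^sub>C (\<beta> j \<cdot>\<^sub>C \<beta>' j)) = C.trace ?x (G \<cdot>\<^sub>C \<beta> j \<cdot>\<^sub>C \<beta>' j)"
        by (simp add: C.arr C.comp_assoc_arr)
      also have "\<dots> = C.trace (D j) (\<beta>' j \<cdot>\<^sub>C (G \<cdot>\<^sub>C \<beta> j))" by (rule trace_cyclic[OF SC(4)[OF j] G\<beta>])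
      also have "\<beta>' j \<cdot>\<^sub>C (G \<cdot>\<^sub>C \<beta> j) = Scale C (eigenvalue C (D j) s) (idC (D j))"
        using C.eigenvalue[OF S(2)[OF D[OF j]] s] unfolding s_def by (simp add: C.arr C.comp_assoc_arr)
      also have "C.trace (D j) \<dots> = eigenvalue C (D j) s * dim (D j)"
        using linear_map_smult[OF C.linear_trace[OF SC(2)[OF j]], of "idC (D j)"] C.ident_in[OF SC(2)[OF j]]
        by (simp add: dim_def)
      finally show "C.trace ?x (G \<cdot>\<^sub>C (\<beta> j \<cdot>\<^sub>C \<beta>' j)) = eigenvalue C (D j) (\<beta>' j \<cdot>\<^sub>C G \<cdot>\<^sub>C \<beta> j) * dim (D j)"
        unfolding s_def .
    qed
    also have "\<dots> = (\<Sum>d\<in>S. \<Sum>j | j < N \<and> D j = d. eigenvalue C (D j) (\<beta>' j \<cdot>\<^sub>C G \<cdot>\<^sub>C \<beta> j) * dim (D j))"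
      using sum.group[of "{..<N}" S D "\<lambda>j. eigenvalue C (D j) (\<beta>' j \<cdot>\<^sub>C G \<cdot>\<^sub>C \<beta> j) * dim (D j)"] S(1) D
      by (auto simp: image_subset_iff)
    also have "\<dots> = (\<Sum>d\<in>S. \<Sum>l | l < n d \<and> isomorphic M (X d l) (X c k). dim d)"
    proof (rule sum.cong[OF refl])
      fix d assume d: "d \<in> S"
      have "(\<Sum>j | j < N \<and> D j = d. eigenvalue C (D j) (\<beta>' j \<cdot>\<^sub>C G \<cdot>\<^sub>C \<beta> j) * dim (D j))
          = (\<Sum>j | j < N \<and> D j = d. eigenvalue C d (\<beta>' j \<cdot>\<^sub>C G \<cdot>\<^sub>C \<beta> j)) * dim d"
        unfolding sum_distrib_right by (intro sum.cong) auto
      also have "(\<Sum>j | j < N \<and> D j = d. eigenvalue C d (\<beta>' j \<cdot>\<^sub>C G \<cdot>\<^sub>C \<beta> j))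
          = of_nat (card {l. l < n d \<and> isomorphic M (X d l) (X c k)})"
        unfolding G_def
        by (rule multiplicity_as_trace[OF c g(1) X[OF ck(2,3)] \<iota> \<pi> \<pi>\<iota> g(2) S(2)[OF d] ds[OF d]
              X[OF d] dsC S(2)[OF D] S(3)[OF D d]])
      finally show "(\<Sum>j | j < N \<and> D j = d. eigenvalue C (D j) (\<beta>' j \<cdot>\<^sub>C G \<cdot>\<^sub>C \<beta> j) * dim (D j))
          = (\<Sum>l | l < n d \<and> isomorphic M (X d l) (X c k). dim d)" by simp
    qed
    also have "\<dots> = (\<Sum>j\<in>Sigma S (\<lambda>d. {l. l < n d \<and> isomorphic M (X d l) (X c k)}). dim (fst j))"
      using S(1) by (subst sum.Sigma) (auto simp: case_prod_unfold)
    also have "Sigma S (\<lambda>d. {l. l < n d \<and> isomorphic M (X d l) (X c k)}) = {j. j \<in> J \<and> r j i}"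
      by (auto simp: J_def r_def ck(1))
    finally show ?thesis unfolding lhs .
  qed
  define P where "P = (\<Sum>i\<in>J. (cmod (T i))\<^sup>2 / real (card {j \<in> J. r j i}))"
  have "Q * of_real P = (\<Sum>j\<in>J. dim (fst j) * cnj (T j))"
    unfolding P_def
  proof (rule class_sum[OF J])
    show "r i i" if "i \<in> J" for i
    proof -
      have "simple M (X (fst i) (snd i))" using that X by (auto simp: J_def)
      thus ?thesis unfolding r_def using M.isomorphic_refl M.simple_obj by blast
    qed
    show "r i j \<Longrightarrow> r j i" for i j unfolding r_def by (rule M.isomorphic_sym)
    show "r i j \<Longrightarrow> r j k \<Longrightarrow> r i k" for i j k unfolding r_def by (rule M.isomorphic_trans)
    show "T i = T j" if "r i j" for i j using module_trace_ident_iso that by (simp add: r_def T_def)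
  qed (rule key)
  also have "\<dots> = (\<Sum>d\<in>S. \<Sum>k<n d. dim d * cnj (T (d, k)))"
    unfolding J_def using S(1) by (subst sum.Sigma) (auto simp: case_prod_unfold)
  also have "\<dots> = (\<Sum>d\<in>S. dim d * cnj (t * dim d))"
    using dim_T by (intro sum.cong) (simp_all add: sum_distrib_left[symmetric] cnj_sum)
  also have "\<dots> = cnj t * of_real (\<Sum>d\<in>S. (cmod (dim d))\<^sup>2)"
    by (simp add: sum_distrib_left complex_norm_square mult_ac del: of_real_power)
  finally have QP: "Q * of_real P = cnj t * of_real (\<Sum>d\<in>S. (cmod (dim d))\<^sup>2)" .
  define B where "B = (cmod t)\<^sup>2 * (\<Sum>d\<in>S. (cmod (dim d))\<^sup>2)"
  have "C.trace A idA * of_real P = t * (Q * of_real P)" using t_nonzero by (simp add: Q_def)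
  also have "\<dots> = of_real B" unfolding QP B_def by (simp add: complex_norm_square mult_ac del: of_real_power)
  finally have eq: "C.trace A idA * of_real P = of_real B" .
  have "0 < (\<Sum>d\<in>S. (cmod (dim d))\<^sup>2)"
  proof -
    obtain d where d: "d \<in> S" "isomorphic C \<one>\<^sub>C d" using S(4)[OF C.simple_unit] by blast
    obtain f g where "f \<in> Hom C \<one>\<^sub>C d" "g \<in> Hom C d \<one>\<^sub>C" "g \<cdot>\<^sub>C f = idC \<one>\<^sub>C" "f \<cdot>\<^sub>C g = idC d"
      using C.isomorphicE[OF d(2)] .
    hence "dim d = 1" using trace_cyclic[of f "\<one>\<^sub>C" d g] trace_unit_obj by (simp add: dim_def)
    thus ?thesis using S(1) d(1) by (intro sum_pos2[of _ d]) auto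
  qed
  hence B: "0 < B" unfolding B_def using t_nonzero by simp
  have "0 \<le> P" unfolding P_def by (intro sum_nonneg) simp
  moreover have "P \<noteq> 0" using eq B by auto
  ultimately have P: "0 < P" by simp
  have "C.trace A idA = of_real (B / P)" using eq P by (simp add: field_simps)
  thus "C.trace A idA \<in> \<real>" "0 < Re (C.trace A idA)" using B P by simp_all
qed

end

theorem theorem6p6:
  fixes C :: "('o, 'a) pivotal_cat"
    and M :: "('o, 'a, 'p, 'b) mod_cat"
    and \<Theta> :: "'p \<Rightarrow> 'b \<Rightarrow> complex"
    and m :: 'p and H :: 'o and \<alpha> :: "'o \<Rightarrow> 'b \<Rightarrow> 'a"
  assumes "pivotal_fusion_category C"
    and "module_category C M"
    and "module_trace C M \<Theta>"
    and "m \<in> Obj M"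
    and "\<not> zero_object M m"
    and "inner_hom C M m m H \<alpha>"
  shows "(\<exists>\<Delta> \<epsilon>. frobenius_algebra C H (inner_mult C M m H \<alpha>) (inner_unit C M m \<alpha>) \<Delta> \<epsilon>) \<and>
         (simple M m \<longrightarrow>
            (\<exists>\<Delta> \<epsilon>. frobenius_algebra C H (inner_mult C M m H \<alpha>) (inner_unit C M m \<alpha>) \<Delta> \<epsilon> \<and>
                    special C H (inner_mult C M m H \<alpha>) (inner_unit C M m \<alpha>) \<Delta> \<epsilon> \<and>
                    haploid C H \<and> symmetric_form C H (inner_mult C M m H \<alpha>) \<epsilon>) \<and>
            dimension C H \<in> \<real> \<and> 0 < Re (dimension C H))"
proof -
  have traced: "traced_internal_endomorphisms C M m H \<alpha> \<Theta>"
    by (intro traced_internal_endomorphisms.intro internal_endomorphisms.intro assms)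
  then interpret traced_internal_endomorphisms C M m H \<alpha> \<Theta> .
  obtain \<delta> \<Delta> where \<Delta>: "\<Delta> = (idA \<otimes>\<^sub>C \<mu>) \<cdot>\<^sub>C (\<delta> \<otimes>\<^sub>C idA)" "\<Delta> \<cdot>\<^sub>C \<eta> = \<delta>"
    and frob: "frobenius_algebra C H \<mu> \<eta> \<Delta> counit"
    using frobenius_structure by metis
  have "special C H \<mu> \<eta> \<Delta> counit \<and> haploid C H \<and> symmetric_form C H \<mu> counit \<and>
      dimension C H \<in> \<real> \<and> 0 < Re (dimension C H)" if "simple M m"
  proof -
    interpret simple_internal_endomorphisms C M m H \<alpha> \<Theta>
      by (intro simple_internal_endomorphisms.intro traced simple_internal_endomorphisms_axioms.intro that)
    have dim: "dimension C H = C.trace H idA"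
      by (simp add: dimension_def scalar_of_def C.trace_def eigenvalue_def)
    have "C.trace H idA \<noteq> 0" using dimension_positive(2) by auto
    thus ?thesis
      using special_if_dimension_nonzero[OF frob \<Delta>(2,1)] internal_haploid
        symmetric_if_dimension_nonzero dimension_positive dim by simp
  qed
  thus ?thesis using frob by blast
qed

end
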